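(* Let $\Bbbk$ be an algebraically closed field of characteristic $p>0$ and let $\lambda(u)=(\lambda_1(u),\lambda_2(u))$ be a restricted tuple. The irreducible $Y_2^{[p]}$-module $L^{[p]}(\lambda_1(u),\lambda_2(u))$ is finite dimensional if and only if there exists a monic polynomial $P(u)\in\Bbbk[u]$ such that $$\frac{\lambda_1(u)}{\lambda_2(u)}=\frac{P(u+1)}{P(u)},$$ where the right-hand side is expanded as a power series in $u^{-1}$.
   Context: **Yangian.** $\Bbbk$ is an algebraically closed field of characteristic $p>0$. $Y_2$ is the associative unital $\Bbbk$-algebra with generators $t_{i,j}^{(r)}$ ($1\le i,j\le 2$, $r>0$) and relations $$[t_{i,j}^{(r)},t_{k,l}^{(s)}]=\sum_{t=0}^{\min(r,s)-1}\left(t_{k,j}^{(t)}t_{i,l}^{(r+s-1-t)}-t_{k,j}^{(r+s-1-t)}t_{i,l}^{(t)}\right),\qquad t_{i,j}^{(0)}:=\delta_{i,j}.$$ Put $t_{i,j}(u)=\sum_{r\ge0}t_{i,j}^{(r)}u^{-r}$. The Drinfeld generators are defined by $t_{1,1}(u)=d_1(u)$, $t_{1,2}(u)=d_1(u)e(u)$, $t_{2,1}(u)=f(u)d_1(u)$, $t_{2,2}(u)=f(u)d_1(u)e(u)+d_2(u)$, with $d_i(u)=\sum_{r\ge0}d_i^{(r)}u^{-r}$, $e(u)=\sum_{r>0}e^{(r)}u^{-r}$, $f(u)=\sum_{r>0}f^{(r)}u^{-r}$. **Restricted Yangian.** Let $b_i(u)=\sum_{r\ge0}b_i^{(r)}u^{-r}:=d_i(u)d_i(u-1)\cdots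 d_i(u-p+1)$. The elements $b_i^{(rp)}$ ($i=1,2$, $r>0$), $(e^{(r)})^p$, $(f^{(r)})^p$ ($r>0$) are central; they generate the $p$-center $Z_p(Y_2)$, and $Z_p(Y_2)_+$ is the ideal of $Z_p(Y_2)$ generated by them. Put $Y_2^{[p]}:=Y_2/Y_2Z_p(Y_2)_+$; the same symbols denote images of generators. **Restricted series.** $g(u)\in\Bbbk[[u^{-1}]]$ is restricted if $g(u)g(u-1)\cdots g(u-p+1)=1$ (this forces $g(u)\in1+u^{-1}\Bbbk[[u^{-1}]]$). A tuple $\lambda(u)=(\lambda_1(u),\lambda_2(u))$, $\lambda_i(u)=1+\sum_{r>0}\lambda_i^{(r)}u^{-r}$, is restricted if both components are. **Baby Verma and simple modules.** For restricted $\lambda(u)$, $Z^{[p]}(\lambda(u))$ is the quotient of $Y_2^{[p]}$ by the left ideal generated by all $e^{(r)}$ and all $d_i^{(r)}-\lambda_i^{(r)}$ ($i=1,2$, $r>0$). It has a unique maximal proper submodule; $L^{[p]}(\lambda(u))=L^{[p]}(\lambda_1(u),\lambda_2(u))$ is the corresponding simple quotient. *)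

theory Defs
  imports
    "HOL-Library.Poly_Mapping"
    "HOL-Computational_Algebra.Formal_Laurent_Series"
    "HOL-Algebra.Algebra"
    "HOL-Algebra.Algebraic_Closure_Type"
    "Jordan_Normal_Form.Missing_VectorSpace"
begin

section \<open>Free associative algebras\<close>

datatype 'g free_monoid = Word "'g list"

instantiation free_monoid :: (type) monoid_add
begin

definition zero_free_monoid :: "'a free_monoid" where
  "zero_free_monoid = Word []"

fun plus_free_monoid :: "'a free_monoid \<Rightarrow> 'a free_monoid \<Rightarrow> 'a free_monoid" where
  "plus_free_monoid (Word v) (Word w) = Word (v @ w)"

instance
proof
  fix a b c :: "'a free_monoid"
  show "a + b + c = a + (b + c)" by (cases a; cases b; cases c) simp
  show "0 + a = a" by (cases a) (simp add: zero_free_monoid_def)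
  show "a + 0 = a" by (cases a) (simp add: zero_free_monoid_def)
qed

end

text \<open>
  The free algebra is the monoid algebra of the free monoid; its product is the convolution
  product of \<^theory>\<open>HOL-Library.Poly_Mapping\<close>.
\<close>

type_synonym ('g, 'k) free_algebra = "'g free_monoid \<Rightarrow>\<^sub>0 'k"

definition free_gen :: "'g \<Rightarrow> ('g, 'k::comm_ring_1) free_algebra" where
  "free_gen g = Poly_Mapping.single (Word [g]) 1"

definition free_const :: "'k \<Rightarrow> ('g, 'k::comm_ring_1) free_algebra" where
  "free_const c = Poly_Mapping.single 0 c"

lemma free_const_add: "free_const (a + b) = free_const a + free_const b"
  by (simp add: free_const_def single_add)

lemma free_const_mult: "free_const (a * b) = free_const a * free_const b"
  by (simp add: free_const_def mult_single)

lemma free_const_1: "free_const 1 = 1"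
  by (simp add: free_const_def)

lemma ring_of_type_algebra_simps [simp]:
  "carrier (ring_of_type_algebra :: 'a::ring_1 ring) = UNIV"
  "x \<otimes>\<^bsub>ring_of_type_algebra\<^esub> y = x * y"
  "x \<oplus>\<^bsub>ring_of_type_algebra\<^esub> y = x + y"
  "\<one>\<^bsub>ring_of_type_algebra\<^esub> = (1 :: 'a)"
  "\<zero>\<^bsub>ring_of_type_algebra\<^esub> = (0 :: 'a)"
  by (simp_all add: ring_of_type_algebra_def)

lemma ring_ring_of_type_algebra: "ring (ring_of_type_algebra :: 'a::ring_1 ring)"
proof -
  have "\<exists>y. x + y = 0" for x :: 'a
    using add.right_inverse by blast
  thus ?thesis
    unfolding ring_of_type_algebra_def using add.right_inverse
    by unfold_locales (auto simp: algebra_simps Units_def)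
qed

lemma a_inv_ring_of_type_algebra [simp]:
  "\<ominus>\<^bsub>ring_of_type_algebra\<^esub> x = - (x :: 'a::ring_1)"
proof -
  interpret ring "ring_of_type_algebra :: 'a ring" by (rule ring_ring_of_type_algebra)
  show ?thesis using minus_equality[of "-x" x] by simp
qed


section \<open>The Yangian of gl(2)\<close>

datatype ix = I1 | I2

text \<open>
  The letter \<open>(i, j, r)\<close> stands for the generator \<open>t\<^sub>i\<^sub>j\<close> with upper index \<open>r + 1\<close>, so that upper index
  \<open>0\<close> is not a generator.
\<close>

type_synonym 'k yangian_free = "(ix \<times> ix \<times> nat, 'k) free_algebra"

fun t_free :: "ix \<Rightarrow> ix \<Rightarrow> nat \<Rightarrow> 'k::comm_ring_1 yangian_free" where
  "t_free i j 0 = (if i = j then 1 else 0)"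
| "t_free i j (Suc r) = free_gen (i, j, r)"

definition yangian_rels :: "'k::comm_ring_1 yangian_free set" where
  "yangian_rels =
     {t_free i j r * t_free k l s - t_free k l s * t_free i j r
        - (\<Sum>t<min r s. t_free k j t * t_free i l (r + s - 1 - t)
                        - t_free k j (r + s - 1 - t) * t_free i l t)
      | i j k l r s. r > 0 \<and> s > 0}"

definition yangian_ideal :: "'k::comm_ring_1 yangian_free set" where
  "yangian_ideal = genideal ring_of_type_algebra yangian_rels"

definition yangian_eq :: "'k::comm_ring_1 yangian_free \<Rightarrow> 'k yangian_free \<Rightarrow> bool" where
  "yangian_eq x y \<longleftrightarrow> x - y \<in> yangian_ideal"

lemma ideal_yangian_ideal: "ideal (yangian_ideal :: 'k::comm_ring_1 yangian_free set) ring_of_type_algebra"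
  unfolding yangian_ideal_def by (rule ring.genideal_ideal[OF ring_ring_of_type_algebra]) simp

lemma yangian_rels_subset: "yangian_rels \<subseteq> yangian_ideal"
  unfolding yangian_ideal_def by (rule ring.genideal_self[OF ring_ring_of_type_algebra]) simp

lemma yangian_ideal_0: "0 \<in> (yangian_ideal :: 'k::comm_ring_1 yangian_free set)"
  using additive_subgroup.zero_closed[OF ideal.axioms(1)[OF ideal_yangian_ideal]] by simp

lemma yangian_ideal_add: "x \<in> yangian_ideal \<Longrightarrow> y \<in> yangian_ideal \<Longrightarrow> x + y \<in> yangian_ideal"
  using additive_subgroup.a_closed[OF ideal.axioms(1)[OF ideal_yangian_ideal], of x y] by simp

lemma yangian_ideal_lmult: "x \<in> yangian_ideal \<Longrightarrow> z * x \<in> yangian_ideal"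
  using ideal.I_l_closed[OF ideal_yangian_ideal, of x z] by simp

lemma yangian_ideal_rmult: "x \<in> yangian_ideal \<Longrightarrow> x * z \<in> yangian_ideal"
  using ideal.I_r_closed[OF ideal_yangian_ideal, of x z] by simp

lemma yangian_ideal_uminus: "x \<in> yangian_ideal \<Longrightarrow> - x \<in> yangian_ideal"
  using yangian_ideal_lmult[of x "-1"] by simp

lemma lookup_free_mult_0:
  fixes x y :: "('g, 'k::comm_ring_1) free_algebra"
  shows "Poly_Mapping.lookup (x * y) 0 = Poly_Mapping.lookup x 0 * Poly_Mapping.lookup y 0"
proof -
  have split: "0 = l + q \<longleftrightarrow> l = 0 \<and> q = 0" for l q :: "'g free_monoid"
    by (cases l; cases q) (auto simp: zero_free_monoid_def)
  have "(\<Sum>q. Poly_Mapping.lookup y q when (0 :: 'g free_monoid) = l + q)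
          = (Poly_Mapping.lookup y 0 when l = 0)" for l :: "'g free_monoid"
    by (cases "l = 0") (simp_all add: split)
  hence "Poly_Mapping.lookup (x * y) 0
           = (\<Sum>l. Poly_Mapping.lookup x l * (Poly_Mapping.lookup y 0 when l = 0))"
    by (simp add: times_poly_mapping.rep_eq prod_fun_def)
  also have "\<dots> = (\<Sum>l. (Poly_Mapping.lookup x l * Poly_Mapping.lookup y 0) when l = 0)"
    by (intro Sum_any.cong) (simp add: when_def)
  finally show ?thesis by simp
qed

lemma lookup_t_free_0: "r > 0 \<Longrightarrow> Poly_Mapping.lookup (t_free i j r) 0 = 0"
  by (cases r) (auto simp: free_gen_def lookup_single zero_free_monoid_def)

lemma yangian_ideal_lookup_0:
  assumes "x \<in> (yangian_ideal :: 'k::comm_ring_1 yangian_free set)"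
  shows "Poly_Mapping.lookup x 0 = 0"
proof -
  let ?R = "ring_of_type_algebra :: 'k yangian_free ring"
  interpret ring ?R by (rule ring_ring_of_type_algebra)
  let ?A = "{x :: 'k yangian_free. Poly_Mapping.lookup x 0 = 0}"
  have "ideal ?A ?R"
  proof (rule idealI[OF ring_ring_of_type_algebra])
    show "subgroup ?A (add_monoid ?R)"
      by (rule add.subgroupI)
        (auto simp: lookup_add a_inv_def[symmetric] intro!: exI[of _ 0])
  qed (simp_all add: lookup_free_mult_0)
  moreover have "yangian_rels \<subseteq> ?A"
  proof
    fix x :: "'k yangian_free"
    assume "x \<in> yangian_rels"
    then obtain i j k l r s where rs: "r > 0" "s > 0"
      and x: "x = t_free i j r * t_free k l s - t_free k l s * t_free i j r
        - (\<Sum>t<min r s. t_free k j t * t_free i l (r + s - 1 - t)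
                        - t_free k j (r + s - 1 - t) * t_free i l t)"
      unfolding yangian_rels_def by blast
    have "Poly_Mapping.lookup (\<Sum>t<min r s. t_free k j t * t_free i l (r + s - 1 - t)
              - t_free k j (r + s - 1 - t) * t_free i l t :: 'k yangian_free) 0 = 0"
      unfolding lookup_sum
      by (rule sum.neutral) (auto simp: lookup_minus lookup_free_mult_0 lookup_t_free_0)
    thus "x \<in> ?A"
      using rs by (simp add: x lookup_minus lookup_free_mult_0 lookup_t_free_0)
  qed
  ultimately have "yangian_ideal \<subseteq> ?A"
    unfolding yangian_ideal_def by (rule genideal_minimal)
  thus ?thesis using assms by blast
qed

quotient_type (overloaded) 'k yangian = "'k::comm_ring_1 yangian_free" / yangian_eq
  morphisms yangian_rep yangian_abs
proof (rule equivpI)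
  show "reflp yangian_eq"
    by (rule reflpI) (simp add: yangian_eq_def yangian_ideal_0)
  show "symp yangian_eq"
  proof (rule sympI)
    fix x y :: "'a yangian_free"
    assume "yangian_eq x y"
    thus "yangian_eq y x"
      using yangian_ideal_uminus[of "x - y"] by (simp add: yangian_eq_def)
  qed
  show "transp yangian_eq"
  proof (rule transpI)
    fix x y z :: "'a yangian_free"
    assume "yangian_eq x y" "yangian_eq y z"
    thus "yangian_eq x z"
      using yangian_ideal_add[of "x - y" "y - z"] by (simp add: yangian_eq_def)
  qed
qed

instantiation yangian :: (comm_ring_1) ring_1
begin

lift_definition zero_yangian :: "'a yangian" is 0 .

lift_definition one_yangian :: "'a yangian" is 1 .

lift_definition plus_yangian :: "'a yangian \<Rightarrow> 'a yangian \<Rightarrow> 'a yangian" is "(+)"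
proof -
  fix a a' b b' :: "'a yangian_free"
  assume "yangian_eq a a'" "yangian_eq b b'"
  thus "yangian_eq (a + b) (a' + b')"
    using yangian_ideal_add[of "a - a'" "b - b'"] by (simp add: yangian_eq_def algebra_simps)
qed

lift_definition uminus_yangian :: "'a yangian \<Rightarrow> 'a yangian" is "uminus"
proof -
  fix a b :: "'a yangian_free"
  assume "yangian_eq a b"
  thus "yangian_eq (- a) (- b)"
    using yangian_ideal_uminus[of "a - b"] by (simp add: yangian_eq_def)
qed

definition minus_yangian :: "'a yangian \<Rightarrow> 'a yangian \<Rightarrow> 'a yangian" where
  "minus_yangian x y = x + - y"

lift_definition times_yangian :: "'a yangian \<Rightarrow> 'a yangian \<Rightarrow> 'a yangian" is "(*)"
proof -
  fix a a' b b' :: "'a yangian_free"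
  assume "yangian_eq a a'" "yangian_eq b b'"
  hence "(a - a') * b + a' * (b - b') \<in> yangian_ideal"
    unfolding yangian_eq_def
    by (intro yangian_ideal_add yangian_ideal_rmult yangian_ideal_lmult)
  thus "yangian_eq (a * b) (a' * b')"
    by (simp add: yangian_eq_def algebra_simps)
qed

instance
proof
  fix a b c :: "'a yangian"
  show "a + b + c = a + (b + c)" by transfer (simp add: yangian_eq_def yangian_ideal_0 algebra_simps)
  show "a + b = b + a" by transfer (simp add: yangian_eq_def yangian_ideal_0 algebra_simps)
  show "0 + a = a" by transfer (simp add: yangian_eq_def yangian_ideal_0)
  show "- a + a = 0" by transfer (simp add: yangian_eq_def yangian_ideal_0)
  show "a - b = a + - b" by (simp add: minus_yangian_def)
  show "1 * a = a" by transfer (simp add: yangian_eq_def yangian_ideal_0)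
  show "a * 1 = a" by transfer (simp add: yangian_eq_def yangian_ideal_0)
  show "(0 :: 'a yangian) \<noteq> 1"
    by transfer (auto simp: yangian_eq_def dest!: yangian_ideal_lookup_0)
  show "a * b * c = a * (b * c)" by transfer (simp add: yangian_eq_def yangian_ideal_0 mult.assoc)
  show "(a + b) * c = a * c + b * c"
    by transfer (simp add: yangian_eq_def yangian_ideal_0 algebra_simps)
  show "a * (b + c) = a * b + a * c"
    by transfer (simp add: yangian_eq_def yangian_ideal_0 algebra_simps)
qed

end

lift_definition t_gen :: "ix \<Rightarrow> ix \<Rightarrow> nat \<Rightarrow> 'k::comm_ring_1 yangian" is t_free .

lift_definition yangian_const :: "'k::comm_ring_1 \<Rightarrow> 'k yangian" is free_const .

lemma t_gen_0: "t_gen i j 0 = (if i = j then 1 else 0)"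
  by transfer (simp add: yangian_eq_def yangian_ideal_0)

lemma yangian_abs_hom:
  "yangian_abs (x + y) = yangian_abs x + yangian_abs y"
  "yangian_abs (x - y) = yangian_abs x - yangian_abs y"
  "yangian_abs (x * y) = yangian_abs x * yangian_abs y"
  by (simp_all add: plus_yangian.abs_eq times_yangian.abs_eq minus_yangian_def
      uminus_yangian.abs_eq)

lemma yangian_abs_sum: "yangian_abs (sum f A) = (\<Sum>x\<in>A. yangian_abs (f x))"
  by (induction A rule: infinite_finite_induct)
    (simp_all add: yangian_abs_hom zero_yangian.abs_eq)

lemma yangian_relation:
  assumes "r > 0" "s > 0"
  shows "t_gen i j r * t_gen k l s - t_gen k l s * t_gen i j r =
           (\<Sum>t<min r s. t_gen k j t * t_gen i l (r + s - 1 - t)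
                          - t_gen k j (r + s - 1 - t) * t_gen i l t)"
proof -
  have "yangian_abs (t_free i j r * t_free k l s - t_free k l s * t_free i j r)
      = yangian_abs (\<Sum>t<min r s. t_free k j t * t_free i l (r + s - 1 - t)
                        - t_free k j (r + s - 1 - t) * t_free i l t)"
    unfolding yangian.abs_eq_iff yangian_eq_def
    by (rule subsetD[OF yangian_rels_subset]) (use assms in \<open>unfold yangian_rels_def, blast\<close>)
  thus ?thesis
    by (simp add: yangian_abs_hom yangian_abs_sum t_gen.abs_eq)
qed


section \<open>Power series in the inverse of u and Drinfeld generators\<close>

text \<open>
  A series in nonpositive powers of \<open>u\<close> is a formal power series whose variable \<^const>\<open>fps_X\<close> is the
  inverse of \<open>u\<close>.  Replacing \<open>u\<close> by \<open>u - c\<close> replaces \<open>X = 1/u\<close> by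
  \<open>1/(u - c) = X/(1 - cX) = X (1 + cX + c\<^sup>2X\<^sup>2 + \<dots>)\<close>.
\<close>

definition u_shift :: "nat \<Rightarrow> 'a::ring_1 fps \<Rightarrow> 'a fps" where
  "u_shift c g = fps_compose g (fps_X * Abs_fps (\<lambda>n. of_nat c ^ n))"

definition u_shift_prod :: "nat \<Rightarrow> 'a::ring_1 fps \<Rightarrow> 'a fps" where
  "u_shift_prod m g = prod_list (map (\<lambda>c. u_shift c g) [0..<m])"

definition t_series :: "ix \<Rightarrow> ix \<Rightarrow> 'k::comm_ring_1 yangian fps" where
  "t_series i j = Abs_fps (t_gen i j)"

definition d1_inv :: "'k::comm_ring_1 yangian fps" where
  "d1_inv = fps_right_inverse (t_series I1 I1) 1"

definition e_series :: "'k::comm_ring_1 yangian fps" where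
  "e_series = d1_inv * t_series I1 I2"

definition f_series :: "'k::comm_ring_1 yangian fps" where
  "f_series = t_series I2 I1 * d1_inv"

fun d_series :: "ix \<Rightarrow> 'k::comm_ring_1 yangian fps" where
  "d_series I1 = t_series I1 I1"
| "d_series I2 = t_series I2 I2 - f_series * t_series I1 I1 * e_series"

lemma gauss_decomposition:
  "t_series I1 I1 = (d_series I1 :: 'k::comm_ring_1 yangian fps)"
  "t_series I1 I2 = d_series I1 * (e_series :: 'k yangian fps)"
  "t_series I2 I1 = f_series * (d_series I1 :: 'k yangian fps)"
  "t_series I2 I2 = f_series * d_series I1 * e_series + (d_series I2 :: 'k yangian fps)"
proof -
  have const: "fps_nth (t_series I1 I1) 0 = (1 :: 'k yangian)"
    by (simp add: t_series_def t_gen_0)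
  have r: "t_series I1 I1 * d1_inv = (1 :: 'k yangian fps)"
    unfolding d1_inv_def by (rule fps_right_inverse) (simp add: const)
  have l: "d1_inv * t_series I1 I1 = (1 :: 'k yangian fps)"
    unfolding d1_inv_def by (rule fps_left_inverse'[where x = 1]) (simp_all add: const)
  show "t_series I1 I2 = d_series I1 * (e_series :: 'k yangian fps)"
    by (simp only: e_series_def d_series.simps mult.assoc[symmetric] r mult_1_left)
  show "t_series I2 I1 = f_series * (d_series I1 :: 'k yangian fps)"
    by (simp only: f_series_def d_series.simps mult.assoc l mult_1_right)
qed simp_all

lemma drinfeld_nth_0:
  "fps_nth (d_series i) 0 = 1" "fps_nth e_series 0 = 0" "fps_nth f_series 0 = 0"
  by (cases i; simp add: t_series_def t_gen_0 e_series_def f_series_def)+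


section \<open>The restricted Yangian\<close>

definition b_series :: "ix \<Rightarrow> 'k::comm_ring_1 yangian fps" where
  "b_series i = u_shift_prod CHAR('k) (d_series i)"

definition p_center_gens :: "'k::comm_ring_1 yangian set" where
  "p_center_gens =
     {fps_nth (b_series i) (r * CHAR('k)) | i r. r > 0}
     \<union> {fps_nth e_series r ^ CHAR('k) | r. r > 0}
     \<union> {fps_nth f_series r ^ CHAR('k) | r. r > 0}"

text \<open>The generated subalgebra is the subring generated together with the scalars.\<close>

definition p_center :: "'k::comm_ring_1 yangian set" where
  "p_center = generate_ring ring_of_type_algebra (range yangian_const \<union> p_center_gens)"

definition p_center_plus :: "'k::comm_ring_1 yangian set" where
  "p_center_plus = genideal (ring_of_type_algebra\<lparr>carrier := p_center\<rparr>) p_center_gens"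

text \<open>
  \<^const>\<open>ideal_prod\<close> is the set of finite sums of products, taken literally.  It is a two-sided ideal
  because \<^const>\<open>p_center_gens\<close> consists of central elements, which is not proved here; the library's
  \<^const>\<open>FactRing\<close> makes sense syntactically without it.
\<close>

definition restricted_ideal :: "'k::comm_ring_1 yangian set" where
  "restricted_ideal =
     ideal_prod ring_of_type_algebra (carrier ring_of_type_algebra) p_center_plus"

definition restricted_yangian :: "'k::comm_ring_1 yangian set ring" where
  "restricted_yangian = ring_of_type_algebra Quot restricted_ideal"

definition restricted_proj :: "'k::comm_ring_1 yangian \<Rightarrow> 'k yangian set" where
  "restricted_proj y = restricted_ideal +>\<^bsub>ring_of_type_algebra\<^esub> y"


section \<open>Left modules\<close>

text \<open>
  The library's module locale requires a commutative ring, but the underlying record and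
  \<^locale>\<open>Module.submodule\<close> do not.  The fields \<open>mult\<close> and \<open>one\<close> of a module record carry no meaning.
\<close>

locale left_module = R?: ring R + M?: abelian_group M
  for R :: "'a ring" and M :: "('a, 'm) module" (structure) +
  assumes smult_closed: "a \<in> carrier R \<Longrightarrow> x \<in> carrier M \<Longrightarrow> a \<odot>\<^bsub>M\<^esub> x \<in> carrier M"
    and smult_l_distr: "a \<in> carrier R \<Longrightarrow> b \<in> carrier R \<Longrightarrow> x \<in> carrier M \<Longrightarrow>
      (a \<oplus>\<^bsub>R\<^esub> b) \<odot>\<^bsub>M\<^esub> x = a \<odot>\<^bsub>M\<^esub> x \<oplus>\<^bsub>M\<^esub> b \<odot>\<^bsub>M\<^esub> x"
    and smult_r_distr: "a \<in> carrier R \<Longrightarrow> x \<in> carrier M \<Longrightarrow> y \<in> carrier M \<Longrightarrow>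
      a \<odot>\<^bsub>M\<^esub> (x \<oplus>\<^bsub>M\<^esub> y) = a \<odot>\<^bsub>M\<^esub> x \<oplus>\<^bsub>M\<^esub> a \<odot>\<^bsub>M\<^esub> y"
    and smult_assoc: "a \<in> carrier R \<Longrightarrow> b \<in> carrier R \<Longrightarrow> x \<in> carrier M \<Longrightarrow>
      (a \<otimes>\<^bsub>R\<^esub> b) \<odot>\<^bsub>M\<^esub> x = a \<odot>\<^bsub>M\<^esub> (b \<odot>\<^bsub>M\<^esub> x)"
    and smult_one: "x \<in> carrier M \<Longrightarrow> \<one>\<^bsub>R\<^esub> \<odot>\<^bsub>M\<^esub> x = x"

definition regular_module :: "'a ring \<Rightarrow> ('a, 'a) module" where
  "regular_module R =
     \<lparr>carrier = carrier R, monoid.mult = monoid.mult R, one = \<one>\<^bsub>R\<^esub>, ring.zero = \<zero>\<^bsub>R\<^esub>, add = add R,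
      module.smult = monoid.mult R\<rparr>"

lemma left_module_regular_module:
  assumes "ring R"
  shows "left_module R (regular_module R)"
proof -
  interpret ring R by fact
  show ?thesis
    by (intro left_module.intro left_module_axioms.intro assms abelian_groupI)
     (auto simp: regular_module_def a_ac l_distr r_distr m_assoc intro: l_neg bexI[of _ "\<ominus>\<^bsub>R\<^esub> _"])
qed

text \<open>The submodules of the regular module are the left ideals.\<close>

definition left_ideal_gen :: "'a ring \<Rightarrow> 'a set \<Rightarrow> 'a set" where
  "left_ideal_gen R S = \<Inter>{J. Module.submodule J R (regular_module R) \<and> S \<subseteq> J}"

definition quot_module :: "('a, 'm) module \<Rightarrow> 'm set \<Rightarrow> ('a, 'm set) module" where
  "quot_module M N =
     \<lparr>carrier = a_rcosets\<^bsub>M\<^esub> N, monoid.mult = undefined, one = undefined,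
      ring.zero = N, add = set_add M,
      module.smult = (\<lambda>r C. \<Union>x\<in>C. N +>\<^bsub>M\<^esub> (r \<odot>\<^bsub>M\<^esub> x))\<rparr>"

lemma left_module_quot_module:
  assumes "left_module R M" and "Module.submodule N R M"
  shows "left_module R (quot_module M N)"
proof -
  interpret left_module R M by fact
  have sub: "abelian_subgroup N M"
    using Module.submodule.axioms(1)[OF assms(2)]
    by (intro abelian_subgroupI3 additive_subgroup.intro M.abelian_group_axioms)
  interpret N: abelian_subgroup N M by fact
  have smN: "a \<in> carrier R \<Longrightarrow> x \<in> N \<Longrightarrow> a \<odot>\<^bsub>M\<^esub> x \<in> N" for a x
    using Module.submodule.smult_closed[OF assms(2)] .
  have Nc: "x \<in> N \<Longrightarrow> x \<in> carrier M" for x using N.a_subset by auto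
  have sm: "a \<odot>\<^bsub>quot_module M N\<^esub> (N +>\<^bsub>M\<^esub> x) = N +>\<^bsub>M\<^esub> (a \<odot>\<^bsub>M\<^esub> x)"
    if "a \<in> carrier R" "x \<in> carrier M" for a x
  proof -
    have "N +>\<^bsub>M\<^esub> (a \<odot>\<^bsub>M\<^esub> y) = N +>\<^bsub>M\<^esub> (a \<odot>\<^bsub>M\<^esub> x)" if y: "y \<in> N +>\<^bsub>M\<^esub> x" for y
    proof -
      from y obtain n where n: "n \<in> N" "y = n \<oplus>\<^bsub>M\<^esub> x" by (auto simp: a_r_coset_def')
      have "a \<odot>\<^bsub>M\<^esub> y = a \<odot>\<^bsub>M\<^esub> n \<oplus>\<^bsub>M\<^esub> a \<odot>\<^bsub>M\<^esub> x"
        using n that Nc \<open>a \<in> carrier R\<close> \<open>x \<in> carrier M\<close> by (simp add: smult_r_distr)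
      hence "a \<odot>\<^bsub>M\<^esub> y \<in> N +>\<^bsub>M\<^esub> (a \<odot>\<^bsub>M\<^esub> x)"
        using smN[OF \<open>a \<in> carrier R\<close> n(1)] by (auto simp: a_r_coset_def')
      thus ?thesis using N.a_repr_independence' smult_closed \<open>a \<in> carrier R\<close> \<open>x \<in> carrier M\<close> by metis
    qed
    moreover have "x \<in> N +>\<^bsub>M\<^esub> x" using N.a_rcos_self that by auto
    ultimately have "(\<Union>y\<in>N +>\<^bsub>M\<^esub> x. N +>\<^bsub>M\<^esub> (a \<odot>\<^bsub>M\<^esub> y)) = N +>\<^bsub>M\<^esub> (a \<odot>\<^bsub>M\<^esub> x)"
      by (intro UN_constant_eq ballI)
    thus ?thesis by (simp only: quot_module_def module.simps)
  qed
  have car: "carrier (quot_module M N) = a_rcosets\<^bsub>M\<^esub> N" by (simp add: quot_module_def)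
  have carE: "\<exists>x\<in>carrier M. A = N +>\<^bsub>M\<^esub> x" if "A \<in> carrier (quot_module M N)" for A
    using that by (auto simp: car A_RCOSETS_def')
  have carI: "N +>\<^bsub>M\<^esub> x \<in> carrier (quot_module M N)" if "x \<in> carrier M" for x
    using that by (auto simp: car A_RCOSETS_def')
  have ad: "(N +>\<^bsub>M\<^esub> x) \<oplus>\<^bsub>quot_module M N\<^esub> (N +>\<^bsub>M\<^esub> y) = N +>\<^bsub>M\<^esub> (x \<oplus>\<^bsub>M\<^esub> y)"
    if "x \<in> carrier M" "y \<in> carrier M" for x y
    using N.a_rcos_sum that by (simp add: quot_module_def)
  have ze: "\<zero>\<^bsub>quot_module M N\<^esub> = N +>\<^bsub>M\<^esub> \<zero>\<^bsub>M\<^esub>"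
    using M.a_coset_add_zero[OF N.a_subset] by (simp add: quot_module_def)
  have ag: "abelian_group (quot_module M N)"
  proof (rule abelian_groupI)
    fix A
    assume "A \<in> carrier (quot_module M N)"
    then obtain x where x: "x \<in> carrier M" "A = N +>\<^bsub>M\<^esub> x" using carE by blast
    have "(N +>\<^bsub>M\<^esub> (\<ominus>\<^bsub>M\<^esub> x)) \<oplus>\<^bsub>quot_module M N\<^esub> A = \<zero>\<^bsub>quot_module M N\<^esub>"
      using x by (simp add: ad ze M.l_neg)
    thus "\<exists>B\<in>carrier (quot_module M N). B \<oplus>\<^bsub>quot_module M N\<^esub> A = \<zero>\<^bsub>quot_module M N\<^esub>"
      using x carI by (meson M.a_inv_closed)
  qed (auto dest!: carE simp: ad ze M.a_ac intro!: carI)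
  show ?thesis
    by (intro left_module.intro left_module_axioms.intro R.ring_axioms ag)
      (auto dest!: carE simp: sm ad smult_closed smult_l_distr smult_r_distr smult_assoc
        smult_one intro!: carI)
qed

definition maximal_submodule :: "'m set \<Rightarrow> 'a ring \<Rightarrow> ('a, 'm) module \<Rightarrow> bool" where
  "maximal_submodule N R M \<longleftrightarrow>
     Module.submodule N R M \<and> N \<noteq> carrier M \<and>
     (\<forall>N'. Module.submodule N' R M \<longrightarrow> N \<subseteq> N' \<longrightarrow> N' = N \<or> N' = carrier M)"

definition restrict_scalars :: "('k \<Rightarrow> 'a) \<Rightarrow> ('a, 'm) module \<Rightarrow> ('k, 'm) module" where
  "restrict_scalars \<phi> M =
     \<lparr>carrier = carrier M, monoid.mult = monoid.mult M, one = \<one>\<^bsub>M\<^esub>, ring.zero = \<zero>\<^bsub>M\<^esub>, add = add M,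
      module.smult = (\<lambda>c x. \<phi> c \<odot>\<^bsub>M\<^esub> x)\<rparr>"

lemma vectorspace_restrict_scalars:
  assumes "left_module R M" "field K" "\<phi> \<in> ring_hom K R"
  shows "vectorspace K (restrict_scalars \<phi> M)"
proof -
  interpret left_module R M by fact
  interpret K: field K by fact
  note h = ring_hom_memE[OF assms(3)]
  have ag: "abelian_group (restrict_scalars \<phi> M)"
    using M.abelian_group_axioms M.a_comm_group unfolding restrict_scalars_def
    by (intro abelian_groupI) (auto simp: M.a_ac intro: M.minus_closed M.l_neg bexI[of _ "\<ominus>\<^bsub>M\<^esub> _"])
  show ?thesis
    by (intro vectorspace.intro moduleI K.is_cring ag assms(2))
      (auto simp: restrict_scalars_def h smult_closed smult_l_distr smult_r_distr smult_assoc smult_one)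
qed


section \<open>Baby Verma modules and their simple quotients\<close>

definition restricted_series :: "'k::field fps \<Rightarrow> bool" where
  "restricted_series g \<longleftrightarrow> u_shift_prod CHAR('k) g = 1"

definition restricted_tuple :: "(ix \<Rightarrow> 'k::field fps) \<Rightarrow> bool" where
  "restricted_tuple lam \<longleftrightarrow> (\<forall>i. fps_nth (lam i) 0 = 1 \<and> restricted_series (lam i))"

definition baby_verma ::
    "(ix \<Rightarrow> 'k::field fps) \<Rightarrow> ('k yangian set, 'k yangian set set) module" where
  "baby_verma lam =
     quot_module (regular_module restricted_yangian)
       (left_ideal_gen restricted_yangian
          ({restricted_proj (fps_nth e_series r) | r. r > 0}
           \<union> {restricted_proj (fps_nth (d_series i) r - yangian_const (fps_nth (lam i) r))
               | i r. r > 0}))"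

text \<open>
  The definite description relies on the (unproved here) fact that a baby Verma module of a
  restricted tuple has exactly one maximal submodule.
\<close>

definition simple_module ::
    "(ix \<Rightarrow> 'k::field fps) \<Rightarrow> ('k yangian set, 'k yangian set set set) module" where
  "simple_module lam =
     quot_module (baby_verma lam)
       (THE N. maximal_submodule N restricted_yangian (baby_verma lam))"

definition finite_dimensional :: "('k::field yangian set, 'm) module \<Rightarrow> bool" where
  "finite_dimensional M \<longleftrightarrow>
     vectorspace.fin_dim (ring_of_type_algebra :: 'k ring)
       (restrict_scalars (\<lambda>c. restricted_proj (yangian_const c)) M)"

text \<open>
  A polynomial in \<open>u\<close> as a Laurent series in the variable \<open>1/u\<close>, so that the variable \<open>u\<close> itself is
  \<^const>\<open>fls_X_inv\<close>.
\<close>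

definition poly_in_u :: "'k::field poly \<Rightarrow> 'k fls" where
  "poly_in_u P = poly (map_poly fls_const P) fls_X_inv"

end

theory Submission
  imports Defs
begin

text \<open>
  Commutation formulas for the Drinfeld generators, read off from the RTT relation in two variables,
  show that the generators of the \<open>p\<close>-center are central, so the restricted ideal is two-sided and all
  modules can be handled as left ideals of the Yangian itself.

  Let \<open>J\<close> be the left ideal of the baby Verma module and \<open>F\<close> the sum of \<open>J\<close> and the right ideal
  generated by the coefficients of \<open>f(u)\<close>.  Modulo the \<open>p\<close>-center the augmentation ideal of the subalgebra
  generated by these coefficients is locally nilpotent, hence every proper left ideal above \<open>J\<close> lies in
  \<open>F\<close>.  A vacuum expectation on tensor products of evaluation modules, which match the given highest
  weight to any prescribed order, gives \<open>1 \<notin> F\<close>.  So the maximal submodule is \<open>{y. Y y \<subseteq> F}\<close>.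

  If \<open>P\<close> exists, the highest weight vector of a tensor product of two-dimensional evaluation modules,
  twisted by a scalar series, generates a module with simple quotient \<open>L\<close>.  Conversely, if \<open>L\<close> is finite
  dimensional, the images of the highest weight vector under the coefficients of \<open>f(u)\<close> are linearly
  dependent; applying the coefficients of \<open>e(u)\<close> gives a Hankel relation, i.e. the quotient of the two
  weights is rational.  Restrictedness says that it has norm one under \<open>u \<mapsto> u + 1\<close>, and Hilbert's
  Theorem 90 yields \<open>P\<close>.
\<close>

section \<open>Series in two variables\<close>

text \<open>That a baby Verma module is nonzero is invisible in its presentation; the statement that
  1 is not in F takes the place of a basis theorem. The tensor products that witness it are modules
  of the full Yangian and need not factor through the restricted one. This is possible because every
  p-center generator is absorbed into F beforehand: central powers of the f-coefficients belong to
  the right ideal, everything else to the left ideal of the highest weight conditions, where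
  restrictedness makes the norm of a weight trivial. A given element of F then involves finitely
  many weight conditions, so a highest weight that is correct up to some degree suffices.

  Modulo F every element is a scalar, so F is a hyperplane and coincides with the kernel of the
  vacuum expectation of any representation with exactly the right weights. One such representation
  therefore determines L, and L is finite dimensional as soon as its vacuum vector generates a
  finite-dimensional module. A factor common to both weights is realized as a twist by a scalar
  series.\<close>

text \<open>
  In \<^typ>\<open>'a fps fps\<close> the coefficients carry the variable \<open>1/u\<close> and the outer variable is \<open>1/v\<close>.
\<close>

definition X2 :: "'a::ring_1 fps fps" where "X2 = fps_const fps_X"

definition Y2 :: "'a::ring_1 fps fps" where "Y2 = fps_X"

definition inX :: "'a::ring_1 fps \<Rightarrow> 'a fps fps" where "inX f = fps_const f"

definition inY :: "'a::ring_1 fps \<Rightarrow> 'a fps fps" where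
  "inY f = Abs_fps (\<lambda>n. fps_const (fps_nth f n))"

lemma inX_simps:
  "inX (f + g) = inX f + inX g" "inX (f - g) = inX f - inX g" "inX (f * g) = inX f * inX g"
  "inX 1 = 1" "inX 0 = 0" "inX fps_X = X2"
  by (simp_all add: inX_def X2_def)

lemma inY_simps:
  "inY (f + g) = inY f + inY g" "inY (f - g) = inY f - inY g" "inY (f * g) = inY f * inY g"
  "inY 1 = 1" "inY 0 = 0" "inY fps_X = Y2"
proof -
  have s: "fps_const (sum h A) = (\<Sum>x\<in>A. fps_const (h x))" for h :: "nat \<Rightarrow> 'a" and A
    by (induction A rule: infinite_finite_induct) (simp_all flip: fps_const_add)
  show "inY (f * g) = inY f * inY g"
    by (rule fps_ext) (simp add: inY_def fps_mult_nth s)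
qed (auto simp: inY_def Y2_def fps_eq_iff)

lemma inX_const: "inX (fps_const c) = inY (fps_const c)"
  by (auto simp: inX_def inY_def fps_eq_iff)

lemma Y2_central: "F * Y2 = Y2 * F"
  by (simp add: Y2_def fps_eq_iff)

lemma X2_central: "F * X2 = X2 * F"
  by (simp add: X2_def fps_eq_iff)

lemma XY_nth:
  "fps_nth (fps_nth (X2 * F) j) i = (if i = 0 then 0 else fps_nth (fps_nth F j) (i - 1))"
  "fps_nth (fps_nth (Y2 * F) j) i = (if j = 0 then 0 else fps_nth (fps_nth F (j - 1)) i)"
  by (simp_all add: X2_def Y2_def)

lemma in_mult_nth:
  "fps_nth (fps_nth (inX f * F) j) i = fps_nth (f * fps_nth F j) i"
  "fps_nth (fps_nth (F * inX f) j) i = fps_nth (fps_nth F j * f) i"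
  by (simp_all add: inX_def)

lemma inY_nth: "fps_nth (inY f) n = fps_const (fps_nth f n)"
  by (simp add: inY_def)

text \<open>Since 1/v - 1/u = (u - v)/(uv), the equation is (u - v) F = G with denominators cleared.
  The first two conditions say that u F and v F contain no positive power of u or v.\<close>

lemma YmX_eq_iff:
  "(Y2 - X2) * F = X2 * Y2 * G \<longleftrightarrow>
     (\<forall>s. fps_nth (fps_nth F s) 0 = 0) \<and> (\<forall>r. fps_nth (fps_nth F 0) r = 0) \<and>
     (\<forall>r s. fps_nth (fps_nth F s) (Suc r) - fps_nth (fps_nth F (Suc s)) r = fps_nth (fps_nth G s) r)"
  (is "?L \<longleftrightarrow> ?R")
proof
  assume L: ?L
  have c: "(if j = 0 then 0 else fps_nth (fps_nth F (j - 1)) i) -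
           (if i = 0 then 0 else fps_nth (fps_nth F j) (i - 1)) =
           (if i = 0 \<or> j = 0 then 0 else fps_nth (fps_nth G (j - 1)) (i - 1))" for i j
    using arg_cong[OF L, of "\<lambda>H. fps_nth (fps_nth H j) i"]
    by (simp add: left_diff_distrib XY_nth mult.assoc del: fps_mult_nth_0)
  show ?R
  proof (intro conjI allI)
    show "fps_nth (fps_nth F s) 0 = 0" for s using c[of "Suc s" 0] by simp
    show "fps_nth (fps_nth F 0) r = 0" for r using c[of 0 "Suc r"] by simp
    show "fps_nth (fps_nth F s) (Suc r) - fps_nth (fps_nth F (Suc s)) r = fps_nth (fps_nth G s) r"
      for r s using c[of "Suc s" "Suc r"] by simp
  qed
next
  assume R: ?R
  show ?L
  proof (intro fps_ext)
    fix i j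
    show "fps_nth (fps_nth ((Y2 - X2) * F) j) i = fps_nth (fps_nth (X2 * Y2 * G) j) i"
      using R by (cases i; cases j) (auto simp: left_diff_distrib XY_nth mult.assoc simp del: fps_mult_nth_0)
  qed
qed

text \<open>Row r + 1 is computed from row r, starting from zero. The value \<open>c = 0\<close>
  yields cancellation of u - v, the value \<open>c = 1\<close> cancellation of u - v - 1.\<close>

lemma double_seq_0:
  fixes F :: "nat \<Rightarrow> nat \<Rightarrow> 'a::ring_1"
  assumes "\<And>s. F s 0 = 0" "\<And>r s. F s (Suc r) = F (Suc s) r + c * F s r"
  shows "F s r = 0"
  using assms by (induction r arbitrary: s) simp_all

lemma YmX_cancel: "(Y2 - X2) * F = 0 \<Longrightarrow> F = 0"
  using YmX_eq_iff[of F 0] double_seq_0[of "\<lambda>s r. fps_nth (fps_nth F s) r" 0]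
  by (simp add: fps_eq_iff)

lemma YmX_cancel': "(Y2 - X2) * F = (Y2 - X2) * G \<Longrightarrow> F = G"
  using YmX_cancel[of "F - G"] by (simp add: right_diff_distrib)

lemma YmX_eq_self: "(Y2 - X2) * F = X2 * Y2 * F \<Longrightarrow> F = 0"
  using YmX_eq_iff[of F F] double_seq_0[of "\<lambda>s r. fps_nth (fps_nth F s) r" 1]
  by (simp add: fps_eq_iff algebra_simps)

section \<open>The RTT relation\<close>

text \<open>The relation (u - v)[t_ij(u), t_kl(v)] = t_kj(u) t_il(v) - t_kj(v) t_il(u), cleared of
  denominators so that it makes sense for power series over any ring.\<close>

definition rtt :: "(ix \<Rightarrow> ix \<Rightarrow> 'a::ring_1 fps) \<Rightarrow> bool" where
  "rtt T \<longleftrightarrow> (\<forall>i j k l.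
     (Y2 - X2) * (inX (T i j) * inY (T k l) - inY (T k l) * inX (T i j))
       = X2 * Y2 * (inX (T k j) * inY (T i l) - inY (T k j) * inX (T i l)))"

lemma inXY_nth:
  "fps_nth (fps_nth (inX f * inY g) s) r = fps_nth f r * fps_nth g s"
  "fps_nth (fps_nth (inY g * inX f) s) r = fps_nth g s * fps_nth f r"
  by (simp_all add: in_mult_nth inY_nth)

text \<open>Passing from (r, s + 1) to (r + 1, s) changes the number of summands by at most one;
  beyond the diagonal, antisymmetry gives the lost summand the right sign.\<close>

lemma min_Suc_cases:
  fixes D :: "nat \<Rightarrow> nat \<Rightarrow> 'a::ring_1"
  assumes D: "\<And>r s. D s r = - D r s" and D0: "\<And>r. D r r = 0"
  shows "(\<Sum>t<min (Suc r) s. D t (r + s - t)) - (\<Sum>t<min r (Suc s). D t (r + s - t)) = D r s"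
proof -
  consider "r < s" | "r = s" | "s < r" by linarith
  thus ?thesis
  proof cases
    case 3
    hence m: "min (Suc r) s = s" "min r (Suc s) = Suc s" by simp_all
    show ?thesis unfolding m using D[of s r] by simp
  qed (use D0 in simp_all)
qed

text \<open>The sum in the defining relations is the solution of the recursion C(r + 1, s) - C(r, s
  + 1) = D(r, s) with zero boundary values, and this recursion is the coefficient form of
  \<open>rtt\<close>.\<close>

lemma rtt_iff:
  assumes T0: "\<And>i j. fps_nth (T i j) 0 = (if i = j then 1 else 0)"
  shows "rtt T \<longleftrightarrow> (\<forall>i j k l r s.
     fps_nth (T i j) r * fps_nth (T k l) s - fps_nth (T k l) s * fps_nth (T i j) r =
       (\<Sum>t<min r s. fps_nth (T k j) t * fps_nth (T i l) (r + s - 1 - t)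
                       - fps_nth (T k j) (r + s - 1 - t) * fps_nth (T i l) t))"
    (is "_ \<longleftrightarrow> ?R")
proof -
  define D where "D i j k l r s = fps_nth (T k j) r * fps_nth (T i l) s
                       - fps_nth (T k j) s * fps_nth (T i l) r" for i j k l r s
  define C where "C i j k l r s =
    fps_nth (T i j) r * fps_nth (T k l) s - fps_nth (T k l) s * fps_nth (T i j) r" for i j k l r s
  have C0: "C i j k l 0 s = 0" "C i j k l r 0 = 0" for i j k l r s
    by (simp_all add: C_def T0)
  have "rtt T \<longleftrightarrow> (\<forall>i j k l. (\<forall>s. C i j k l 0 s = 0) \<and> (\<forall>r. C i j k l r 0 = 0) \<and>
     (\<forall>r s. C i j k l (Suc r) s - C i j k l r (Suc s) = D i j k l r s))"
    unfolding rtt_def YmX_eq_iff C_def D_def by (simp add: inXY_nth del: fps_mult_nth_0)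
  also have "\<dots> \<longleftrightarrow> (\<forall>i j k l r s. C i j k l (Suc r) s - C i j k l r (Suc s) = D i j k l r s)"
    by (simp add: C0)
  also have "\<dots> \<longleftrightarrow> (\<forall>i j k l r s. C i j k l r s = (\<Sum>t<min r s. D i j k l t (r + s - 1 - t)))"
  proof safe
    fix i j k l r s
    assume *: "\<forall>i j k l r s. C i j k l (Suc r) s - C i j k l r (Suc s) = D i j k l r s"
    show "C i j k l r s = (\<Sum>t<min r s. D i j k l t (r + s - 1 - t))"
    proof (induction r arbitrary: s)
      case (Suc r)
      have "C i j k l (Suc r) s = C i j k l r (Suc s) + D i j k l r s"
        using * by (simp add: algebra_simps)
      also have "D i j k l r s = (\<Sum>t<min (Suc r) s. D i j k l t (r + s - t))
                   - (\<Sum>t<min r (Suc s). D i j k l t (r + s - t))"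
        by (rule min_Suc_cases[symmetric]) (simp_all add: D_def)
      finally show ?case using Suc.IH[of "Suc s"] by simp
    qed (simp add: C_def T0)
  next
    fix i j k l r s
    assume *: "\<forall>i j k l r s. C i j k l r s = (\<Sum>t<min r s. D i j k l t (r + s - 1 - t))"
    show "C i j k l (Suc r) s - C i j k l r (Suc s) = D i j k l r s"
      using min_Suc_cases[of "D i j k l" r s] *[rule_format, of i j k l "Suc r" s]
        *[rule_format, of i j k l r "Suc s"] by (simp add: D_def)
  qed
  finally show ?thesis by (simp add: C_def D_def)
qed

text \<open>Exchanging u and v changes the sign of u - v as well as that of the antisymmetric
  right-hand side.\<close>

lemma rtt_swap:
  assumes "rtt T"
  shows "(Y2 - X2) * (inY (T i j) * inX (T k l) - inX (T k l) * inY (T i j))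
       = X2 * Y2 * (inX (T k j) * inY (T i l) - inY (T k j) * inX (T i l))"
proof -
  let ?F = "\<lambda>r s. fps_nth (T i j) r * fps_nth (T k l) s - fps_nth (T k l) s * fps_nth (T i j) r"
  let ?G = "\<lambda>r s. fps_nth (T k j) r * fps_nth (T i l) s - fps_nth (T k j) s * fps_nth (T i l) r"
  from assms[unfolded rtt_def YmX_eq_iff, rule_format, of i j k l]
  have A: "?F 0 s = 0" "?F r 0 = 0" "?F (Suc r) s - ?F r (Suc s) = ?G r s" for r s
    by (simp_all add: inXY_nth del: fps_mult_nth_0)
  have "?F s (Suc r) - ?F (Suc s) r = ?G r s" for r s
    using A(3)[of s r] by (simp add: algebra_simps)
  thus ?thesis
    unfolding YmX_eq_iff using A(1,2) by (simp add: inXY_nth del: fps_mult_nth_0)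
qed

lemma mult4_swap:
  fixes p q r s :: "'a::ring_1"
  assumes "q * r = r * q"
  shows "p * q * (r * s) = p * r * (q * s)"
  by (metis assms mult.assoc)

lemma comm_split:
  fixes p q r s :: "'a::ring_1"
  assumes "q * r = r * q" "s * p = p * s"
  shows "p * q * (r * s) - r * s * (p * q) = (p * r - r * p) * (q * s) + r * p * (q * s - s * q)"
  unfolding mult4_swap[OF assms(1)] mult4_swap[OF assms(2)] by (simp add: algebra_simps)

lemma central_split:
  fixes z w :: "'a::ring_1"
  assumes z: "\<And>y. y * z = z * y" and w: "\<And>y. y * w = w * y"
    and "L = p * q + r * s" "z * p = w * p'" "z * s = w * s'"
  shows "z * L = w * (p' * q) + w * (r * s')"
proof -
  have "z * L = (z * p) * q + r * (z * s)"
    unfolding assms(3) distrib_left mult.assoc[symmetric] z ..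
  thus ?thesis unfolding assms(4,5) by (simp only: mult.assoc[symmetric] w)
qed

text \<open>This is the comultiplication of the Yangian. Each product of entries leaves two error
  terms, and the unwanted mixed ones cancel only after summation over the inner indices.\<close>

lemma rtt_mult:
  assumes A: "rtt A" and B: "rtt B"
    and AB: "\<And>i j k l r s. fps_nth (A i j) r * fps_nth (B k l) s = fps_nth (B k l) s * fps_nth (A i j) r"
  shows "rtt (\<lambda>i j. A i I1 * B I1 j + A i I2 * B I2 j)"
proof -
  let ?z = "Y2 - X2 :: 'a fps fps" and ?w = "X2 * Y2 :: 'a fps fps"
  have z: "F * ?z = ?z * F" for F 
    by (simp only: left_diff_distrib right_diff_distrib X2_central[of F] Y2_central[of F])
  have w: "F * ?w = ?w * F" for F
    using X2_central[of F] Y2_central[of F] by (metis mult.assoc)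
  have c: "inX (B k l) * inY (A i j) = inY (A i j) * inX (B k l)"
    "inY (B k l) * inX (A i j) = inX (A i j) * inY (B k l)" for i j k l
    by (auto simp: fps_eq_iff inXY_nth AB)
  have step: "?z * (inX (A i a * B a j) * inY (A k b * B b l) - inY (A k b * B b l) * inX (A i a * B a j))
      = ?w * ((inX (A k a) * inY (A i b) - inY (A k a) * inX (A i b)) * (inX (B a j) * inY (B b l)))
        + ?w * (inY (A k b) * inX (A i a) * (inX (B b j) * inY (B a l) - inY (B b j) * inX (B a l)))"
    for i j k l a b
  proof -
    have "inX (A i a * B a j) * inY (A k b * B b l) - inY (A k b * B b l) * inX (A i a * B a j)
      = (inX (A i a) * inY (A k b) - inY (A k b) * inX (A i a)) * (inX (B a j) * inY (B b l))
        + inY (A k b) * inX (A i a) * (inX (B a j) * inY (B b l) - inY (B b l) * inX (B a j))"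
      unfolding inX_simps inY_simps by (rule comm_split) (rule c)+
    thus ?thesis
      by (rule central_split[where z = ?z and w = ?w, OF z w])
        (use A B in \<open>auto simp only: rtt_def\<close>)
  qed
  have [simp]: "inX (A k a * B a j) * inY (A i b * B b l) =
      inX (A k a) * inY (A i b) * (inX (B a j) * inY (B b l))"
    "inY (A k a * B a j) * inX (A i b * B b l) =
      inY (A k a) * inX (A i b) * (inY (B a j) * inX (B b l))" for i j k l a b
    unfolding inX_simps inY_simps using c mult4_swap by blast+
  show ?thesis unfolding rtt_def
  proof (intro allI)
    fix i j k l
    let ?S = "\<lambda>f. f I1 I1 + f I1 I2 + f I2 I1 + f I2 I2 :: 'a fps fps"
    let ?L = "\<lambda>a b. inX (A i a * B a j) * inY (A k b * B b l) - inY (A k b * B b l) * inX (A i a * B a j)"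
    let ?P = "\<lambda>a b. (inX (A k a) * inY (A i b) - inY (A k a) * inX (A i b)) * (inX (B a j) * inY (B b l))
        + inY (A k b) * inX (A i a) * (inX (B b j) * inY (B a l) - inY (B b j) * inX (B a l))"
    let ?Q = "\<lambda>a b. inX (A k a) * inY (A i b) * (inX (B a j) * inY (B b l))
                 - inY (A k a) * inX (A i b) * (inY (B a j) * inX (B b l))"
    have "?z * (inX (A i I1 * B I1 j + A i I2 * B I2 j) * inY (A k I1 * B I1 l + A k I2 * B I2 l) -
            inY (A k I1 * B I1 l + A k I2 * B I2 l) * inX (A i I1 * B I1 j + A i I2 * B I2 j))
        = ?z * ?S ?L"
      unfolding inX_simps(1) inY_simps(1) by (rule arg_cong) (simp only: distrib_left distrib_right, simp add: algebra_simps)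
    also have "\<dots> = ?S (\<lambda>a b. ?z * ?L a b)" by (simp only: distrib_left)
    also have "\<dots> = ?w * ?S ?P" unfolding step by (simp only: distrib_left add.assoc)
    \<comment> \<open>Up to an exchange of the inner indices, the terms
      \<open>inY (A k a) * inX (A i b) * (inX (B a j) * inY (B b l))\<close> occur with both
      signs.\<close>
    also have "?S ?P = ?S ?Q" by (simp add: algebra_simps)
    also have "?S ?Q = inX (A k I1 * B I1 j + A k I2 * B I2 j) * inY (A i I1 * B I1 l + A i I2 * B I2 l) -
            inY (A k I1 * B I1 j + A k I2 * B I2 j) * inX (A i I1 * B I1 l + A i I2 * B I2 l)"
      unfolding inX_simps(1) inY_simps(1) distrib_left distrib_right by simp
    finally show "?z * (inX (A i I1 * B I1 j + A i I2 * B I2 j) * inY (A k I1 * B I1 l + A k I2 * B I2 l) -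
            inY (A k I1 * B I1 l + A k I2 * B I2 l) * inX (A i I1 * B I1 j + A i I2 * B I2 j))
       = ?w * (inX (A k I1 * B I1 j + A k I2 * B I2 j) * inY (A i I1 * B I1 l + A i I2 * B I2 l) -
            inY (A k I1 * B I1 j + A k I2 * B I2 j) * inX (A i I1 * B I1 l + A i I2 * B I2 l))" .
  qed
qed

section \<open>Shifts of the variable\<close>

lemma power_nth_small:
  fixes y :: "'a::ring_1 fps"
  assumes "fps_nth y 0 = 0" "n < j"
  shows "fps_nth (y ^ j) n = 0" "fps_nth (g * y ^ j) n = 0"
proof -
  have *: "fps_nth (y ^ j) n = 0" if "n < j" for n j
    using that
  proof (induction j arbitrary: n)
    case (Suc j)
    have "fps_nth y i * fps_nth (y ^ j) (n - i) = 0" if "i \<le> n" for i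
      using Suc assms(1) that by (cases i) auto
    thus ?case by (simp add: fps_mult_nth)
  qed simp
  show "fps_nth (y ^ j) n = 0" by (rule *[OF assms(2)])
  show "fps_nth (g * y ^ j) n = 0"
    using assms(2) *[OF le_less_trans[OF diff_le_self]] by (simp add: fps_mult_nth)
qed

text \<open>Substitution of \<open>y\<close> for the outer variable. If \<open>y\<close> has no
  constant term, powers beyond the n-th do not reach degree n, whence the finite sum.\<close>

definition ev :: "'a::ring_1 fps \<Rightarrow> 'a fps fps \<Rightarrow> 'a fps" where
  "ev y G = Abs_fps (\<lambda>n. \<Sum>j\<le>n. fps_nth (fps_nth G j * y ^ j) n)"

lemma ev_nth:
  assumes "fps_nth y 0 = 0" "n \<le> N"
  shows "fps_nth (ev y G) n = (\<Sum>j\<le>N. fps_nth (fps_nth G j * y ^ j) n)"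
proof -
  have "(\<Sum>j\<le>n. fps_nth (fps_nth G j * y ^ j) n) = (\<Sum>j\<le>N. fps_nth (fps_nth G j * y ^ j) n)"
    by (rule sum.mono_neutral_left) (use assms in \<open>auto intro!: power_nth_small\<close>)
  thus ?thesis by (simp add: ev_def)
qed

lemma ev_add: "ev y (F + G) = ev y F + ev y G"
  and ev_diff: "ev y (F - G) = ev y F - ev y G"
  by (simp_all add: ev_def fps_eq_iff distrib_right left_diff_distrib sum.distrib sum_subtractf)

text \<open>The coefficients need not commute with each other, so multiplicativity rests on moving
  the powers of the central \<open>y\<close> past them.\<close>

lemma ev_mult:
  fixes F G :: "'a::ring_1 fps fps"
  assumes y0: "fps_nth y 0 = 0" and c: "\<And>f. f * y = y * f"
  shows "ev y (F * G) = ev y F * ev y G"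
proof (rule fps_ext)
  fix n
  have cp: "f * y ^ j = y ^ j * f" for f j
    by (induction j) (simp_all add: mult.assoc[symmetric] c, simp add: mult.assoc c)
  let ?t = "\<lambda>i j. fps_nth F i * fps_nth G j * y ^ (i + j)"
  have t: "fps_nth F i * y ^ i * (fps_nth G j * y ^ j) = ?t i j" for i j
    by (metis cp mult.assoc power_add)
  have "fps_nth (ev y F * ev y G) n
      = (\<Sum>m=0..n. (\<Sum>i\<le>n. fps_nth (fps_nth F i * y ^ i) m) *
                     (\<Sum>j\<le>n. fps_nth (fps_nth G j * y ^ j) (n - m)))"
    unfolding fps_mult_nth[of "ev y F"] by (intro sum.cong refl arg_cong2[of _ _ _ _ "(*)"] ev_nth y0) auto
  also have "\<dots> = (\<Sum>i\<le>n. \<Sum>j\<le>n. fps_nth (?t i j) n)"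
  proof -
    have "(\<Sum>m=0..n. (\<Sum>i\<le>n. fps_nth (fps_nth F i * y ^ i) m) *
                     (\<Sum>j\<le>n. fps_nth (fps_nth G j * y ^ j) (n - m)))
      = (\<Sum>m=0..n. \<Sum>i\<le>n. \<Sum>j\<le>n. fps_nth (fps_nth F i * y ^ i) m * fps_nth (fps_nth G j * y ^ j) (n - m))"
      by (simp only: sum_product)
    also have "\<dots> = (\<Sum>i\<le>n. \<Sum>j\<le>n. \<Sum>m=0..n. fps_nth (fps_nth F i * y ^ i) m * fps_nth (fps_nth G j * y ^ j) (n - m))"
      by (subst sum.swap, rule sum.cong[OF refl], rule sum.swap)
    also have "\<dots> = (\<Sum>i\<le>n. \<Sum>j\<le>n. fps_nth (?t i j) n)"
      by (simp only: fps_mult_nth[symmetric] t)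
    finally show ?thesis .
  qed
  \<comment> \<open>Terms with i + j > n start beyond degree n.\<close>
  also have "\<dots> = (\<Sum>(i, j)\<in>{(i, j). i \<le> n \<and> j \<le> n}. fps_nth (?t i j) n)"
    by (subst sum.cartesian_product, rule sum.cong) auto
  also have "\<dots> = (\<Sum>(i, j)\<in>{(i, j). i + j \<le> n}. fps_nth (?t i j) n)"
    by (rule sum.mono_neutral_right)
      (auto intro!: power_nth_small y0 intro: finite_subset[of _ "{..n} \<times> {..n}"])
  also have "\<dots> = (\<Sum>(l, i)\<in>(SIGMA l:{..n}. {0..l}). fps_nth (?t i (l - i)) n)"
    by (rule sum.reindex_bij_witness[of _ "\<lambda>(l, i). (i, l - i)" "\<lambda>(i, j). (i + j, i)"]) auto
  also have "\<dots> = (\<Sum>l\<le>n. \<Sum>i=0..l. fps_nth (?t i (l - i)) n)"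
    by (rule sum.Sigma[symmetric]) auto
  also have "\<dots> = (\<Sum>l\<le>n. fps_nth (fps_nth (F * G) l * y ^ l) n)"
    by (rule sum.cong[OF refl]) (simp add: fps_mult_nth[of F G] sum_distrib_right fps_sum_nth)
  finally show "fps_nth (ev y (F * G)) n = fps_nth (ev y F * ev y G) n"
    by (simp add: ev_def)
qed

lemma compose_eq_ev: "fps_compose g y = ev y (inY g)"
  by (rule fps_ext) (simp add: ev_def fps_compose_nth inY_nth atMost_atLeast0)

lemma compose_mult:
  fixes y :: "'a::ring_1 fps"
  assumes "fps_nth y 0 = 0" "\<And>f. f * y = y * f"
  shows "fps_compose (f * g) y = fps_compose f y * fps_compose g y"
  by (simp add: compose_eq_ev inY_simps ev_mult[OF assms])

text \<open>With X = 1/u, \<open>geom s\<close> is 1/(1 - s X), \<open>xi s\<close> is 1/(u - s),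
  and \<open>sh s\<close> substitutes u - s for u. Integer shifts are used because both e(u - 1) and
  e(u + 1) occur.\<close>

definition geom :: "int \<Rightarrow> 'a::ring_1 fps" where "geom s = Abs_fps (\<lambda>n. of_int s ^ n)"

definition xi :: "int \<Rightarrow> 'a::ring_1 fps" where "xi s = fps_X * geom s"

definition sh :: "int \<Rightarrow> 'a::ring_1 fps \<Rightarrow> 'a fps" where "sh s g = fps_compose g (xi s)"

lemma u_shift_eq_sh: "u_shift c = sh (int c)"
  by (rule ext) (simp add: u_shift_def sh_def xi_def geom_def)

lemma geom_central: "f * geom s = geom s * f"
proof (rule fps_ext)
  fix n
  have "of_int s ^ m * (c :: 'a) = c * of_int s ^ m" for m c
    by (metis mult_of_int_commute of_int_power)
  thus "fps_nth (f * geom s) n = fps_nth (geom s * f) n"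
    unfolding fps_mult_nth geom_def
    by (intro sum.reindex_bij_witness[of _ "\<lambda>t. n - t" "\<lambda>t. n - t"]) auto
qed

lemma X_central: "f * fps_X = fps_X * (f :: 'a::ring_1 fps)"
  by (simp add: fps_eq_iff)

lemma xi_central: "f * xi s = xi s * f"
  unfolding xi_def by (metis X_central geom_central mult.assoc)

lemma xi_0: "fps_nth (xi s) 0 = 0"
  by (simp add: xi_def)

lemma of_int_central: "f * of_int s = of_int s * (f :: 'a::ring_1)"
  by (metis mult_of_int_commute)

lemma geom_inverse: "(1 - of_int s * fps_X) * geom s = (1 :: 'a::ring_1 fps)"
proof (rule fps_ext)
  fix n
  have "fps_nth (of_int s * fps_X * geom s :: 'a fps) n = (if n = 0 then 0 else of_int s ^ n)"
    by (cases n) (simp_all add: mult.assoc fps_of_int[symmetric] geom_def)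
  thus "fps_nth ((1 - of_int s * fps_X) * geom s) n = fps_nth (1 :: 'a fps) n"
    by (simp add: left_diff_distrib geom_def)
qed

lemma sh_simps:
  fixes f g :: "'a::ring_1 fps" and c :: 'a
  shows "sh s (f + g) = sh s f + sh s g" "sh s (f - g) = sh s f - sh s g" "sh s (f * g) = sh s f * sh s g"
  "sh s 1 = (1 :: 'a fps)" "sh s 0 = (0 :: 'a fps)" "sh s (fps_const c) = fps_const c" "sh s fps_X = (xi s :: 'a fps)"
proof -
  show "sh s (fps_const c) = fps_const c"
    by (rule fps_ext) (simp add: sh_def fps_compose_nth mult_delta_left)
  show "sh s fps_X = (xi s :: 'a fps)"
    by (rule fps_ext) (auto simp: sh_def fps_compose_nth mult_delta_left xi_0 not_less_eq_eq)
qed (simp_all add: sh_def fps_compose_add_distrib fps_compose_sub_distrib compose_mult xi_0 xi_central)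

lemma sh_nth_0: "fps_nth (sh s f) 0 = fps_nth f 0"
  by (simp add: sh_def)

lemma sh_0: "sh 0 f = f"
proof -
  have *: "xi 0 = (fps_X :: 'a fps)"
    by (rule fps_ext) (auto simp: xi_def geom_def power_0_left)
  show ?thesis unfolding sh_def * by (rule fps_ext) (simp add: fps_compose_nth mult_delta_right)
qed

text \<open>In characteristic p this identifies the shifts by -1 and by p - 1.\<close>

lemma sh_cong: "of_int s = (of_int t :: 'a::ring_1) \<Longrightarrow> sh s = (sh t :: 'a fps \<Rightarrow> 'a fps)"
  by (rule ext) (simp add: sh_def xi_def geom_def)

lemma xi_diff: "xi t - xi s = of_int (t - s) * (xi s * xi t :: 'a::ring_1 fps)"
proof -
  have "geom t - geom s = geom t * ((1 - of_int s * fps_X) * geom s) - ((1 - of_int t * fps_X) * geom t) * (geom s :: 'a fps)"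
    by (simp only: geom_inverse) simp
  also have "\<dots> = geom t * (1 - of_int s * fps_X) * geom s - geom t * (1 - of_int t * fps_X) * geom s"
    unfolding geom_central[of "1 - of_int t * fps_X"] by (simp only: mult.assoc)
  also have "\<dots> = geom t * ((of_int t - of_int s) * fps_X) * geom s"
    by (simp add: algebra_simps)
  also have "\<dots> = of_int (t - s) * (fps_X * (geom t * geom s))"
    unfolding of_int_diff[symmetric] geom_central[of "_ * fps_X" t, symmetric] mult.assoc ..
  finally have "xi t - xi s = fps_X * (of_int (t - s) * (fps_X * (geom t * geom s :: 'a fps)))"
    by (simp only: xi_def right_diff_distrib[symmetric])
  also have "\<dots> = of_int (t - s) * (fps_X * (fps_X * (geom t * geom s)))"
    by (simp only: mult.assoc[symmetric] of_int_central)
  also have "fps_X * (fps_X * (geom t * geom s)) = xi s * (xi t :: 'a fps)"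
    unfolding xi_def mult.assoc geom_central[of "fps_X * geom t" s, symmetric] ..
  finally show ?thesis .
qed

lemma xi_cancel: "xi s * f = xi s * g \<Longrightarrow> f = (g :: 'a::ring_1 fps)"
proof -
  assume "xi s * f = xi s * g"
  hence *: "fps_X * (geom s * f) = fps_X * (geom s * g)" by (simp add: xi_def mult.assoc)
  have "fps_nth (geom s * f) n = fps_nth (geom s * g) n" for n
    using arg_cong[OF *, of "\<lambda>h. fps_nth h (Suc n)"] by simp
  hence "geom s * f = geom s * g" by (rule fps_ext)
  hence "((1 - of_int s * fps_X) * geom s) * f = ((1 - of_int s * fps_X) * geom s) * g"
    by (simp only: mult.assoc)
  thus ?thesis by (simp only: geom_inverse mult_1_left)
qed

text \<open>Substitution of \<open>u - s\<close> and \<open>u - t\<close> for the two variables.\<close>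

definition phi :: "int \<Rightarrow> int \<Rightarrow> 'a::ring_1 fps fps \<Rightarrow> 'a fps" where
  "phi s t F = ev (xi t) (Abs_fps (\<lambda>j. sh s (fps_nth F j)))"

lemma sh_sum: "sh s (sum f A) = (\<Sum>x\<in>A. sh s (f x))"
  by (induction A rule: infinite_finite_induct) (simp_all add: sh_simps)

lemma phi_mult: "phi s t (F * G) = phi s t F * phi s t G"
proof -
  have "Abs_fps (\<lambda>j. sh s (fps_nth (F * G) j)) =
      Abs_fps (\<lambda>j. sh s (fps_nth F j)) * Abs_fps (\<lambda>j. sh s (fps_nth G j))"
    by (rule fps_ext) (simp add: fps_mult_nth sh_sum sh_simps)
  thus ?thesis by (simp add: phi_def ev_mult xi_0 xi_central)
qed

lemma phi_simps:
  fixes F G :: "'a::ring_1 fps fps" and f :: "'a fps"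
  shows "phi s t (F + G) = phi s t F + phi s t G" "phi s t (F - G) = phi s t F - phi s t G"
  "phi s t (F * G) = phi s t F * phi s t G"
  "phi s t (inX f) = sh s f" "phi s t (inY f) = sh t f" "phi s t X2 = (xi s :: 'a fps)" "phi s t Y2 = (xi t :: 'a fps)"
proof -
  have "Abs_fps (\<lambda>j. sh s (fps_nth (F + G) j)) =
      Abs_fps (\<lambda>j. sh s (fps_nth F j)) + Abs_fps (\<lambda>j. sh s (fps_nth G j))"
    "Abs_fps (\<lambda>j. sh s (fps_nth (F - G) j)) =
      Abs_fps (\<lambda>j. sh s (fps_nth F j)) - Abs_fps (\<lambda>j. sh s (fps_nth G j))"
    by (auto simp: fps_eq_iff sh_simps)
  thus "phi s t (F + G) = phi s t F + phi s t G" "phi s t (F - G) = phi s t F - phi s t G"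
    by (simp_all add: phi_def ev_add ev_diff)
  show X: "phi s t (inX f) = sh s f" for f :: "'a fps"
  proof (rule fps_ext)
    fix n
    have "fps_nth (phi s t (inX f)) n = (\<Sum>j\<le>n. if j = 0 then fps_nth (sh s f) n else 0)"
      unfolding phi_def ev_def inX_def fps_nth_Abs_fps by (rule sum.cong) (auto simp: sh_simps)
    thus "fps_nth (phi s t (inX f)) n = fps_nth (sh s f) n" by simp
  qed
  show Y: "phi s t (inY f) = sh t f" for f :: "'a fps"
  proof -
    have "Abs_fps (\<lambda>j. sh s (fps_nth (inY f) j)) = inY f"
      by (rule fps_ext) (simp add: inY_nth sh_simps)
    thus ?thesis by (simp add: phi_def sh_def compose_eq_ev)
  qed
  show "phi s t X2 = (xi s :: 'a fps)" "phi s t Y2 = (xi t :: 'a fps)"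
    using X[of fps_X] Y[of fps_X] by (simp_all add: sh_simps inX_simps inY_simps)
qed (rule phi_mult)

text \<open>The substitution turns u - v into (u - s) - (u - t) = t - s, and the factors 1/(u - s)
  and 1/(u - t) can be cancelled.\<close>

lemma phi_YmX:
  assumes "(Y2 - X2) * F = X2 * Y2 * G"
  shows "of_int (t - s) * phi s t F = phi s t G"
proof -
  have "xi s * (xi t * (of_int (t - s) * phi s t F)) = (of_int (t - s) * (xi s * xi t)) * phi s t F"
    unfolding of_int_central[of "xi s * xi t", symmetric] mult.assoc ..
  also have "\<dots> = phi s t ((Y2 - X2) * F)" by (simp only: phi_simps xi_diff)
  also have "\<dots> = xi s * (xi t * phi s t G)" by (simp only: assms phi_simps mult.assoc)
  finally show ?thesis by (blast dest: xi_cancel)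
qed

section \<open>Relations between the Drinfeld generators\<close>

text \<open>Read (u - v) P = Q. As a relation between P and Q it is stable under sums and under
  multiplication by arbitrary series on either side.\<close>

definition zw :: "'a::ring_1 fps fps \<Rightarrow> 'a fps fps \<Rightarrow> bool" where
  "zw P Q \<longleftrightarrow> (Y2 - X2) * P = X2 * Y2 * Q"

lemma z_central: "F * (Y2 - X2) = (Y2 - X2) * F"
  by (simp only: left_diff_distrib right_diff_distrib X2_central[of F] Y2_central[of F])

lemma w_central: "F * (X2 * Y2) = X2 * Y2 * F"
  using X2_central[of F] Y2_central[of F] by (metis mult.assoc)

lemma zw_add: "zw P Q \<Longrightarrow> zw P' Q' \<Longrightarrow> zw (P + P') (Q + Q')"
  and zw_diff: "zw P Q \<Longrightarrow> zw P' Q' \<Longrightarrow> zw (P - P') (Q - Q')"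
  and zw_minus: "zw P Q \<Longrightarrow> zw (- P) (- Q)"
  by (simp_all add: zw_def distrib_left right_diff_distrib)

lemma zw_left: "zw P Q \<Longrightarrow> zw (F * P) (F * Q)"
  unfolding zw_def by (metis z_central w_central mult.assoc)

lemma zw_right: "zw P Q \<Longrightarrow> zw (P * F) (Q * F)"
  unfolding zw_def by (metis mult.assoc)

lemma zw_0: "zw P 0 \<Longrightarrow> P = 0"
  unfolding zw_def using YmX_cancel by auto

lemma zw_self: "zw P P \<Longrightarrow> P = 0"
  unfolding zw_def by (rule YmX_eq_self)

lemma rtt_zw:
  assumes "rtt T"
  shows "zw (inX (T i j) * inY (T k l) - inY (T k l) * inX (T i j))
            (inX (T k j) * inY (T i l) - inY (T k j) * inX (T i l))"
    "zw (inY (T i j) * inX (T k l) - inX (T k l) * inY (T i j))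
            (inX (T k j) * inY (T i l) - inY (T k j) * inX (T i l))"
  using assms rtt_swap[OF assms, of i j k l] by (simp_all add: rtt_def zw_def)

declare d_series.simps [simp del]

text \<open>The locale only fixes the coefficient type and the abbreviations for the series.\<close>

locale yang =
  fixes K :: "'k::comm_ring_1 itself"
begin

abbreviation A :: "'k yangian fps" where "A \<equiv> t_series I1 I1"
abbreviation B :: "'k yangian fps" where "B \<equiv> t_series I1 I2"
abbreviation C :: "'k yangian fps" where "C \<equiv> t_series I2 I1"
abbreviation G :: "'k yangian fps" where "G \<equiv> t_series I2 I2"
abbreviation E :: "'k yangian fps" where "E \<equiv> e_series"
abbreviation F :: "'k yangian fps" where "F \<equiv> f_series"
abbreviation D :: "'k yangian fps" where "D \<equiv> d_series I2"

lemma rtt_t_series: "rtt (t_series :: ix \<Rightarrow> ix \<Rightarrow> 'k yangian fps)"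
proof (subst rtt_iff)
  show "fps_nth (t_series i j) 0 = (if i = j then 1 else (0 :: 'k yangian))" for i j
    by (simp add: t_series_def t_gen_0)
  show "\<forall>i j k l r s. fps_nth (t_series i j) r * fps_nth (t_series k l) s -
      fps_nth (t_series k l) s * fps_nth (t_series i j) r =
      (\<Sum>t<min r s. fps_nth (t_series k j) t * fps_nth (t_series i l) (r + s - 1 - t)
         - fps_nth (t_series k j) (r + s - 1 - t) * (fps_nth (t_series i l) t :: 'k yangian))"
  proof (intro allI)
    fix i j k l and r s :: nat
    show "fps_nth (t_series i j) r * fps_nth (t_series k l) s -
      fps_nth (t_series k l) s * fps_nth (t_series i j) r =
      (\<Sum>t<min r s. fps_nth (t_series k j) t * fps_nth (t_series i l) (r + s - 1 - t)
         - fps_nth (t_series k j) (r + s - 1 - t) * (fps_nth (t_series i l) t :: 'k yangian))"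
    proof (cases "r > 0 \<and> s > 0")
      case True
      thus ?thesis using yangian_relation[of r s i j k l] by (simp add: t_series_def)
    next
      case False
      thus ?thesis by (auto simp: t_series_def t_gen_0)
    qed
  qed
qed

lemmas yang_zw = rtt_zw[OF rtt_t_series]

lemma A_inv: "A * d1_inv = (1 :: 'k yangian fps)" "d1_inv * A = (1 :: 'k yangian fps)"
proof -
  have const: "fps_nth A 0 = (1 :: 'k yangian)"
    by (simp add: t_series_def t_gen_0)
  show "A * d1_inv = (1 :: 'k yangian fps)"
    unfolding d1_inv_def by (rule fps_right_inverse) (simp add: const)
  show "d1_inv * A = (1 :: 'k yangian fps)"
    unfolding d1_inv_def by (rule fps_left_inverse'[where x = 1]) (simp_all add: const)
qed

lemma inA_inv:
  "inX A * inX d1_inv = (1 :: 'k yangian fps fps)"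
  "inX d1_inv * inX A = (1 :: 'k yangian fps fps)"
  "inY A * inY d1_inv = (1 :: 'k yangian fps fps)"
  "inY d1_inv * inY A = (1 :: 'k yangian fps fps)"
  by (simp_all only: inX_simps(3)[symmetric] inY_simps(3)[symmetric] A_inv inX_simps(4) inY_simps(4))

lemma cancel_left: "i * a = 1 \<Longrightarrow> a * x = a * y \<Longrightarrow> x = (y :: 'a::ring_1)"
  by (metis mult.assoc mult_1_left)

lemma cancel_right: "a * i = 1 \<Longrightarrow> x * a = y * a \<Longrightarrow> x = (y :: 'a::ring_1)"
  by (metis mult.assoc mult_1_right)

lemma gauss_BCG:
  "B = A * (E :: 'k yangian fps)" "C = F * (A :: 'k yangian fps)"
  "G = F * A * E + (D :: 'k yangian fps)"
  using gauss_decomposition[where ?'k = 'k] by (simp_all only: d_series.simps(1))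

lemma in_BCG:
  "inX B = inX A * inX E" "inX C = inX F * inX A" "inX G = inX F * inX A * inX E + inX D"
  "inY B = inY A * inY E" "inY C = inY F * inY A" "inY G = inY F * inY A * inY E + inY D"
  unfolding gauss_BCG inX_simps inY_simps by simp_all

text \<open>For equal index pairs the right-hand side of the RTT relation is the commutator itself,
  and u - v - 1 can be cancelled.\<close>

lemma tt_commute:
  "inX (t_series i j :: 'k yangian fps) * inY (t_series i j) = inY (t_series i j) * inX (t_series i j)"
  using zw_self[OF yang_zw(1)[of i j i j]] by simp

lemma mult_left_swap: "a * b = b * a \<Longrightarrow> a * (b * c) = b * (a * (c :: 'a::ring_1))"
  by (metis mult.assoc)

text \<open>Substituting t_12 = d_1 e into the relation of t_11 with t_12 leaves a common left
  factor d_1, which is invertible. The second form is the same with u and v exchanged in the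
  commutator.\<close>

lemma comm_AE:
  "zw (inX A * inY E - inY E * inX A) (inX A * (inY E - inX E))"
  "zw (inY A * inX E - inX E * inY A) (inY A * (inY E - inX E))"
proof -
  note aa = tt_commute[of I1 I1] and aa2 = mult_left_swap[OF tt_commute[of I1 I1]]
  have "zw (inX A * inY B - inY B * inX A) (inX A * inY B - inY A * inX B)"
    using yang_zw(1)[of I1 I1 I1 I2] .
  also have "inX A * inY B - inY B * inX A = inY A * (inX A * inY E - inY E * inX A)"
    unfolding in_BCG by (simp add: algebra_simps aa aa2)
  also have "inX A * inY B - inY A * inX B = inY A * (inX A * (inY E - inX E))"
    unfolding in_BCG by (simp add: algebra_simps aa aa2)
  finally have "zw (inY A * (inX A * inY E - inY E * inX A)) (inY A * (inX A * (inY E - inX E)))" .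
  from zw_left[OF this, of "inY d1_inv"]
  show "zw (inX A * inY E - inY E * inX A) (inX A * (inY E - inX E))"
    by (simp only: mult.assoc[symmetric] inA_inv mult_1_left)
  have "zw (inY A * inX B - inX B * inY A) (inX A * inY B - inY A * inX B)"
    using yang_zw(2)[of I1 I1 I1 I2] .
  also have "inY A * inX B - inX B * inY A = inX A * (inY A * inX E - inX E * inY A)"
    unfolding in_BCG by (simp add: algebra_simps aa aa2)
  also have "inX A * inY B - inY A * inX B = inX A * (inY A * (inY E - inX E))"
    unfolding in_BCG by (simp add: algebra_simps aa aa2)
  finally have "zw (inX A * (inY A * inX E - inX E * inY A)) (inX A * (inY A * (inY E - inX E)))" .
  from zw_left[OF this, of "inX d1_inv"]
  show "zw (inY A * inX E - inX E * inY A) (inY A * (inY E - inX E))"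
    by (simp only: mult.assoc[symmetric] inA_inv mult_1_left)
qed

lemma comm_AF: "zw (inX A * inY F - inY F * inX A) ((inX F - inY F) * inX A)"
proof -
  note aa = tt_commute[of I1 I1] and aa2 = mult_left_swap[OF tt_commute[of I1 I1]]
  have "zw (inX A * inY C - inY C * inX A) (inX C * inY A - inY C * inX A)"
    using yang_zw(1)[of I1 I1 I2 I1] .
  also have "inX A * inY C - inY C * inX A = (inX A * inY F - inY F * inX A) * inY A"
    unfolding in_BCG by (simp add: algebra_simps aa)
  also have "inX C * inY A - inY C * inX A = (inX F - inY F) * inX A * inY A"
    unfolding in_BCG by (simp add: algebra_simps aa)
  finally have "zw ((inX A * inY F - inY F * inX A) * inY A) ((inX F - inY F) * inX A * inY A)" .
  from zw_right[OF this, of "inY d1_inv"] show ?thesis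
    by (simp only: mult.assoc inA_inv mult_1_right)
qed

text \<open>The series t_12(u) and t_12(v) commute; moving the factors d_1 of t_12 = d_1 e to the
  left by both forms of \<open>comm_AE\<close> converts this into a relation for e alone.\<close>

lemma comm_EE: "zw (inX E * inY E - inY E * inX E) ((inX E - inY E) * (inX E - inY E))"
proof -
  note aa = tt_commute[of I1 I1] and aa2 = mult_left_swap[OF tt_commute[of I1 I1]]
  have bb: "inX A * inX E * (inY A * inY E) = inY A * inY E * (inX A * inX E)"
    using tt_commute[of I1 I2] unfolding in_BCG .
  have "inY A * inX A * (inX E * inY E - inY E * inX E)
      = inX A * (inY A * inX E - inX E * inY A) * inY E - inY A * (inX A * inY E - inY E * inX A) * inX E"
    using bb by (simp add: algebra_simps aa aa2)
  moreover have "zw (inX A * (inY A * inX E - inX E * inY A) * inY E - inY A * (inX A * inY E - inY E * inX A) * inX E)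
       (inX A * (inY A * (inY E - inX E)) * inY E - inY A * (inX A * (inY E - inX E)) * inX E)"
    by (intro zw_diff zw_left zw_right comm_AE)
  moreover have "inX A * (inY A * (inY E - inX E)) * inY E - inY A * (inX A * (inY E - inX E)) * inX E
      = inY A * inX A * ((inX E - inY E) * (inX E - inY E))"
    by (simp add: algebra_simps aa aa2)
  ultimately have "zw (inY A * inX A * (inX E * inY E - inY E * inX E))
     (inY A * inX A * ((inX E - inY E) * (inX E - inY E)))" by (simp only:)
  from zw_left[OF zw_left[OF this, of "inY d1_inv"], of "inX d1_inv"] show ?thesis
    by (simp only: mult.assoc[symmetric] inA_inv mult_1_left)
qed

text \<open>The right-hand side of the relation between t_11 and t_22 is entirely produced by the
  summand f d_1 e of t_22, so nothing is left for d_2.\<close>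

lemma AD_commute: "inX A * inY D = inY D * inX A"
proof -
  note aa = tt_commute[of I1 I1] and aa2 = mult_left_swap[OF tt_commute[of I1 I1]]
  have "inX A * inY D - inY D * inX A = (inX A * inY G - inY G * inX A)
      - ((inX A * inY F - inY F * inX A) * inY A * inY E + inY F * inY A * (inX A * inY E - inY E * inX A))"
    unfolding in_BCG by (simp add: algebra_simps aa aa2)
  moreover have "zw ((inX A * inY G - inY G * inX A)
      - ((inX A * inY F - inY F * inX A) * inY A * inY E + inY F * inY A * (inX A * inY E - inY E * inX A)))
     ((inX C * inY B - inY C * inX B) - ((inX F - inY F) * inX A * inY A * inY E + inY F * inY A * (inX A * (inY E - inX E))))"
    by (intro zw_diff[OF yang_zw(1)[of I1 I1 I2 I2]] zw_add zw_left zw_right comm_AE comm_AF)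
  moreover have "(inX C * inY B - inY C * inX B) - ((inX F - inY F) * inX A * inY A * inY E + inY F * inY A * (inX A * (inY E - inX E))) = 0"
    unfolding in_BCG by (simp add: algebra_simps aa aa2)
  ultimately show ?thesis using zw_0 by (metis right_minus_eq)
qed

text \<open>Division by d_1(u) on the left and by d_1(v) on the right makes this (u - v)[e(u), f(v)]
  = h(u) - h(v) with h = d_2/d_1. The undivided form is what the relation between t_12 and t_21
  gives directly.\<close>

lemma comm_EF:
  "zw (inX A * (inX E * inY F - inY F * inX E) * inY A) (inX D * inY A - inY D * inX A)"
proof -
  note aa = tt_commute[of I1 I1] and aa2 = mult_left_swap[OF tt_commute[of I1 I1]]
  have "zw (inX A * (inX E * inY A - inY A * inX E) + inY A * (inX A * inY E - inY E * inX A))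
      (inX A * - (inY A * (inY E - inX E)) + inY A * (inX A * (inY E - inX E)))"
    using zw_minus[OF comm_AE(2)] by (intro zw_add zw_left comm_AE) simp
  also have "inX A * - (inY A * (inY E - inX E)) + inY A * (inX A * (inY E - inX E)) = 0"
    by (simp add: algebra_simps aa aa2)
  \<comment> \<open>This identity, a combination of both forms of \<open>comm_AE\<close>, removes
    the terms with a factor f(v) from the right-hand side below.\<close>
  finally have res: "inX A * (inX E * inY A - inY A * inX E) + inY A * (inX A * inY E - inY E * inX A) = 0"
    by (rule zw_0)
  have "inX A * (inX E * inY F - inY F * inX E) * inY A = (inX B * inY C - inY C * inX B)
     - ((inX A * inY F - inY F * inX A) * inX E * inY A + inY F * inX A * - (inY A * inX E - inX E * inY A))"
    unfolding in_BCG by (simp add: algebra_simps aa aa2)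
  moreover have "zw ((inX B * inY C - inY C * inX B)
     - ((inX A * inY F - inY F * inX A) * inX E * inY A + inY F * inX A * - (inY A * inX E - inX E * inY A)))
     ((inX G * inY A - inY G * inX A) - ((inX F - inY F) * inX A * inX E * inY A + inY F * inX A * - (inY A * (inY E - inX E))))"
    by (intro zw_diff[OF yang_zw(1)[of I1 I2 I2 I1]] zw_add zw_left zw_right zw_minus comm_AE comm_AF)
  moreover have "(inX G * inY A - inY G * inX A) - ((inX F - inY F) * inX A * inX E * inY A + inY F * inX A * - (inY A * (inY E - inX E)))
    = inX D * inY A - inY D * inX A + inY F * (inX A * (inX E * inY A - inY A * inX E) + inY A * (inX A * inY E - inY E * inX A))"
    unfolding in_BCG by (simp add: algebra_simps aa aa2)
  ultimately show ?thesis by (simp add: res)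
qed

text \<open>The first coefficient of \<open>e\<close> is the gl(2)-element \<open>t\<^sub>1\<^sub>2\<close> and acts on all generators by the adjoint action.\<close>

definition x0 :: "'k yangian fps" where "x0 = fps_const (t_gen I1 I2 1)"

lemma x0_t: "x0 * t_series k l - t_series k l * x0 =
    (if k = I2 then t_series I1 l else 0) - (if l = I1 then t_series k I2 else (0 :: 'k yangian fps))"
proof (rule fps_ext)
  fix s
  show "fps_nth (x0 * t_series k l - t_series k l * x0) s =
    fps_nth ((if k = I2 then t_series I1 l else 0) - (if l = I1 then t_series k I2 else (0 :: 'k yangian fps))) s"
  proof (cases "s = 0")
    case False
    thus ?thesis using yangian_relation[of 1 s I1 I2 k l, where ?'a = 'k]
      by (cases k; cases l; simp add: x0_def t_series_def t_gen_0)
  qed (cases k; cases l; simp add: x0_def t_series_def t_gen_0)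
qed

lemma x0_A: "x0 * A - A * x0 = - (A * E)"
  using x0_t[of I1 I1] by (simp add: gauss_BCG)

lemma x0_F_A: "(x0 * F - F * x0) * A = A - (D :: 'k yangian fps)"
proof -
  have "(x0 * F - F * x0) * A = (x0 * C - C * x0) - F * (x0 * A - A * (x0 :: 'k yangian fps))"
    unfolding gauss_BCG by (simp add: algebra_simps)
  also have "\<dots> = A - D" using x0_t[of I2 I1] unfolding x0_A gauss_BCG(3) by (simp add: mult.assoc)
  finally show ?thesis .
qed

lemma x0_D: "x0 * D - D * x0 = D * (E :: 'k yangian fps)"
proof -
  have "x0 * D - D * x0 = (x0 * G - G * x0) - (x0 * F - F * x0) * A * E - F * (x0 * B - B * (x0 :: 'k yangian fps))"
    unfolding gauss_BCG by (simp add: algebra_simps)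
  also have "\<dots> = A * E - (A - D) * E" using x0_t[of I2 I2] x0_t[of I1 I2] by (simp add: x0_F_A gauss_BCG(1))
  finally show ?thesis by (simp add: algebra_simps)
qed

text \<open>Up to sign, commutators with \<open>x0\<close> produce d_1 e from d_1 and d_2 e from
  d_2. As d_1 and d_2 commute, the Jacobi identity trades [d_2(u), d_1(v) e(v)] for
  [d_2(u) e(u), d_1(v)], which \<open>comm_AE\<close> evaluates.\<close>

lemma comm_DE: "zw (inX D * inY E - inY E * inX D) (- (inX D * (inY E - inX E)))"
proof -
  let ?x = "inX x0"
  have xx: "?x = inY x0" unfolding x0_def by (rule inX_const)
  have "inY x0 * inY A - inY A * inY x0 = - (inY A * inY E)"
    by (metis x0_A inY_simps(2,3) inY_simps(5) diff_0)
  hence ae: "inY A * inY E = inY A * ?x - ?x * inY A" by (simp add: xx algebra_simps)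
  have de: "?x * inX D - inX D * ?x = inX D * inX E"
    by (metis x0_D inX_simps(2,3))
  have da: "inX D * inY A = inY A * inX D"
    using AD_commute
    by (auto simp: fps_eq_iff inXY_nth simp del: fps_mult_nth_0)
  note da2 = mult_left_swap[OF da]
  have "inY A * (inX D * inY E - inY E * inX D) = inX D * (inY A * inY E) - (inY A * inY E) * inX D"
    by (simp add: right_diff_distrib mult.assoc[symmetric] da)
  also have "\<dots> = (?x * inX D - inX D * ?x) * inY A - inY A * (?x * inX D - inX D * ?x)"
    unfolding ae by (simp add: algebra_simps da da2)
  also have "\<dots> = inX D * - (inY A * inX E - inX E * inY A)"
    unfolding de by (simp add: algebra_simps da da2)
  finally have "zw (inY A * (inX D * inY E - inY E * inX D)) (inX D * - (inY A * (inY E - inX E)))"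
    using zw_left[OF zw_minus[OF comm_AE(2)]] by simp
  also have "inX D * - (inY A * (inY E - inX E)) = inY A * - (inX D * (inY E - inX E))"
    by (simp only: mult_minus_right mult.assoc[symmetric] da)
  finally have "zw (inY A * (inX D * inY E - inY E * inX D)) (inY A * - (inX D * (inY E - inX E)))" .
  from zw_left[OF this, of "inY d1_inv"] show ?thesis
    by (simp only: mult.assoc[symmetric] inA_inv mult_1_left)
qed

end

section \<open>Shifted families of generators\<close>

context yang
begin

text \<open>Up to the factor u^k the tail of e(u) beyond degree k, so that e^(k+1) can play the part
  of the first coefficient of e.\<close>

definition ek :: "nat \<Rightarrow> 'k yangian fps" where
  "ek k = Abs_fps (\<lambda>n. if n = 0 then 0 else fps_nth e_series (k + n))"

definition xk :: "nat \<Rightarrow> 'k yangian fps" where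
  "xk k = fps_const (fps_nth e_series (Suc k))"

lemma ek_nth: "fps_nth (ek k) n = (if n = 0 then 0 else fps_nth e_series (k + n))"
  by (simp add: ek_def)

lemma ek_rec: "ek k = fps_X * (xk k + ek (Suc k))"
  by (rule fps_ext) (auto simp: ek_nth xk_def le_Suc_eq)

text \<open>
  The relations between \<open>q\<close> and \<open>e\<close> are invariant under the shift of the indices of \<open>e\<close> except for the
  boundary term, which has to be computed by recursion.
\<close>

lemma shift_family:
  fixes q :: "'k yangian fps" and rho :: "'k yangian"
  assumes q0: "fps_nth q 0 = 1" and rho: "rho = 1 \<or> rho = - 1"
    and rel: "zw (inX q * inY e_series - inY e_series * inX q)
                 (inX (fps_const rho * q) * (inY e_series - inX e_series))"
  shows "q * xk k - xk k * q = fps_const rho * q * ek k"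
    and "zw (inX q * inY (ek k) - inY (ek k) * inX q)
            (inX (fps_const rho * q) * (inY (ek k) - inX (ek k)))"
proof -
  let ?E = "fps_nth e_series :: nat \<Rightarrow> 'k yangian"
  have step: "fps_nth q (Suc r) * ?E s - ?E s * fps_nth q (Suc r)
      - (fps_nth q r * ?E (Suc s) - ?E (Suc s) * fps_nth q r) = rho * fps_nth q r * ?E s"
    if "s > 0" for r s
    using conjunct2[OF conjunct2[OF rel[unfolded zw_def YmX_eq_iff]], rule_format, of s r] that
    by (simp add: inXY_nth right_diff_distrib inX_simps(3)[symmetric] del: fps_mult_nth_0)
      (simp add: inX_def)
  have bd: "fps_nth q r * ?E (Suc k) - ?E (Suc k) * fps_nth q r = rho * fps_nth (q * ek k) r" for r k
  proof (induction r arbitrary: k)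
    case 0
    show ?case by (simp add: q0 ek_nth)
  next
    case (Suc r)
    have "q * ek k = fps_X * (q * xk k + q * ek (Suc k))"
      unfolding ek_rec[of k] by (simp only: mult.assoc[symmetric] X_central distrib_left)
    hence "fps_nth (q * ek k) (Suc r) = fps_nth q r * ?E (Suc k) + fps_nth (q * ek (Suc k)) r"
      by (simp add: xk_def)
    thus ?case using step[of "Suc k" r] Suc[of "Suc k"] by (simp add: algebra_simps)
  qed
  show "q * xk k - xk k * q = fps_const rho * q * ek k"
    by (rule fps_ext) (simp add: xk_def bd mult.assoc)
  show "zw (inX q * inY (ek k) - inY (ek k) * inX q)
            (inX (fps_const rho * q) * (inY (ek k) - inX (ek k)))"
    unfolding zw_def YmX_eq_iff
  proof (intro conjI allI)
    show "fps_nth (fps_nth (inX q * inY (ek k) - inY (ek k) * inX q) s) 0 = 0" for s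
      by (simp add: inXY_nth q0 del: fps_mult_nth_0)
    show "fps_nth (fps_nth (inX q * inY (ek k) - inY (ek k) * inX q) 0) r = 0" for r
      by (simp add: inXY_nth ek_nth del: fps_mult_nth_0)
    show "fps_nth (fps_nth (inX q * inY (ek k) - inY (ek k) * inX q) s) (Suc r) -
       fps_nth (fps_nth (inX q * inY (ek k) - inY (ek k) * inX q) (Suc s)) r =
       fps_nth (fps_nth (inX (fps_const rho * q) * (inY (ek k) - inX (ek k))) s) r" for r s
    proof (cases s)
      case 0
      thus ?thesis using bd[of r k]
        by (simp add: inXY_nth right_diff_distrib inX_simps(3)[symmetric] ek_nth del: fps_mult_nth_0)
          (simp add: inX_def inY_nth ek_nth mult.assoc algebra_simps)
    next
      case (Suc s')
      thus ?thesis using step[of "k + s" r]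
        by (simp add: inXY_nth right_diff_distrib inX_simps(3)[symmetric] ek_nth del: fps_mult_nth_0)
          (simp add: inX_def inY_nth ek_nth mult.assoc algebra_simps)
    qed
  qed
qed

lemma AD_nth_0: "fps_nth (t_series I1 I1) 0 = (1 :: 'k yangian)" "fps_nth (d_series I2) 0 = (1 :: 'k yangian)"
  using drinfeld_nth_0(1)[of I1] drinfeld_nth_0(1)[of I2] by (simp_all add: d_series.simps(1))

lemmas A_family = shift_family[of A 1, simplified, OF AD_nth_0(1) comm_AE(1)]

lemma inX_minus: "inX (- f) = - inX (f :: 'k yangian fps)"
  using inX_simps(2)[of 0 f] by (simp add: inX_simps)

lemma D_family:
  "D * xk k - xk k * D = - (D * ek k)"
  "zw (inX D * inY (ek k) - inY (ek k) * inX D) (- (inX D * (inY (ek k) - inX (ek k))))"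
proof -
  have m: "fps_const (- 1) * D = - D" by (rule fps_ext) simp
  have "zw (inX D * inY e_series - inY e_series * inX D)
    (inX (fps_const (- 1) * D) * (inY e_series - inX (e_series :: 'k yangian fps)))"
    using comm_DE unfolding m by (simp add: inX_minus)
  note * = shift_family[OF AD_nth_0(2) _ this, of k, unfolded m]
  show "D * xk k - xk k * D = - (D * ek k)" using *(1) by simp
  show "zw (inX D * inY (ek k) - inY (ek k) * inX D) (- (inX D * (inY (ek k) - inX (ek k))))"
    using *(2) by (simp add: inX_minus)
qed

lemma A_shift: "of_int (t - s) * (sh s A * sh t (ek k) - sh t (ek k) * sh s A)
    = sh s A * (sh t (ek k) - sh s (ek k))"
  using phi_YmX[OF A_family(2)[of k, unfolded zw_def], of t s] by (simp only: phi_simps)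

lemma D_shift: "of_int (t - s) * (sh s D * sh t (ek k) - sh t (ek k) * sh s D)
    = - (sh s D * (sh t (ek k) - sh s (ek k)))"
proof -
  have "zw (inX D * inY (ek k) - inY (ek k) * inX D) (inX D * (inX (ek k) - inY (ek k)))"
    using D_family(2)[of k] by (simp add: algebra_simps)
  from phi_YmX[OF this[unfolded zw_def], of t s] show ?thesis
    by (simp only: phi_simps) (simp add: algebra_simps)
qed

text \<open>For r = 1 the sum is a coefficient of e(u)^2. Passing from (r, s + 1) to (r + 1, s)
  removes the two outer summands.\<close>

lemma E_comm:
  assumes "1 \<le> r" "r \<le> s"
  shows "fps_nth E r * fps_nth E s - fps_nth E s * fps_nth E r = (\<Sum>i=r..<s. fps_nth E i * fps_nth E (r + s - 1 - i))"
proof -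
  let ?E = "fps_nth e_series :: nat \<Rightarrow> 'k yangian"
  have E0: "?E 0 = 0" by (rule drinfeld_nth_0)
  have rel: "?E (Suc r) * ?E s - ?E s * ?E (Suc r) - (?E r * ?E (Suc s) - ?E (Suc s) * ?E r) =
     (if s = 0 then fps_nth (E * E) r else 0) - ?E r * ?E s - ?E s * ?E r + (if r = 0 then fps_nth (E * E) s else 0)"
    for r s
    using conjunct2[OF conjunct2[OF comm_EE[unfolded zw_def YmX_eq_iff]], rule_format, of s r]
    by (cases s; cases r; simp add: inXY_nth algebra_simps inX_simps(3)[symmetric] inY_simps(3)[symmetric] del: fps_mult_nth_0)
      (simp_all add: inX_def inY_nth E0 algebra_simps)
  show ?thesis using assms
  proof (induction r arbitrary: s rule: nat_induct_at_least)
    case base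
    have "?E 1 * ?E s - ?E s * ?E 1 = (\<Sum>i=0..s. ?E i * ?E (s - i))"
      using rel[of s 0] E0 by (cases "s = 0") (simp_all add: fps_mult_nth algebra_simps)
    also have "\<dots> = (\<Sum>i=1..<s. ?E i * ?E (s - i))"
    proof (rule sum.mono_neutral_right)
      show "\<forall>i\<in>{0..s} - {1..<s}. ?E i * ?E (s - i) = 0"
      proof
        fix i assume "i \<in> {0..s} - {1..<s}"
        hence "i = 0 \<or> s - i = 0" by auto
        thus "?E i * ?E (s - i) = 0" using E0 by auto
      qed
    qed auto
    finally show ?case by simp
  next
    case (Suc r)
    have "?E (Suc r) * ?E s - ?E s * ?E (Suc r) =
       (?E r * ?E (Suc s) - ?E (Suc s) * ?E r) - ?E r * ?E s - ?E s * ?E r"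
      using rel[of r s] Suc by (simp add: algebra_simps)
    also have "?E r * ?E (Suc s) - ?E (Suc s) * ?E r = (\<Sum>i=r..<Suc s. ?E i * ?E (r + s - i))"
      using Suc.IH[of "Suc s"] Suc.prems by simp
    also have "\<dots> = ?E r * ?E s + (\<Sum>i=Suc r..<s. ?E i * ?E (r + s - i)) + ?E s * ?E r"
      using Suc.prems by (subst sum.atLeast_Suc_lessThan) (auto simp: sum.atLeast_Suc_lessThan)
    finally show ?case by simp
  qed
qed

lemma ek_sq_nth: "n > 0 \<Longrightarrow> fps_nth (ek k * ek k) n = (\<Sum>i=1..<n. fps_nth E (k + i) * fps_nth E (k + n - i))"
  unfolding fps_mult_nth
  by (rule sum.mono_neutral_cong_right) (auto simp: ek_nth not_less)

text \<open>A Riccati equation for the adjoint action of e^(k+1): its m-th iterate is m! times a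
  power of \<open>ek k\<close>, which vanishes at m = p.\<close>

lemma x_ek: "xk k * ek k - ek k * xk k = ek k * ek k"
proof (rule fps_ext)
  fix n
  show "fps_nth (xk k * ek k - ek k * xk k) n = fps_nth (ek k * ek k) n"
  proof (cases "n = 0")
    case False
    have "(\<Sum>i=Suc k..<k + n. fps_nth E i * fps_nth E (Suc k + (k + n) - 1 - i)) =
      (\<Sum>i=1..<n. fps_nth E (k + i) * fps_nth E (k + n - i))"
      by (rule sum.reindex_bij_witness[of _ "\<lambda>i. k + i" "\<lambda>i. i - k"]) (auto simp: ac_simps)
    thus ?thesis using E_comm[of "Suc k" "k + n"] False by (simp add: ek_sq_nth xk_def ek_nth)
  qed (simp add: ek_nth)
qed

lemma E_shift: "of_int (t - s) * (sh s (ek k) * sh t (ek k) - sh t (ek k) * sh s (ek k))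
    = (sh s (ek k) - sh t (ek k)) * (sh s (ek k) - sh t (ek k))"
proof -
  let ?E = "fps_nth e_series :: nat \<Rightarrow> 'k yangian"
  have x: "?E (Suc k) * fps_nth (ek k) n - fps_nth (ek k) n * ?E (Suc k) = fps_nth (ek k * ek k) n" for n
    using arg_cong[OF x_ek[of k], of "\<lambda>f. fps_nth f n"] by (simp add: xk_def)
  have rel: "?E (Suc r) * ?E s - ?E s * ?E (Suc r) - (?E r * ?E (Suc s) - ?E (Suc s) * ?E r) =
     - ?E r * ?E s - ?E s * ?E r" if "r > 0" "s > 0" for r s
    using conjunct2[OF conjunct2[OF comm_EE[unfolded zw_def YmX_eq_iff]], rule_format, of s r] that
    by (simp add: inXY_nth algebra_simps inX_simps(3)[symmetric] inY_simps(3)[symmetric] del: fps_mult_nth_0)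
      (simp add: inX_def inY_nth)
  have "zw (inX (ek k) * inY (ek k) - inY (ek k) * inX (ek k)) ((inX (ek k) - inY (ek k)) * (inX (ek k) - inY (ek k)))"
    unfolding zw_def YmX_eq_iff
  proof (intro conjI allI)
    show "fps_nth (fps_nth (inX (ek k) * inY (ek k) - inY (ek k) * inX (ek k)) s) 0 = 0" for s
      by (simp add: inXY_nth ek_nth del: fps_mult_nth_0)
    show "fps_nth (fps_nth (inX (ek k) * inY (ek k) - inY (ek k) * inX (ek k)) 0) r = 0" for r
      by (simp add: inXY_nth ek_nth del: fps_mult_nth_0)
    show "fps_nth (fps_nth (inX (ek k) * inY (ek k) - inY (ek k) * inX (ek k)) s) (Suc r) -
       fps_nth (fps_nth (inX (ek k) * inY (ek k) - inY (ek k) * inX (ek k)) (Suc s)) r =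
       fps_nth (fps_nth ((inX (ek k) - inY (ek k)) * (inX (ek k) - inY (ek k))) s) r" for r s
      using x[of r] x[of s] rel[of "k + r" "k + s"]
      by (cases s; cases r; simp add: inXY_nth algebra_simps inX_simps(3)[symmetric] inY_simps(3)[symmetric] ek_nth del: fps_mult_nth_0)
        (simp_all add: inX_def inY_nth algebra_simps ek_nth)
  qed
  from phi_YmX[OF this[unfolded zw_def], of t s] show ?thesis by (simp only: phi_simps)
qed

definition H :: "'k yangian fps" where "H = d1_inv * D"

lemma AD_comm1: "A * D = D * A"
proof (rule fps_ext)
  fix n
  have *: "fps_nth A r * fps_nth D s = fps_nth D s * fps_nth A r" for r s
    using arg_cong[OF AD_commute, of "\<lambda>f. fps_nth (fps_nth f s) r"]
    by (simp add: inXY_nth del: fps_mult_nth_0)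
  show "fps_nth (A * D) n = fps_nth (D * A) n"
    unfolding fps_mult_nth
    by (intro sum.reindex_bij_witness[of _ "\<lambda>t. n - t" "\<lambda>t. n - t"]) (auto simp: *)
qed

lemma inv_commute: "i * a = 1 \<Longrightarrow> a * i = 1 \<Longrightarrow> a * x = x * a \<Longrightarrow> i * x = x * (i :: 'a::ring_1)"
  by (metis mult.assoc mult_1_left mult_1_right)

text \<open>The right-hand side h(u) - h(v) contains no mixed monomial, so the commutator depends on
  r + s alone.\<close>

lemma E_F_comm:
  assumes "r \<ge> 1" "s \<ge> 1"
  shows "fps_nth E r * fps_nth F s - fps_nth F s * fps_nth E r = - fps_nth H (r + s - 1)"
proof -
  have hD: "d1_inv * D = D * d1_inv"
    by (rule inv_commute[OF A_inv(2,1) AD_comm1])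
  have inH: "inX H = inX d1_inv * inX D" "inY H = inY D * inY d1_inv"
    by (simp_all only: H_def inX_simps) (simp only: hD inY_simps)
  have c: "inX d1_inv * inY D = inY D * inX d1_inv" "inX d1_inv * inY A = inY A * inX d1_inv"
    by (rule inv_commute[OF inA_inv(2,1)] AD_commute tt_commute)+
  have c': "inY d1_inv * inX A = inX A * inY d1_inv"
    by (rule inv_commute[OF inA_inv(4,3) tt_commute[symmetric]])
  have "zw (inX d1_inv * (inX A * (inX E * inY F - inY F * inX E) * inY A) * inY d1_inv)
    (inX d1_inv * (inX D * inY A - inY D * inX A) * inY d1_inv)"
    by (intro zw_left zw_right comm_EF)
  also have "inX d1_inv * (inX A * (inX E * inY F - inY F * inX E) * inY A) * inY d1_inv
      = (inX d1_inv * inX A) * (inX E * inY F - inY F * inX E) * (inY A * inY d1_inv)"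
    by (simp only: mult.assoc)
  also have "\<dots> = inX E * inY F - inY F * inX E" by (simp only: inA_inv mult_1_left mult_1_right)
  also have "inX d1_inv * (inX D * inY A - inY D * inX A) * inY d1_inv
    = inX d1_inv * inX D * (inY A * inY d1_inv) - inY D * (inX d1_inv * inX A) * inY d1_inv"
    by (simp only: right_diff_distrib left_diff_distrib mult.assoc c(1)[THEN mult_left_swap])
  also have "\<dots> = inX H - inY H"
    by (simp only: inA_inv mult_1_right inH)
  finally have zwH: "zw (inX E * inY F - inY F * inX E) (inX H - inY H)" .
  have rel: "fps_nth E (Suc r) * fps_nth F s - fps_nth F s * fps_nth E (Suc r)
     - (fps_nth E r * fps_nth F (Suc s) - fps_nth F (Suc s) * fps_nth E r)
     = (if s = 0 then fps_nth H r else 0) - (if r = 0 then fps_nth H s else 0)" for r s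
    using conjunct2[OF conjunct2[OF zwH[unfolded zw_def YmX_eq_iff]], rule_format, of s r]
    by (simp add: inXY_nth del: fps_mult_nth_0) (simp add: inX_def inY_nth)
  show ?thesis using assms
  proof (induction r arbitrary: s rule: nat_induct_at_least)
    case base
    thus ?case using rel[of 0 s] by (simp add: drinfeld_nth_0)
  next
    case (Suc r)
    thus ?case using rel[of r s] Suc.IH[of "Suc s"] by (simp add: eq_neg_iff_add_eq_0)
  qed
qed

end

section \<open>Universal property and transposition\<close>

lemma free_induct [case_names zero single add]:
  fixes x :: "('g, 'k::comm_ring_1) free_algebra"
  assumes "P 0" "\<And>w a. P (Poly_Mapping.single w a)" "\<And>x y. P x \<Longrightarrow> P y \<Longrightarrow> P (x + y)"
  shows "P x"
proof (induction x rule: update_induct)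
  case const
  show ?case by (rule assms(1))
next
  case (update f a b)
  have "Poly_Mapping.update a b f = f + Poly_Mapping.single a b"
    by (rule poly_mapping_eqI)
      (use update.hyps in \<open>auto simp: lookup_update lookup_add lookup_single in_keys_iff when_def\<close>)
  thus ?case using assms update by metis
qed

fun letters :: "'g free_monoid \<Rightarrow> 'g list" where "letters (Word w) = w"

lemma letters_simps: "letters 0 = []" "letters (v + w) = letters v @ letters w"
  by (simp add: zero_free_monoid_def) (cases v; cases w; simp)

definition heval :: "('k \<Rightarrow> 'b) \<Rightarrow> ('g \<Rightarrow> 'b) \<Rightarrow> ('g, 'k::comm_ring_1) free_algebra \<Rightarrow> 'b::ring_1" where
  "heval c h x = (\<Sum>w\<in>Poly_Mapping.keys x. c (Poly_Mapping.lookup x w) * prod_list (map h (letters w)))"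

definition scalar_hom :: "('k::comm_ring_1 \<Rightarrow> 'b::ring_1) \<Rightarrow> bool" where
  "scalar_hom c \<longleftrightarrow> c 1 = 1 \<and> (\<forall>a b. c (a + b) = c a + c b) \<and> (\<forall>a b. c (a * b) = c a * c b)
     \<and> (\<forall>a y. c a * y = y * c a)"

lemma scalar_hom_simps:
  assumes "scalar_hom c"
  shows "c 1 = 1" "c 0 = 0" "c (a + b) = c a + c b" "c (a * b) = c a * c b" "y * c a = c a * y"
proof -
  show add: "c (a + b) = c a + c b" for a b using assms[unfolded scalar_hom_def] by blast
  show "c 0 = 0" using add[of 0 0] by simp
  show "c 1 = 1" "c (a * b) = c a * c b" using assms[unfolded scalar_hom_def] by blast+
  show "y * c a = c a * y" using assms[unfolded scalar_hom_def] by metis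
qed

context
  fixes c :: "'k::comm_ring_1 \<Rightarrow> 'b::ring_1" and h :: "'g \<Rightarrow> 'b"
  assumes c: "scalar_hom c"
begin

lemma heval_add: "heval c h (x + y) = heval c h x + heval c h y"
  unfolding heval_def
  by (rule setsum_keys_plus_distrib) (simp_all add: scalar_hom_simps(1-4)[OF c] distrib_right)

lemma heval_single: "heval c h (Poly_Mapping.single w a) = c a * prod_list (map h (letters w))"
  by (cases "a = 0") (simp_all add: heval_def scalar_hom_simps(1-4)[OF c])

lemma heval_0: "heval c h 0 = 0"
  by (simp add: heval_def)

lemma heval_mult: "heval c h (x * y) = heval c h x * heval c h y"
proof (induction x rule: free_induct)
  case (single w a)
  show ?case
  proof (induction y rule: free_induct)
    case (single v b)
    have "c a * c b * (P * Q) = c a * P * (c b * Q)" for P Q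
      using scalar_hom_simps(5)[OF c] by (metis mult.assoc)
    thus ?case by (simp add: mult_single heval_single letters_simps scalar_hom_simps(1-4)[OF c])
  qed (simp_all add: heval_0 heval_add distrib_left)
qed (simp_all add: heval_0 heval_add distrib_right)

lemma heval_minus: "heval c h (x - y) = heval c h x - heval c h y"
  using heval_add[of "x - y" y] by (simp add: eq_diff_eq)

lemma heval_sum: "heval c h (sum f S) = (\<Sum>s\<in>S. heval c h (f s))"
  by (induction S rule: infinite_finite_induct) (simp_all add: heval_0 heval_add)

lemma heval_gen: "heval c h (free_gen g) = h g" "heval c h (free_const a) = c a" "heval c h 1 = 1"
  using heval_single[of 0 1]
  by (simp_all add: free_gen_def free_const_def heval_single scalar_hom_simps(1-4)[OF c] letters_simps)

end

text \<open>By \<open>rtt_iff\<close> the evaluation of words annihilates the defining relations,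
  hence the ideal they generate.\<close>

lemma yangian_universal:
  fixes T :: "ix \<Rightarrow> ix \<Rightarrow> 'b::ring_1 fps" and c :: "'k::comm_ring_1 \<Rightarrow> 'b"
  assumes c: "scalar_hom c" and T: "rtt T"
    and T0: "\<And>i j. fps_nth (T i j) 0 = (if i = j then 1 else 0)"
  obtains h :: "'k yangian \<Rightarrow> 'b" where
    "\<And>x y. h (x + y) = h x + h y" "\<And>x y. h (x * y) = h x * h y" "h 1 = 1"
    "\<And>a. h (yangian_const a) = c a" "\<And>i j r. h (t_gen i j r) = fps_nth (T i j) r"
proof -
  define g where "g = (\<lambda>(i, j, r). fps_nth (T i j) (Suc r))"
  define e where "e = (heval c g :: 'k yangian_free \<Rightarrow> 'b)"
  note es = heval_add[OF c] heval_mult[OF c] heval_minus[OF c] heval_sum[OF c] heval_0[OF c] heval_gen[OF c]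
  have et: "e (t_free i j r) = fps_nth (T i j) r" for i j r
    by (cases r) (auto simp: e_def es g_def T0)
  have "e x = 0" if "x \<in> yangian_ideal" for x
  proof -
    let ?R = "ring_of_type_algebra :: 'k yangian_free ring"
    interpret ring ?R by (rule ring_ring_of_type_algebra)
    have "ideal {x. e x = 0} ?R"
    proof (rule idealI[OF ring_ring_of_type_algebra])
      show "subgroup {x. e x = 0} (add_monoid ?R)"
        by (rule add.subgroupI)
          (auto simp: e_def es a_inv_def[symmetric] heval_minus[OF c, of _ 0, simplified] intro!: exI[of _ 0])
    qed (simp_all add: e_def es)
    moreover have "yangian_rels \<subseteq> {x. e x = 0}"
    proof
      fix x :: "'k yangian_free"
      assume "x \<in> yangian_rels"
      then obtain i j k l r s where
        x: "x = t_free i j r * t_free k l s - t_free k l s * t_free i j r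
        - (\<Sum>t<min r s. t_free k j t * t_free i l (r + s - 1 - t)
                        - t_free k j (r + s - 1 - t) * t_free i l t)"
        unfolding yangian_rels_def by blast
      have "e x = 0"
        unfolding x using T[unfolded rtt_iff[of T, OF T0], rule_format, of i j r k l s] et
        by (simp add: e_def es)
      thus "x \<in> {x. e x = 0}" by simp
    qed
    ultimately have "yangian_ideal \<subseteq> {x. e x = 0}"
      unfolding yangian_ideal_def by (rule genideal_minimal)
    thus ?thesis using that by blast
  qed
  hence eq: "e x = e y" if "yangian_eq x y" for x y
    using \<open>\<And>x. x \<in> yangian_ideal \<Longrightarrow> e x = 0\<close>[of "x - y"] that
    unfolding yangian_eq_def by (simp add: e_def es(3))
  define h where "h y = e (yangian_rep y)" for y
  have habs: "h (yangian_abs x) = e x" for x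
    unfolding h_def by (rule eq) (metis Quotient3_yangian Quotient3_rep_abs yangian.abs_eq_iff Quotient3_abs_rep)
  have "\<exists>x. y = yangian_abs x" for y :: "'k yangian"
    by (metis Quotient3_yangian Quotient3_abs_rep)
  hence "h (x + y) = h x + h y" "h (x * y) = h x * h y" for x y
    using habs yangian_abs_hom(1,3) by (metis e_def es(1,2))+
  moreover have "h 1 = 1" "h (yangian_const a) = c a" "h (t_gen i j r) = fps_nth (T i j) r" for a i j r
    using et by (simp_all add: one_yangian.abs_eq yangian_const.abs_eq t_gen.abs_eq habs)
      (simp_all add: e_def es)
  ultimately show ?thesis by (rule that)
qed

lemma yangian_induct [case_names const gen add mult]:
  fixes y :: "'k::comm_ring_1 yangian"
  assumes const: "\<And>a. P (yangian_const a)" and gen: "\<And>i j r. P (t_gen i j r)"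
    and add: "\<And>x y. P x \<Longrightarrow> P y \<Longrightarrow> P (x + y)" and mult: "\<And>x y. P x \<Longrightarrow> P y \<Longrightarrow> P (x * y)"
  shows "P y"
proof -
  have "P (yangian_abs x)" for x :: "'k yangian_free"
  proof (induction x rule: free_induct)
    case zero
    have "free_const 0 = (0 :: 'k yangian_free)" by (simp add: free_const_def)
    thus ?case using const[of 0] by (simp add: yangian_const.abs_eq)
  next
    case (single w a)
    obtain l where w: "w = Word l" by (cases w)
    show ?case unfolding w
    proof (induction l arbitrary: a)
      case Nil
      thus ?case using const[of a] by (simp add: yangian_const.abs_eq free_const_def zero_free_monoid_def)
    next
      case (Cons g l)
      obtain i j r where g: "g = (i, j, r)" by (cases g)
      have "Poly_Mapping.single (Word (g # l)) a = t_free i j (Suc r) * Poly_Mapping.single (Word l) a"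
        by (simp add: free_gen_def mult_single g)
      thus ?case using Cons[of a] gen[of i j "Suc r"] mult
        by (simp only: yangian_abs_hom t_gen.abs_eq)
    qed
  next
    case (add x y)
    thus ?case by (simp add: yangian_abs_hom assms(3))
  qed
  thus ?thesis by (metis Quotient3_yangian Quotient3_abs_rep)
qed

lemma yangian_const_hom: "scalar_hom (yangian_const :: 'k::comm_ring_1 \<Rightarrow> 'k yangian)"
proof -
  have c: "free_const a * x = x * free_const a" for a and x :: "'k yangian_free"
  proof (induction x rule: free_induct)
    case (single w b)
    thus ?case by (simp add: free_const_def mult_single mult.commute)
  qed (simp_all add: distrib_left distrib_right)
  show ?thesis unfolding scalar_hom_def
  proof (intro conjI allI)
    show "yangian_const 1 = (1 :: 'k yangian)"
      by transfer (simp add: free_const_1 yangian_eq_def yangian_ideal_0)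
    fix a b :: 'k and y :: "'k yangian"
    show "yangian_const (a + b) = (yangian_const a + yangian_const b :: 'k yangian)"
      by transfer (simp add: free_const_add yangian_eq_def yangian_ideal_0)
    show "yangian_const (a * b) = (yangian_const a * yangian_const b :: 'k yangian)"
      by transfer (simp add: free_const_mult yangian_eq_def yangian_ideal_0)
    show "yangian_const a * y = y * yangian_const a"
      by transfer (simp add: c yangian_eq_def yangian_ideal_0)
  qed
qed

lemmas yconst = scalar_hom_simps[OF yangian_const_hom]

lemma yangian_const_uminus: "yangian_const (- a) = - yangian_const a"
  using yconst(3)[of a "- a"] by (simp add: yconst(2) eq_neg_iff_add_eq_0 add.commute)

lemma yangian_const_minus: "yangian_const (a - b) = yangian_const a - yangian_const b"
  using yconst(3)[of a "- b"] by (simp add: yangian_const_uminus)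

lemma yangian_const_of_nat: "yangian_const (of_nat n) = of_nat n"
  by (induction n) (simp_all add: yconst(1-4))

section \<open>Transposition as an anti-automorphism\<close>

typedef 'a opp = "UNIV :: 'a set" morphisms unop Opp ..

setup_lifting type_definition_opp

instantiation opp :: (ring_1) ring_1
begin
lift_definition zero_opp :: "'a opp" is 0 .
lift_definition one_opp :: "'a opp" is 1 .
lift_definition plus_opp :: "'a opp \<Rightarrow> 'a opp \<Rightarrow> 'a opp" is "(+)" .
lift_definition minus_opp :: "'a opp \<Rightarrow> 'a opp \<Rightarrow> 'a opp" is "(-)" .
lift_definition uminus_opp :: "'a opp \<Rightarrow> 'a opp" is uminus .
lift_definition times_opp :: "'a opp \<Rightarrow> 'a opp \<Rightarrow> 'a opp" is "\<lambda>x y. y * x" .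
instance by standard (transfer; simp add: algebra_simps)+
end

lemma add_exchange:
  fixes x y p q a b :: "'a::ab_group_add"
  assumes "x - y = p - q" "p - a = q - b"
  shows "x - y = a - b"
proof -
  have "a - b = p - q" using assms(2) by (simp add: algebra_simps)
  thus ?thesis using assms(1) by simp
qed

text \<open>In the opposite ring the right-hand side appears with both products reversed. The
  discrepancy is a difference of two commutators, which vanishes because [t_ij(u), t_kl(v)] is
  symmetric in u and v.\<close>

lemma rtt_transpose:
  fixes T :: "ix \<Rightarrow> ix \<Rightarrow> 'a::ring_1 fps"
  assumes "rtt T"
  shows "rtt (\<lambda>i j. Abs_fps (\<lambda>r. Opp (fps_nth (T j i) r)))"
proof -
  have sym: "fps_nth (T i j) r * fps_nth (T k l) s - fps_nth (T k l) s * fps_nth (T i j) r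
      = fps_nth (T i j) s * fps_nth (T k l) r - fps_nth (T k l) r * fps_nth (T i j) s" for i j k l r s
  proof -
    have "(inX (T i j) * inY (T k l) - inY (T k l) * inX (T i j))
        - (inY (T i j) * inX (T k l) - inX (T k l) * inY (T i j)) = 0"
      by (rule zw_0) (use zw_diff[OF rtt_zw[OF assms, of i j k l]] in simp)
    from arg_cong[OF this, of "\<lambda>f. fps_nth (fps_nth f s) r"]
    show ?thesis by (simp add: inXY_nth del: fps_mult_nth_0)
  qed
  have op: "Opp x * Opp y = Opp (y * x)" "Opp x - Opp y = Opp (x - y)" "Opp 0 = 0"
    "Opp x = Opp y \<longleftrightarrow> x = y" for x y :: 'a
    by (simp_all add: times_opp.abs_eq eq_onp_same_args minus_opp.abs_eq zero_opp_def Opp_inject)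
  show ?thesis unfolding rtt_def YmX_eq_iff
  proof (intro allI conjI)
    fix i j k l r s
    from rtt_swap[OF assms, of l k j i, unfolded YmX_eq_iff]
    have *: "fps_nth (T l k) s * fps_nth (T j i) 0 - fps_nth (T j i) 0 * fps_nth (T l k) s = 0"
      "fps_nth (T l k) 0 * fps_nth (T j i) r - fps_nth (T j i) r * fps_nth (T l k) 0 = 0"
      "fps_nth (T l k) s * fps_nth (T j i) (Suc r) - fps_nth (T j i) (Suc r) * fps_nth (T l k) s
       - (fps_nth (T l k) (Suc s) * fps_nth (T j i) r - fps_nth (T j i) r * fps_nth (T l k) (Suc s))
       = fps_nth (T j k) r * fps_nth (T l i) s - fps_nth (T j k) s * fps_nth (T l i) r" for r s
      by (simp_all add: inXY_nth del: fps_mult_nth_0)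
    let ?T = "\<lambda>i j. Abs_fps (\<lambda>r. Opp (fps_nth (T j i) r))"
    show "fps_nth (fps_nth (inX (?T i j) * inY (?T k l) - inY (?T k l) * inX (?T i j)) s) 0 = 0"
      "fps_nth (fps_nth (inX (?T i j) * inY (?T k l) - inY (?T k l) * inX (?T i j)) 0) r = 0"
      using * by (simp_all add: inXY_nth op flip: op(3) del: fps_mult_nth_0)
    show "fps_nth (fps_nth (inX (?T i j) * inY (?T k l) - inY (?T k l) * inX (?T i j)) s) (Suc r) -
       fps_nth (fps_nth (inX (?T i j) * inY (?T k l) - inY (?T k l) * inX (?T i j)) (Suc s)) r =
       fps_nth (fps_nth (inX (?T k j) * inY (?T i l) - inY (?T k j) * inX (?T i l)) s) r"
      using add_exchange[OF *(3)[of s r] sym[of j k r l i s]]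
      by (simp add: inXY_nth op del: fps_mult_nth_0)
  qed
qed

text \<open>The universal property applies to the opposite ring, where an anti-homomorphism becomes
  a homomorphism.\<close>

lemma ex_transpose:
  "\<exists>h :: 'k::comm_ring_1 yangian \<Rightarrow> 'k yangian. (\<forall>x y. h (x + y) = h x + h y) \<and>
    (\<forall>x y. h (x * y) = h y * h x) \<and> h 1 = 1 \<and> (\<forall>a. h (yangian_const a) = yangian_const a) \<and>
    (\<forall>i j r. h (t_gen i j r) = t_gen j i r)"
proof -
  let ?T = "\<lambda>i j. Abs_fps (\<lambda>r. Opp (fps_nth (t_series j i :: 'k yangian fps) r))"
  have op: "Opp x * Opp y = Opp (y * x)" "Opp x + Opp y = Opp (x + y)" "Opp 1 = 1" "Opp 0 = 0"
     for x y :: "'k yangian"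
    by (simp_all add: times_opp.abs_eq eq_onp_same_args plus_opp.abs_eq one_opp_def zero_opp_def)
  have c: "scalar_hom (\<lambda>a. Opp (yangian_const a :: 'k yangian))"
    unfolding scalar_hom_def
  proof (intro conjI allI)
    fix a :: 'k and y :: "'k yangian opp"
    show "Opp (yangian_const a) * y = y * Opp (yangian_const a)"
      by (cases y) (simp add: op yconst(5))
  next
    fix a b :: 'k
    show "Opp (yangian_const (a * b) :: 'k yangian) = Opp (yangian_const a) * Opp (yangian_const b)"
      unfolding op yconst(4)[symmetric] by (simp only: mult.commute)
  qed (simp_all add: op yconst(1-4))
  have T0: "fps_nth (?T i j) 0 = (if i = j then 1 else 0)" for i j
    by (simp add: t_series_def t_gen_0 op)
  obtain h :: "'k yangian \<Rightarrow> 'k yangian opp" where h: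
    "\<And>x y. h (x + y) = h x + h y" "\<And>x y. h (x * y) = h x * h y" "h 1 = 1"
    "\<And>a. h (yangian_const a) = Opp (yangian_const a)" "\<And>i j r. h (t_gen i j r) = fps_nth (?T i j) r"
    by (rule yangian_universal[OF c rtt_transpose[OF yang.rtt_t_series] T0]) (rule that)
  show ?thesis
    by (rule exI[of _ "\<lambda>x. unop (h x)"])
      (simp add: h plus_opp.rep_eq times_opp.rep_eq one_opp.rep_eq Opp_inverse t_series_def)
qed

text \<open>The transposition exchanges e and f and fixes d_1 and d_2, so statements about e yield
  statements about f.\<close>

definition tau :: "'k::comm_ring_1 yangian \<Rightarrow> 'k yangian" where
  "tau = (SOME h. (\<forall>x y. h (x + y) = h x + h y) \<and>
    (\<forall>x y. h (x * y) = h y * h x) \<and> h 1 = 1 \<and> (\<forall>a. h (yangian_const a) = yangian_const a) \<and>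
    (\<forall>i j r. h (t_gen i j r) = t_gen j i r))"

lemma tau_simps:
  fixes x y :: "'k::comm_ring_1 yangian"
  shows "tau (x + y) = tau x + tau y" "tau (x * y) = tau y * tau x" "tau 1 = (1 :: 'k yangian)"
  "tau (yangian_const a) = (yangian_const a :: 'k yangian)"
  "tau (t_gen i j r) = (t_gen j i r :: 'k yangian)"
  using someI_ex[OF ex_transpose[where ?'k = 'k], folded tau_def] by auto

lemma tau_0: "tau 0 = 0"
  using tau_simps(4)[of 0] by (simp add: yconst(1-4))

lemma tau_minus: "tau (x - y) = tau x - tau y"
  using tau_simps(1)[of "x - y" y] by simp

lemma tau_sum: "tau (sum f S) = (\<Sum>s\<in>S. tau (f s))"
  by (induction S rule: infinite_finite_induct) (simp_all add: tau_0 tau_simps)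

lemma tau_tau: "tau (tau y) = y"
  by (induction y rule: yangian_induct) (simp_all add: tau_simps)

lemma tau_power: "tau (y ^ n) = tau y ^ n"
  by (induction n) (simp_all add: tau_simps power_commutes)

definition ftr :: "'k::comm_ring_1 yangian fps \<Rightarrow> 'k yangian fps" where
  "ftr f = Abs_fps (\<lambda>n. tau (fps_nth f n))"

lemma ftr_nth: "fps_nth (ftr f) n = tau (fps_nth f n)"
  by (simp add: ftr_def)

lemma ftr_mult: "ftr (f * g) = ftr g * ftr f"
proof (rule fps_ext)
  show "fps_nth (ftr (f * g)) n = fps_nth (ftr g * ftr f) n" for n
    unfolding fps_mult_nth ftr_nth tau_sum tau_simps
    by (rule sum.reindex_bij_witness[of _ "\<lambda>t. n - t" "\<lambda>t. n - t"]) auto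
qed

lemma ftr_minus: "ftr (f - g) = ftr f - ftr g"
  by (rule fps_ext) (simp add: ftr_nth tau_minus)

lemma ftr_1: "ftr 1 = 1"
  by (rule fps_ext) (simp add: ftr_nth tau_simps tau_0)

lemma tau_of_int: "tau (of_int n) = of_int n"
proof -
  have "yangian_const (of_int n) = (of_int n :: 'a yangian)"
    by (cases n) (simp_all add: yangian_const_of_nat yangian_const_uminus yangian_const_minus yconst(1-4))
  thus ?thesis by (metis tau_simps(4))
qed

lemma xi_pow_nth: "\<exists>m. fps_nth (xi s ^ i) n = (of_int m :: 'a::ring_1)"
proof (induction i arbitrary: n)
  case 0
  show ?case by (cases n) (auto intro: exI[of _ 0] exI[of _ 1])
next
  case (Suc i)
  have "\<exists>m. fps_nth (xi s) n = (of_int m :: 'a)" for n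
    by (cases n) (auto simp: xi_def geom_def intro: exI[of _ 0] exI[of _ "s ^ _"])
  then obtain f where f: "\<And>n. fps_nth (xi s) n = (of_int (f n) :: 'a)" by metis
  obtain g where g: "\<And>n. fps_nth (xi s ^ i) n = (of_int (g n) :: 'a)" using Suc by metis
  have "fps_nth (xi s ^ Suc i) n = (of_int (\<Sum>t=0..n. f t * g (n - t)) :: 'a)"
    by (simp add: fps_mult_nth f g)
  thus ?case ..
qed

text \<open>The coefficients of the powers of \<open>xi s\<close> are integers, hence central and
  fixed by \<open>tau\<close>.\<close>

lemma ftr_sh: "ftr (sh s f) = sh s (ftr f)"
proof (rule fps_ext)
  fix n
  show "fps_nth (ftr (sh s f)) n = fps_nth (sh s (ftr f)) n"
    unfolding sh_def ftr_nth fps_compose_nth tau_sum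
  proof (rule sum.cong[OF refl])
    fix i
    obtain m where m: "fps_nth (xi s ^ i) n = (of_int m :: 'a yangian)" using xi_pow_nth by blast
    show "tau (fps_nth f i * fps_nth (xi s ^ i) n) = tau (fps_nth f i) * fps_nth (xi s ^ i) n"
      by (simp add: m tau_simps tau_of_int of_int_central)
  qed
qed

context yang
begin

lemma ftr_t: "ftr (t_series i j) = t_series j i"
  by (rule fps_ext) (simp add: ftr_nth t_series_def tau_simps)

lemma ftr_d1_inv: "ftr d1_inv = (d1_inv :: 'k yangian fps)"
proof -
  have "A * ftr d1_inv = ftr (d1_inv * A)" by (simp only: ftr_mult ftr_t)
  also have "\<dots> = A * d1_inv" by (simp only: A_inv ftr_1)
  finally show ?thesis by (rule cancel_left[OF A_inv(2)])
qed

lemma ftr_E: "ftr E = F" and ftr_F: "ftr F = E"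
  by (simp_all add: e_series_def f_series_def ftr_mult ftr_t ftr_d1_inv)

lemma ftr_D: "ftr D = D"
  by (simp only: d_series.simps ftr_minus ftr_mult ftr_t ftr_E ftr_F mult.assoc)

end

section \<open>Iterated commutators\<close>

primrec adn :: "'a::ring_1 \<Rightarrow> nat \<Rightarrow> 'a \<Rightarrow> 'a" where
  "adn x 0 y = y"
| "adn x (Suc n) y = x * adn x n y - adn x n y * x"

lemma adn_shift: "adn x n (x * y - y * x) = adn x (Suc n) y"
  by (induction n) simp_all

lemma adn_minus: "adn x n (- y) = - adn x n y"
  by (induction n) simp_all

lemma adn_vanish: "adn x m y = 0 \<Longrightarrow> m \<le> n \<Longrightarrow> adn x n y = 0"
  by (induction n) (auto simp: le_Suc_eq)

lemma adn_const_nth: "fps_nth (adn (fps_const x) n f) m = adn x n (fps_nth f m)"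
  by (induction n) simp_all

lemma of_nat_central: "f * of_nat n = of_nat n * (f :: 'a::ring_1)"
  by (metis mult_of_nat_commute)

lemma power_mult_adn:
  "x ^ m * y = (\<Sum>j\<le>m. of_nat (m choose j) * (adn x j y * x ^ (m - j)))"
proof (induction m)
  case (Suc m)
  let ?t = "\<lambda>j. adn x j y * x ^ (Suc m - j)"
  have "x ^ Suc m * y = (\<Sum>j\<le>m. x * (of_nat (m choose j) * (adn x j y * x ^ (m - j))))"
    by (simp only: power_Suc mult.assoc Suc.IH sum_distrib_left)
  also have "\<dots> = (\<Sum>j\<le>m. of_nat (m choose j) * ?t (Suc j) + of_nat (m choose j) * ?t j)"
  proof (rule sum.cong[OF refl])
    fix j assume "j \<in> {..m}"
    hence "x ^ (Suc m - j) = x * x ^ (m - j)" by (simp add: Suc_diff_le)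
    thus "x * (of_nat (m choose j) * (adn x j y * x ^ (m - j)))
        = of_nat (m choose j) * ?t (Suc j) + of_nat (m choose j) * ?t j"
      by (simp only: mult.assoc[symmetric] of_nat_central[of x] diff_Suc_Suc)
        (simp add: algebra_simps)
  qed
  also have "\<dots> = (\<Sum>j\<le>m. of_nat (m choose j) * ?t (Suc j)) + (\<Sum>j\<le>Suc m. of_nat (m choose j) * ?t j)"
    by (simp add: sum.distrib binomial_eq_0)
  also have "\<dots> = (\<Sum>j\<le>Suc m. of_nat (Suc m choose j) * ?t j)"
    unfolding sum.atMost_Suc_shift[of _ m] by (simp add: sum.distrib[symmetric] algebra_simps)
  finally show ?case .
qed simp

text \<open>The intermediate binomial coefficients vanish modulo p, so ad(x^p) = ad(x)^p, and
  centrality of a p-th power becomes the vanishing of p-fold commutators.\<close>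

lemma power_prime_commute:
  fixes x y :: "'a::ring_1"
  assumes p: "normalization_semidom_class.prime p" "of_nat p = (0 :: 'a)"
  shows "x ^ p * y = adn x p y + y * x ^ p"
proof -
  have z: "of_nat (p choose j) = (0 :: 'a)" if "0 < j" "j < p" for j
  proof -
    have "p dvd p choose j" using p that by (intro dvd_choose_prime) auto
    thus ?thesis by (elim dvdE) (simp add: p)
  qed
  have "x ^ p * y = (\<Sum>j\<le>p. of_nat (p choose j) * (adn x j y * x ^ (p - j)))"
    by (rule power_mult_adn)
  also have "\<dots> = (\<Sum>j\<in>{0, p}. of_nat (p choose j) * (adn x j y * x ^ (p - j)))"
    by (rule sum.mono_neutral_right) (auto simp: z)
  also have "\<dots> = adn x p y + y * x ^ p"
    using p(1) by (auto simp: add.commute dest: prime_gt_0_nat)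
  finally show ?thesis .
qed

text \<open>Agreement below degree N only: the coefficients of e with small index, read backwards,
  form a finite segment and satisfy their differential equation just up to its end.\<close>

definition eq_upto :: "nat \<Rightarrow> 'a fps \<Rightarrow> 'a::ring_1 fps \<Rightarrow> bool" where
  "eq_upto N f g \<longleftrightarrow> (\<forall>l<N. fps_nth f l = fps_nth g l)"

lemma eq_upto_intros:
  "eq_upto N f f" "eq_upto N f g \<Longrightarrow> eq_upto N g h \<Longrightarrow> eq_upto N f h"
  "eq_upto N f g \<Longrightarrow> eq_upto N f' g' \<Longrightarrow> eq_upto N (f + f') (g + g')"
  "eq_upto N f g \<Longrightarrow> eq_upto N f' g' \<Longrightarrow> eq_upto N (f - f') (g - g')"
  "eq_upto N f g \<Longrightarrow> eq_upto N f' g' \<Longrightarrow> eq_upto N (f * f') (g * g')"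
  by (auto simp: eq_upto_def fps_mult_nth)

text \<open>The commutator with x acts on powers of y like the derivation s y^2 d/dy.\<close>

lemma ad_riccati:
  fixes x y :: "'a::ring_1 fps"
  assumes "eq_upto N (x * y - y * x) (of_int s * (y * y))"
  shows "eq_upto N (adn x m y) (of_int (fact m * s ^ m) * y ^ Suc m)"
proof -
  have pow: "eq_upto N (x * y ^ n - y ^ n * x) (of_int (int n * s) * y ^ Suc n)" for n
  proof (induction n)
    case (Suc n)
    have "eq_upto N ((x * y - y * x) * y ^ n + y * (x * y ^ n - y ^ n * x))
      (of_int s * (y * y) * y ^ n + y * (of_int (int n * s) * y ^ Suc n))"
      by (intro eq_upto_intros(1,3,5) assms Suc)
    also have "(x * y - y * x) * y ^ n + y * (x * y ^ n - y ^ n * x) = x * y ^ Suc n - y ^ Suc n * x"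
      by (simp add: algebra_simps)
    also have "of_int s * (y * y) * y ^ n + y * (of_int (int n * s) * y ^ Suc n)
        = of_int (int (Suc n) * s) * y ^ Suc (Suc n)"
      by (simp only: mult.assoc[symmetric] of_int_central[of y]) (simp add: algebra_simps)
    finally show ?case .
  qed (simp add: eq_upto_def)
  show ?thesis
  proof (induction m)
    case (Suc m)
    let ?c = "of_int (fact m * s ^ m) :: 'a fps"
    have "eq_upto N (adn x (Suc m) y) (x * (?c * y ^ Suc m) - ?c * y ^ Suc m * x)"
      unfolding adn.simps by (intro eq_upto_intros(1,4,5) Suc)
    also have "x * (?c * y ^ Suc m) - ?c * y ^ Suc m * x = ?c * (x * y ^ Suc m - y ^ Suc m * x)"
      by (simp only: right_diff_distrib mult.assoc[symmetric] of_int_central[of x])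
    finally have "eq_upto N (adn x (Suc m) y) (?c * (of_int (int (Suc m) * s) * y ^ Suc (Suc m)))"
      by (rule eq_upto_intros(2)) (intro eq_upto_intros(1,5) pow)
    also have "?c * (of_int (int (Suc m) * s) * y ^ Suc (Suc m)) = of_int (fact (Suc m) * s ^ Suc m) * y ^ Suc (Suc m)"
      by (simp only: mult.assoc[symmetric] of_int_mult[symmetric]) (simp add: algebra_simps)
    finally show ?case .
  qed (simp add: eq_upto_def)
qed

text \<open>A term e^i h e^(m+1-i) arises from two terms of the previous level, with multiplicities
  i and m + 1 - i. Their sum m + 1 does not depend on i, and this builds up the factorial.\<close>

lemma ad_two_sided:
  fixes x e h :: "'a::ring_1"
  assumes xe: "x * e - e * x = e * e" and xh: "x * h - h * x = e * h + h * e"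
  shows "adn x m h = of_nat (fact m) * (\<Sum>i\<le>m. e ^ i * h * e ^ (m - i))"
proof -
  have pow: "x * e ^ n - e ^ n * x = of_nat n * e ^ Suc n" for n
  proof (induction n)
    case (Suc n)
    have "x * e ^ Suc n - e ^ Suc n * x = (x * e - e * x) * e ^ n + e * (x * e ^ n - e ^ n * x)"
      by (simp add: algebra_simps)
    also have "\<dots> = of_nat (Suc n) * e ^ Suc (Suc n)"
      unfolding xe Suc by (simp only: mult.assoc[symmetric] of_nat_central[of e]) (simp add: algebra_simps)
    finally show ?case .
  qed simp
  let ?T = "\<lambda>m i. e ^ i * h * e ^ (m - i)"
  have step: "x * ?T m i - ?T m i * x = of_nat (Suc i) * ?T (Suc m) (Suc i) + of_nat (Suc m - i) * ?T (Suc m) i"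
    if "i \<le> m" for i m
  proof -
    have s: "Suc m - i = Suc (m - i)" using that by simp
    have "x * ?T m i - ?T m i * x = (x * e ^ i - e ^ i * x) * h * e ^ (m - i)
        + e ^ i * (x * h - h * x) * e ^ (m - i) + e ^ i * h * (x * e ^ (m - i) - e ^ (m - i) * x)"
      by (simp add: algebra_simps)
    also have "\<dots> = of_nat i * (e ^ Suc i * h * e ^ (m - i)) + (e ^ i * e * h * e ^ (m - i) + e ^ i * h * (e * e ^ (m - i)))
        + of_nat (m - i) * (e ^ i * h * e ^ Suc (m - i))"
      unfolding pow xh by (simp only: mult.assoc[symmetric] of_nat_central[of "e ^ i * h"] distrib_left distrib_right)
    also have "\<dots> = of_nat (Suc i) * ?T (Suc m) (Suc i) + of_nat (Suc m - i) * ?T (Suc m) i"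
      unfolding s diff_Suc_Suc power_Suc2[of e i, symmetric] power_Suc[of e "m - i", symmetric]
      by (simp only: of_nat_Suc distrib_right mult_1_left add_ac)
    finally show ?thesis .
  qed
  show ?thesis
  proof (induction m)
    case (Suc m)
    have "adn x (Suc m) h = of_nat (fact m) * (\<Sum>i\<le>m. x * ?T m i - ?T m i * x)"
      unfolding adn.simps Suc sum_subtractf right_diff_distrib sum_distrib_left sum_distrib_right
      by (simp only: mult.assoc[symmetric] of_nat_central[of x])
    also have "(\<Sum>i\<le>m. x * ?T m i - ?T m i * x)
        = (\<Sum>i\<le>m. of_nat (Suc i) * ?T (Suc m) (Suc i)) + (\<Sum>i\<le>m. of_nat (Suc m - i) * ?T (Suc m) i)"
      unfolding sum.distrib[symmetric] by (rule sum.cong[OF refl], rule step) simp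
    also have "(\<Sum>i\<le>m. of_nat (Suc i) * ?T (Suc m) (Suc i)) = (\<Sum>i\<le>Suc m. of_nat i * ?T (Suc m) i)"
      by (subst sum.atMost_Suc_shift) simp
    also have "(\<Sum>i\<le>m. of_nat (Suc m - i) * ?T (Suc m) i) = (\<Sum>i\<le>Suc m. of_nat (Suc m - i) * ?T (Suc m) i)"
      by simp
    also have "(\<Sum>i\<le>Suc m. of_nat i * ?T (Suc m) i) + (\<Sum>i\<le>Suc m. of_nat (Suc m - i) * ?T (Suc m) i)
        = (\<Sum>i\<le>Suc m. of_nat (Suc m) * ?T (Suc m) i)"
      unfolding sum.distrib[symmetric]
      by (rule sum.cong[OF refl]) (simp only: distrib_right[symmetric] of_nat_add[symmetric] atMost_iff le_add_diff_inverse)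
    also have "of_nat (fact m) * \<dots> = of_nat (fact (Suc m)) * (\<Sum>i\<le>Suc m. ?T (Suc m) i)"
      unfolding sum_distrib_left[symmetric] mult.assoc[of "of_nat (fact m)", symmetric] of_nat_mult[symmetric]
      by (simp only: fact_Suc mult.commute of_nat_id)
    finally show ?case .
  qed simp
qed

text \<open>
  The relation says that \<open>\<gamma>\<close> and \<open>M\<close> generate a Jordan plane; in its realization \<open>\<gamma> = x\<close>,
  \<open>M = - x\<^sup>2 d/dx + x\<close> the identity is a telescoping sum of partial fractions.
\<close>

lemma jordan_plane_sum:
  fixes g M :: "'a::ring_1"
  assumes gM: "g * M - M * g = g * g"
  shows "(\<Sum>i\<le>m. (M - g) ^ i * (M + g) ^ (m - i)) = of_nat (Suc m) * M ^ m"
proof -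
  have Mg: "M * g = g * M - g * g" using gM by (simp add: algebra_simps)
  have pw: "(M + g) ^ Suc m = M ^ Suc m + of_nat (Suc m) * (g * M ^ m)" for m
  proof (induction m)
    case (Suc m)
    have c: "M * (of_nat n * y) = of_nat n * (M * y)" "g * (of_nat n * y) = of_nat n * (g * y)" for n y
      by (metis mult.assoc of_nat_central)+
    have "(M + g) ^ Suc (Suc m) = (M + g) * (M ^ Suc m + of_nat (Suc m) * (g * M ^ m))"
      by (simp only: power_Suc[of "M + g" "Suc m"] Suc)
    also have "\<dots> = M ^ Suc (Suc m) + g * M ^ Suc m + of_nat (Suc m) * (M * g * M ^ m) + of_nat (Suc m) * (g * g * M ^ m)"
      by (simp add: distrib_left distrib_right c mult.assoc del: of_nat_Suc)
    also have "\<dots> = M ^ Suc (Suc m) + g * M ^ Suc m + of_nat (Suc m) * (g * M ^ Suc m)"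
      unfolding Mg by (simp add: left_diff_distrib right_diff_distrib mult.assoc del: of_nat_Suc)
    also have "\<dots> = M ^ Suc (Suc m) + of_nat (Suc (Suc m)) * (g * M ^ Suc m)"
      by (simp add: algebra_simps)
    finally show ?case .
  qed simp
  show ?thesis
  proof (induction m)
    case (Suc m)
    have c: "(M - g) * (of_nat n * y) = of_nat n * ((M - g) * y)" for n y
      by (metis mult.assoc of_nat_central)
    have "(\<Sum>i\<le>Suc m. (M - g) ^ i * (M + g) ^ (Suc m - i))
        = (M + g) ^ Suc m + (M - g) * (\<Sum>i\<le>m. (M - g) ^ i * (M + g) ^ (m - i))"
      by (subst sum.atMost_Suc_shift) (simp add: sum_distrib_left mult.assoc del: sum.atMost_Suc)
    also have "\<dots> = M ^ Suc m + of_nat (Suc m) * (g * M ^ m) + of_nat (Suc m) * ((M - g) * M ^ m)"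
      by (simp only: pw Suc c)
    also have "\<dots> = of_nat (Suc (Suc m)) * M ^ Suc m"
      by (simp add: algebra_simps)
    finally show ?case .
  qed simp
qed

section \<open>The p-center\<close>

definition central :: "'a::ring_1 \<Rightarrow> bool" where
  "central y \<longleftrightarrow> (\<forall>z. y * z = z * y)"

lemma const_commute_iff:
  "fps_const y * f = f * fps_const (y :: 'a::ring_1) \<longleftrightarrow> (\<forall>n. y * fps_nth f n = fps_nth f n * y)"
  by (simp add: fps_eq_iff)

lemma commute_mult: "y * a = a * y \<Longrightarrow> y * b = b * y \<Longrightarrow> y * (a * b) = a * b * (y :: 'a::ring_1)"
  by (metis mult.assoc)

lemma commute_sh: "fps_const (y :: 'a::ring_1) * f = f * fps_const y \<Longrightarrow> fps_const y * sh s f = sh s f * fps_const y"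
proof -
  assume "fps_const y * f = f * fps_const y"
  from arg_cong[OF this, of "sh s"] show ?thesis by (simp add: sh_simps)
qed

lemma fcentral:
  fixes f g :: "'a::ring_1 fps"
  assumes "\<And>n. central (fps_nth f n)"
  shows "f * g = g * f"
proof (rule fps_ext)
  fix n
  have "a * fps_nth f m = fps_nth f m * a" for a m
    using assms unfolding central_def by simp
  thus "fps_nth (f * g) n = fps_nth (g * f) n"
    unfolding fps_mult_nth
    by (intro sum.reindex_bij_witness[of _ "\<lambda>t. n - t" "\<lambda>t. n - t"]) auto
qed

context yang
begin

text \<open>The series d_2 does not have to be tested: the coefficients of d_2/d_1 are, up to sign,
  commutators of coefficients of e and f.\<close>

lemma central_of_generators:
  assumes A: "\<And>r. y * fps_nth A r = fps_nth A r * y" and E: "\<And>r. y * fps_nth E r = fps_nth E r * y"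
    and F: "\<And>r. y * fps_nth F r = fps_nth F r * y"
  shows "central y"
proof -
  let ?y = "fps_const y :: 'k yangian fps"
  have H: "y * fps_nth H n = fps_nth H n * y" for n
  proof (cases "n = 0")
    case True
    have "fps_nth H 0 = fps_nth d1_inv 0" by (simp add: H_def AD_nth_0)
    also have "\<dots> = 1" by (simp add: d1_inv_def)
    finally show ?thesis using True by simp
  next
    case False
    have "fps_nth H n = - (fps_nth E 1 * fps_nth F n - fps_nth F n * fps_nth E 1)"
      using E_F_comm[of 1 n] False by simp
    hence "fps_nth H n = fps_nth F n * fps_nth E 1 - fps_nth E 1 * fps_nth F n" by simp
    thus ?thesis using E[of 1] F[of n] by (simp add: right_diff_distrib left_diff_distrib commute_mult)
  qed
  have cA: "?y * A = A * ?y" and cE: "?y * E = E * ?y" and cF: "?y * F = F * ?y" and cH: "?y * H = H * ?y"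
    using assms H by (simp_all add: const_commute_iff)
  have "D = A * H" by (simp only: H_def mult.assoc[symmetric] A_inv mult_1_left)
  hence cD: "?y * D = D * ?y" using commute_mult[OF cA cH] by simp
  have cB: "?y * B = B * ?y" and cC: "?y * C = C * ?y"
    unfolding gauss_BCG by (intro commute_mult cA cE cF)+
  have "?y * (F * A * E) = F * A * E * ?y" by (intro commute_mult cA cE cF)
  hence cG: "?y * G = G * ?y" unfolding gauss_BCG distrib_left distrib_right cD by simp
  have t: "y * t_gen i j r = t_gen i j r * y" for i j r
    using cA cB cC cG by (cases i; cases j) (simp_all add: const_commute_iff t_series_def)
  show ?thesis unfolding central_def
  proof
    fix z
    show "y * z = z * y"
    proof (induction z rule: yangian_induct)
      case (const a)
      show ?case by (rule yconst(5))
    next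
      case (add u v)
      thus ?case by (simp add: distrib_left distrib_right)
    next
      case (mult u v)
      thus ?case by (rule commute_mult)
    qed (rule t)
  qed
qed

section \<open>Centrality of the p-th powers of the coefficients of e and f\<close>

lemma x_A: "xk k * A = A * (xk k - ek k)"
  using A_family(1)[of k] by (simp add: algebra_simps)

lemma x_D: "xk k * D = D * (xk k + ek k)"
  using D_family(1)[of k] by (simp add: algebra_simps)

text \<open>At v = u - 1 the factor u - v is 1 and the terms d_1(u) e(v) cancel. The relation for
  d_2 has the opposite sign, so there the shift is to v = u + 1.\<close>

lemma A_e: "A * ek k = sh 1 (ek k) * A"
  using A_shift[of 1 0 k] by (simp add: sh_0 algebra_simps)

lemma D_e: "D * ek k = sh (- 1) (ek k) * D"
  using D_shift[of "- 1" 0 k] by (simp add: sh_0 algebra_simps)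

lemma x_H: "xk k * H - H * xk k = ek k * H + H * ek k"
proof -
  have "A * (xk k * H - H * xk k) = (A * xk k - xk k * A) * H + (xk k * (A * H) - (A * H) * xk k)"
    by (simp add: algebra_simps)
  also have "A * H = D" by (simp only: H_def mult.assoc[symmetric] A_inv mult_1_left)
  also have "A * xk k - xk k * A = A * ek k" by (rule A_family(1))
  also have "xk k * D - D * xk k = A * H * ek k"
    using \<open>A * H = D\<close> by (simp add: x_D algebra_simps)
  finally have "A * (xk k * H - H * xk k) = A * (ek k * H + H * ek k)"
    by (simp add: algebra_simps)
  thus ?thesis by (rule cancel_left[OF A_inv(2)])
qed

end

locale yang_p = yang K for K :: "'k::comm_ring_1 itself" +
  fixes p :: nat
  assumes p: "normalization_semidom_class.prime p" "of_nat p = (0 :: 'k)"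
begin

lemma p_yang: "of_nat p = (0 :: 'k yangian)"
  using p(2) yconst(2) yangian_const_of_nat by metis

lemma p_fps: "of_nat p = (0 :: 'k yangian fps)"
  by (metis p_yang fps_of_nat fps_const_0_eq_0)

lemma p_gt: "p \<ge> 2"
  using p(1) by (rule prime_ge_2_nat)

lemma fact_0: "of_int (fact p * c) = (0 :: 'k yangian fps)"
proof -
  obtain q where "fact p = p * q" using p_gt dvd_fact[of p p] by (auto elim: dvdE)
  hence "(fact p :: int) = int p * int q" by (metis of_nat_fact of_nat_mult)
  thus ?thesis by (simp add: p_fps)
qed

text \<open>The factor (p - 1)! in \<open>ad_two_sided\<close> is not divisible by p, so the sum
  itself has to vanish. Moving the powers of e past the inverse of d_1 and past d_2 turns them into
  powers of e(u - 1) and e(u + 1). By \<open>E_shift\<close>, half the difference and the mean of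
  these two satisfy the relation of \<open>jordan_plane_sum\<close>, which evaluates the sum to p
  times a power.\<close>

lemma adH: "adn (xk k) (p - 1) H = 0"
proof -
  let ?e = "ek k" and ?a = "sh 1 (ek k)" and ?b = "sh (- 1) (ek k)"
  have pw: "?e ^ i * d1_inv = d1_inv * ?a ^ i" for i
  proof (induction i)
    case (Suc i)
    have ed: "?e * d1_inv = d1_inv * ?a"
      by (rule cancel_left[OF A_inv(2)]) (unfold mult.assoc[symmetric] A_e A_inv mult_1_left, simp only: mult.assoc A_inv mult_1_right)
    have "?e ^ Suc i * d1_inv = ?e * (?e ^ i * d1_inv)" by (simp add: mult.assoc)
    also have "\<dots> = d1_inv * ?a ^ Suc i" by (simp only: Suc mult.assoc[symmetric] ed power_Suc)
    finally show ?case .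
  qed simp
  have pw': "D * ?e ^ i = ?b ^ i * D" for i
  proof (induction i)
    case (Suc i)
    have "D * ?e ^ Suc i = (D * ?e) * ?e ^ i" by (simp add: mult.assoc)
    also have "\<dots> = ?b * (D * ?e ^ i)" by (simp only: D_e mult.assoc)
    also have "\<dots> = ?b ^ Suc i * D" by (simp only: Suc power_Suc mult.assoc)
    finally show ?case .
  qed simp
  have jp: "(\<Sum>i\<le>p - 1. ?a ^ i * ?b ^ (p - 1 - i)) = 0"
  proof (cases "p = 2")
    case True
    \<comment> \<open>In characteristic 2 there is no mean to form; the shifts by 1 and -1 coincide
      and the sum is twice one term.\<close>
    have "of_nat 2 = (0 :: 'k yangian)" using p_yang True by simp
    hence "of_int 1 = (of_int (- 1) :: 'k yangian)" by (simp add: eq_neg_iff_add_eq_0)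
    hence "?a = ?b" using sh_cong by metis
    moreover have "?b + ?b = 0"
    proof -
      have "?b + ?b = of_nat p * ?b" using True by (simp add: mult_2)
      thus ?thesis by (simp only: p_fps mult_zero_left)
    qed
    ultimately show ?thesis using True by simp
  next
    case False
    with p(1) have "odd p" using prime_odd_nat p_gt by auto
    then obtain h where h: "p = 2 * h + 1" by (elim oddE)
    \<comment> \<open>This is (p + 1)/2, the inverse of 2 modulo p. Below, \<open>M\<close> is the
      mean of the two shifted series and \<open>g\<close> half their difference.\<close>
    define c where "c = (of_nat (Suc h) :: 'k yangian fps)"
    have c2: "2 * c = 1"
    proof -
      have "2 * c = of_nat (p + 1)"
        unfolding c_def h mult_2[of "of_nat _"] of_nat_add[symmetric] by (rule arg_cong) simp
      also have "\<dots> = 1" by (simp add: p_fps)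
      finally show ?thesis .
    qed
    have cc: "y * c = c * y" for y unfolding c_def by (rule of_nat_central)
    define g where "g = c * (?b - ?a)"
    define M where "M = ?a + g"
    have "g + g = 2 * c * (?b - ?a)" by (simp add: g_def mult_2 distrib_right)
    hence gg: "g + g = ?b - ?a" by (simp add: c2)
    have a: "M - g = ?a" and b: "M + g = ?b" using gg by (simp_all add: M_def algebra_simps)
    have "2 * (?b * ?a - ?a * ?b) = (?b - ?a) * (?b - ?a)"
      using E_shift[of 1 "- 1" k] by simp
    hence X: "c * (2 * (?b * ?a - ?a * ?b)) = c * ((?b - ?a) * (?b - ?a))" by simp
    have "c * 2 = 1" using c2 cc[of 2] by simp
    hence "?b * ?a - ?a * ?b = c * 2 * (?b * ?a - ?a * ?b)" by simp
    hence ba: "?b * ?a - ?a * ?b = c * ((?b - ?a) * (?b - ?a))" by (simp only: mult.assoc X)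
    have "g * M - M * g = g * ?a - ?a * g"
      unfolding M_def by (simp add: algebra_simps)
    also have "?a * g = c * (?a * (?b - ?a))" 
      unfolding g_def by (rule mult_left_swap[OF cc])
    also have "g * ?a - \<dots> = c * (?b * ?a - ?a * ?b)"
      unfolding g_def by (simp add: algebra_simps)
    also have "\<dots> = g * g"
      unfolding ba g_def mult.assoc mult_left_swap[OF cc[of "?b - ?a"]] ..
    finally have "(\<Sum>i\<le>p - 1. (M - g) ^ i * (M + g) ^ (p - 1 - i)) = of_nat (Suc (p - 1)) * M ^ (p - 1)"
      by (rule jordan_plane_sum)
    thus ?thesis using p_gt p_fps by (simp add: a b del: of_nat_Suc)
  qed
  have "(\<Sum>i\<le>p - 1. ?e ^ i * H * ?e ^ (p - 1 - i)) = d1_inv * (\<Sum>i\<le>p - 1. ?a ^ i * ?b ^ (p - 1 - i)) * D"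
    unfolding H_def sum_distrib_left sum_distrib_right
    by (rule sum.cong[OF refl]) (unfold mult.assoc[symmetric] pw, simp only: mult.assoc pw')
  hence "(\<Sum>i\<le>p - 1. ?e ^ i * H * ?e ^ (p - 1 - i)) = 0" by (simp only: jp mult_zero_left mult_zero_right)
  thus ?thesis using ad_two_sided[OF x_ek x_H, of k "p - 1"] by (simp only: mult_zero_right)
qed

text \<open>By \<open>power_prime_commute\<close> it suffices that p-fold commutators with the
  coefficients of d_1, e and f vanish. For d_1 two commutators are enough, for e the Riccati
  equation produces p!, and f is reduced to \<open>adH\<close>.\<close>

lemma E_p_central: "central (fps_nth E r ^ p)"
proof (cases r)
  case 0
  thus ?thesis using p_gt by (simp add: drinfeld_nth_0 central_def power_0_left)
next
  case (Suc k)
  let ?x = "fps_nth E (Suc k)"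
  have com: "?x ^ p * y = y * ?x ^ p" if "adn ?x p y = 0" for y
    using power_prime_commute[OF p(1) p_yang, of ?x y] that by simp
  have comf: "?x ^ p * fps_nth f n = fps_nth f n * ?x ^ p" if "fps_nth (adn (xk k) p f) n = 0" for f n
    using com that by (simp add: xk_def adn_const_nth)
  have "central (?x ^ p)"
  proof (rule central_of_generators)
    fix n
    have "adn (xk k) 2 A = xk k * (xk k * A - A * xk k) - (xk k * A - A * xk k) * xk k"
      by (simp add: numeral_2_eq_2)
    also have "xk k * A - A * xk k = - (A * ek k)" by (simp add: x_A algebra_simps)
    also have "xk k * - (A * ek k) - - (A * ek k) * xk k = A * (ek k * xk k) - (xk k * A) * ek k"
      by (simp add: algebra_simps)
    also have "\<dots> = A * (ek k * ek k - (xk k * ek k - ek k * xk k))"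
      by (simp add: x_A algebra_simps)
    also have "\<dots> = 0" by (simp add: x_ek)
    finally have "adn (xk k) p A = 0" using p_gt by (rule adn_vanish)
    thus "?x ^ p * fps_nth A n = fps_nth A n * ?x ^ p" by (intro comf) simp
  next
    fix n
    consider "n = 0" | "n > k" | "0 < n" "n \<le> k" by linarith
    thus "?x ^ p * fps_nth E n = fps_nth E n * ?x ^ p"
    proof cases
      case 1
      thus ?thesis by (simp add: drinfeld_nth_0)
    next
      case 2
      have "eq_upto N (xk k * ek k - ek k * xk k) (of_int 1 * (ek k * ek k))" for N
        by (simp add: x_ek eq_upto_intros)
      from ad_riccati[OF this, of "Suc (n - k)" p]
      have "fps_nth (adn (xk k) p (ek k)) (n - k) = 0"
        by (simp only: fact_0 eq_upto_def) simp
      hence "?x ^ p * fps_nth (ek k) (n - k) = fps_nth (ek k) (n - k) * ?x ^ p" by (rule comf)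
      thus ?thesis using 2 by (simp add: ek_nth)
    next
      case 3
      \<comment> \<open>For indices up to k the coefficients are listed backwards. This again gives
        a Riccati equation, now with sign -1 and valid below degree k, where the indices stay
        positive.\<close>
      define y where "y = Abs_fps (\<lambda>l. fps_nth E (k - l))"
      have "eq_upto k (xk k * y - y * xk k) (of_int (- 1) * (y * y))"
        unfolding eq_upto_def
      proof safe
        fix l assume l: "l < k"
        have "(\<Sum>i=k - l..<Suc k. fps_nth E i * fps_nth E (k - l + Suc k - 1 - i)) = fps_nth (y * y) l"
          unfolding fps_mult_nth y_def
          by (rule sum.reindex_bij_witness[of _ "\<lambda>i. k - i" "\<lambda>i. k - i"]) (use l in auto)
        thus "fps_nth (xk k * y - y * xk k) l = fps_nth (of_int (- 1) * (y * y)) l"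
          using E_comm[of "k - l" "Suc k"] l by (simp add: xk_def y_def algebra_simps)
      qed
      from ad_riccati[OF this, of p] have "fps_nth (adn (xk k) p y) (k - n) = 0"
        using 3 by (simp only: fact_0 eq_upto_def) simp
      hence "?x ^ p * fps_nth y (k - n) = fps_nth y (k - n) * ?x ^ p" by (rule comf)
      thus ?thesis using 3 by (simp add: y_def)
    qed
  next
    fix n
    show "?x ^ p * fps_nth F n = fps_nth F n * ?x ^ p"
    proof (cases "n = 0")
      case False
      \<comment> \<open>The first commutator turns f^(n) into a coefficient of -H; the other p - 1
        are those of \<open>adH\<close>.\<close>
      have "adn ?x (Suc (p - 1)) (fps_nth F n) = adn ?x (p - 1) (- fps_nth H (k + n))"
        unfolding adn_shift[symmetric] using E_F_comm[of "Suc k" n] False by simp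
      also have "\<dots> = - fps_nth (adn (xk k) (p - 1) H) (k + n)"
        by (simp add: adn_minus adn_const_nth xk_def)
      finally have "adn ?x p (fps_nth F n) = 0" using p_gt adH by simp
      thus ?thesis by (rule com)
    qed (simp add: drinfeld_nth_0)
  qed
  thus ?thesis by (simp add: Suc)
qed

lemma F_p_central: "central (fps_nth F r ^ p)"
proof -
  have t: "tau (fps_nth E r ^ p) = fps_nth F r ^ p"
    by (simp add: tau_power ftr_E[symmetric] ftr_nth)
  show ?thesis unfolding central_def
  proof
    fix z
    have "fps_nth E r ^ p * tau z = tau z * fps_nth E r ^ p"
      using E_p_central unfolding central_def by blast
    from arg_cong[OF this, of tau] show "fps_nth F r ^ p * z = z * fps_nth F r ^ p"
      by (simp add: tau_simps tau_tau t)
  qed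
qed

end

section \<open>Quantum determinants and the central series b\<close>

lemma prod_list_commute:
  fixes g :: "nat \<Rightarrow> 'a::ring_1"
  assumes "\<And>c. y * g c = g c * y"
  shows "y * prod_list (map g xs) = prod_list (map g xs) * y"
  by (induction xs) (simp_all add: commute_mult assms)

lemma prod_list_mult_commute:
  fixes f g :: "nat \<Rightarrow> 'a::ring_1"
  assumes "\<And>c d. f c * g d = g d * f c"
  shows "prod_list (map f xs) * prod_list (map g xs) = prod_list (map (\<lambda>c. f c * g c) xs)"
proof (induction xs)
  case (Cons c xs)
  have "prod_list (map f xs) * g c = g c * prod_list (map f xs)"
    using prod_list_commute[of "g c" f xs] assms by metis
  from mult4_swap[OF this, of "f c" "prod_list (map g xs)"] show ?case by (simp add: Cons)
qed simp

lemma prod_list_rev_commute: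
  fixes g :: "nat \<Rightarrow> 'a::ring_1"
  assumes "\<And>c d. g c * g d = g d * g c"
  shows "prod_list (map g (rev xs)) = prod_list (map g xs)"
proof (induction xs)
  case (Cons c xs)
  thus ?case using prod_list_commute[of "g c" g xs] assms by simp
qed simp

lemma prod_list_nth_0:
  fixes g :: "nat \<Rightarrow> 'a::ring_1 fps"
  assumes "\<And>c. fps_nth (g c) 0 = 1"
  shows "fps_nth (prod_list (map g xs)) 0 = 1"
  by (induction xs) (simp_all add: assms)

lemma ftr_prod_list: "ftr (prod_list (map g xs)) = prod_list (map (\<lambda>c. ftr (g c)) (rev xs))"
  by (induction xs) (simp_all add: ftr_mult ftr_1)

lemma sh_commute:
  fixes f g :: "'a::ring_1 fps"
  assumes "\<And>r s. fps_nth f r * fps_nth g s = fps_nth g s * fps_nth f r"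
  shows "sh s f * sh t g = sh t g * sh s f"
proof -
  have "fps_const (fps_nth f r) * sh t g = sh t g * fps_const (fps_nth f r)" for r
    by (rule commute_sh) (simp add: const_commute_iff assms)
  hence "fps_nth (sh t g) m * fps_nth f r = fps_nth f r * fps_nth (sh t g) m" for r m
    by (simp add: const_commute_iff)
  hence "fps_const (fps_nth (sh t g) m) * sh s f = sh s f * fps_const (fps_nth (sh t g) m)" for m
    by (intro commute_sh) (simp add: const_commute_iff)
  hence c: "fps_nth (sh t g) m * fps_nth (sh s f) n = fps_nth (sh s f) n * fps_nth (sh t g) m" for m n
    by (simp add: const_commute_iff)
  show ?thesis
  proof (rule fps_ext)
    show "fps_nth (sh s f * sh t g) n = fps_nth (sh t g * sh s f) n" for n
      unfolding fps_mult_nth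
      by (intro sum.reindex_bij_witness[of _ "\<lambda>t. n - t" "\<lambda>t. n - t"]) (auto simp: c)
  qed
qed

context yang
begin

lemma A_coeff: "fps_nth A r * fps_nth A s = fps_nth A s * fps_nth A r"
  using arg_cong[OF tt_commute[of I1 I1], of "\<lambda>f. fps_nth (fps_nth f s) r"]
  by (simp add: inXY_nth del: fps_mult_nth_0)

lemma AD_coeff: "fps_nth A r * fps_nth D s = fps_nth D s * fps_nth A r"
  using arg_cong[OF AD_commute, of "\<lambda>f. fps_nth (fps_nth f s) r"]
  by (simp add: inXY_nth del: fps_mult_nth_0)

lemma x_sh: "xk k * sh s A = sh s A * (xk k - sh s (ek k))" "xk k * sh s D = sh s D * (xk k + sh s (ek k))"
  using arg_cong[OF x_A[of k], of "sh s"] arg_cong[OF x_D[of k], of "sh s"]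
  by (simp_all only: sh_simps xk_def)

text \<open>In the paper's notation \<open>qd s\<close> is the quantum determinant evaluated at \<open>u + 1 - s\<close>.\<close>

definition qd :: "int \<Rightarrow> 'k yangian fps" where
  "qd s = sh s D * sh (s - 1) A"

text \<open>The correction picked up by \<open>xk k\<close> at d_2 turns, on passing the factor d_1
  at the neighbouring shift, into the negative of the correction picked up there.\<close>

lemma qd_x: "xk k * qd s = qd s * xk k"
proof -
  have e: "sh s (ek k) * sh (s - 1) A = sh (s - 1) A * sh (s - 1) (ek k)"
    using A_shift[of s "s - 1" k] by (simp add: algebra_simps)
  have "xk k * qd s = sh s D * (xk k * sh (s - 1) A) + sh s D * (sh s (ek k) * sh (s - 1) A)"
    unfolding qd_def mult.assoc[symmetric] x_sh(2) by (simp add: algebra_simps)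
  also have "\<dots> = qd s * xk k" unfolding e x_sh(1) qd_def by (simp add: algebra_simps)
  finally show ?thesis .
qed

text \<open>For a series fixed by transposition, commuting with the coefficients of f is the
  transpose of commuting with those of e.\<close>

lemma central_nthI:
  assumes x: "\<And>k. xk k * f = f * xk k" and A: "\<And>r. fps_const (fps_nth A r) * f = f * fps_const (fps_nth A r)"
    and t: "ftr f = f"
  shows "central (fps_nth f n)"
proof -
  have E: "fps_nth f n * fps_nth E r = fps_nth E r * fps_nth f n" for r n
  proof (cases r)
    case (Suc k)
    from x[of k] show ?thesis by (simp add: Suc xk_def const_commute_iff)
  qed (simp add: drinfeld_nth_0)
  show ?thesis
  proof (rule central_of_generators)
    show "fps_nth f n * fps_nth A r = fps_nth A r * fps_nth f n" for r
      using A[of r] by (simp add: const_commute_iff)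
    show "fps_nth f n * fps_nth E r = fps_nth E r * fps_nth f n" for r by (rule E)
    show "fps_nth f n * fps_nth F r = fps_nth F r * fps_nth f n" for r
      using arg_cong[OF E[of n r], of tau] t by (simp add: tau_simps ftr_E[symmetric] ftr_nth[symmetric])
  qed
qed

lemma qd_central: "central (fps_nth (qd s) n)"
proof (rule central_nthI[OF qd_x])
  show "fps_const (fps_nth A r) * qd s = qd s * fps_const (fps_nth A r)" for r
    unfolding qd_def
    by (intro commute_mult commute_sh) (simp_all add: const_commute_iff A_coeff AD_coeff)
  have "sh (s - 1) A * sh s D = sh s D * sh (s - 1) A"
    by (rule sh_commute) (rule AD_coeff)
  thus "ftr (qd s) = qd s" by (simp add: qd_def ftr_mult ftr_sh ftr_t ftr_D)
qed

definition prA :: "nat \<Rightarrow> 'k yangian fps" where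
  "prA m = prod_list (map (\<lambda>c. sh (int c) A) [0..<m])"

text \<open>Every further factor raises the coefficient of \<open>ek k\<close> by one; after p
  factors it is zero.\<close>

lemma x_prA: "xk k * prA m = prA m * (xk k - of_nat m * ek k)"
proof (induction m)
  case (Suc m)
  let ?Am = "sh (int m) A"
  have s: "prA (Suc m) = prA m * ?Am" by (simp add: prA_def)
  have *: "of_nat m * ek k * ?Am = ?Am * (of_nat m * ek k + (ek k - sh (int m) (ek k)))"
  proof -
    have "- of_nat m * (?Am * ek k - ek k * ?Am) = ?Am * (ek k - sh (int m) (ek k))"
      using A_shift[of 0 "int m" k] by (simp add: sh_0)
    hence "of_nat m * ek k * ?Am = of_nat m * ?Am * ek k + ?Am * (ek k - sh (int m) (ek k))"
      by (simp add: algebra_simps)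
    thus ?thesis by (simp only: distrib_left of_nat_central[of ?Am, symmetric] mult.assoc[symmetric])
  qed
  have "xk k * prA (Suc m) = prA m * ((xk k - of_nat m * ek k) * ?Am)"
    unfolding s mult.assoc[symmetric] Suc ..
  also have "(xk k - of_nat m * ek k) * ?Am = ?Am * (xk k - of_nat (Suc m) * ek k)"
    unfolding left_diff_distrib * x_sh by (simp add: algebra_simps)
  finally show ?case by (simp add: s mult.assoc)
qed (simp add: prA_def)

end

context yang_p
begin

lemma prA_central: "central (fps_nth (prA p) n)"
proof (rule central_nthI)
  have AA: "sh s A * sh t A = sh t A * sh s A" for s t by (rule sh_commute) (rule A_coeff)
  show "xk k * prA p = prA p * xk k" for k
    by (simp add: x_prA p_fps)
  show "fps_const (fps_nth A r) * prA p = prA p * fps_const (fps_nth A r)" for r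
    unfolding prA_def
    by (intro prod_list_commute commute_sh) (simp add: const_commute_iff A_coeff)
  show "ftr (prA p) = prA p"
    unfolding prA_def ftr_prod_list ftr_sh ftr_t by (rule prod_list_rev_commute) (rule AA)
qed

text \<open>The product of the quantum determinants over all residues modulo p is the product for
  d_2 times a shifted product for d_1. A shift by one permutes the residues, so the latter is
  \<open>prA p\<close>, which is central and invertible.\<close>

lemma prD_central: "central (fps_nth (prod_list (map (\<lambda>c. sh (int c) D) [0..<p])) n)"
proof -
  let ?b = "prod_list (map (\<lambda>c. sh (int c) D) [0..<p])"
  let ?M = "prod_list (map (\<lambda>c. sh (int c - 1) A) [0..<p])"
  let ?N = "prod_list (map (\<lambda>c. qd (int c)) [0..<p])"
  have AA: "sh s A * sh t A = sh t A * sh s A" for s t by (rule sh_commute) (rule A_coeff)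
  have bM: "?b * ?M = ?N"
    unfolding qd_def by (rule prod_list_mult_commute, rule sh_commute, rule AD_coeff[symmetric])
  obtain q where q: "p = Suc q" using p_gt by (cases p) auto
  have "?M = sh (- 1) A * prod_list (map (\<lambda>c. sh (int c) A) [0..<q])"
    unfolding q upt_conv_Cons[OF zero_less_Suc] map_Suc_upt[symmetric] by (simp add: comp_def)
  also have "sh (- 1) A = sh (int q) A"
  proof -
    have "of_int (- 1) = (of_int (int q) :: 'k yangian)"
      using p_yang q by (simp add: eq_neg_iff_add_eq_0[symmetric] add.commute) (metis add.commute eq_neg_iff_add_eq_0 minus_minus)
    thus ?thesis using sh_cong by metis
  qed
  also have "sh (int q) A * prod_list (map (\<lambda>c. sh (int c) A) [0..<q]) = prA p"
    unfolding prA_def q by (simp add: prod_list_commute[OF AA])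
  finally have M: "?M = prA p" .
  have cM: "?M * g = g * ?M" for g unfolding M by (rule fcentral) (rule prA_central)
  have cN: "?N * g = g * ?N" for g
  proof -
    have "qd s * g = g * qd s" for s by (rule fcentral) (rule qd_central)
    thus ?thesis using prod_list_commute[of g "\<lambda>c. qd (int c)"] by metis
  qed
  have M0: "fps_nth ?M 0 = 1" by (rule prod_list_nth_0) (simp add: sh_nth_0 AD_nth_0)
  have "?M * fps_right_inverse ?M 1 = 1" by (rule fps_right_inverse) (simp add: M0)
  note cancel = cancel_right[OF this]
  have "fps_const z * ?b = ?b * fps_const z" for z
  proof (rule cancel)
    have "fps_const z * ?b * ?M = ?N * fps_const z" by (simp only: mult.assoc bM cN)
    also have "\<dots> = ?b * (?M * fps_const z)" unfolding bM[symmetric] mult.assoc ..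
    also have "\<dots> = ?b * fps_const z * ?M" unfolding cM[of "fps_const z"] mult.assoc ..
    finally show "fps_const z * ?b * ?M = ?b * fps_const z * ?M" .
  qed
  thus ?thesis unfolding central_def const_commute_iff by metis
qed

end

lemma p_center_gens_central:
  fixes y :: "'k::field yangian"
  assumes p: "CHAR('k) > 0" and y: "y \<in> p_center_gens"
  shows "central y"
proof -
  interpret yang_p "TYPE('k)" "CHAR('k)"
    by standard (use prime_CHAR_semidom[OF p] in simp_all)
  have b: "b_series I1 = prA CHAR('k)" "b_series I2 = prod_list (map (\<lambda>c. sh (int c) D) [0..<CHAR('k)])"
    by (simp_all add: b_series_def u_shift_prod_def u_shift_eq_sh prA_def d_series.simps(1))
  from y consider i r where "y = fps_nth (b_series i) (r * CHAR('k))"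
    | r where "y = fps_nth e_series r ^ CHAR('k)" | r where "y = fps_nth f_series r ^ CHAR('k)"
    unfolding p_center_gens_def by blast
  thus ?thesis
  proof cases
    case (1 i r)
    thus ?thesis by (cases i) (simp_all add: b prA_central prD_central)
  qed (simp_all add: E_p_central F_p_central)
qed

section \<open>Left ideals of the Yangian and submodules\<close>

definition lid :: "'a::ring_1 set \<Rightarrow> bool" where
  "lid N \<longleftrightarrow> 0 \<in> N \<and> (\<forall>x\<in>N. \<forall>y\<in>N. x + y \<in> N) \<and> (\<forall>x\<in>N. \<forall>y. y * x \<in> N)"

lemma lidD:
  assumes "lid N"
  shows "0 \<in> N" "x \<in> N \<Longrightarrow> y \<in> N \<Longrightarrow> x + y \<in> N" "x \<in> N \<Longrightarrow> y * x \<in> N" "x \<in> N \<Longrightarrow> - x \<in> N"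
    "x \<in> N \<Longrightarrow> y \<in> N \<Longrightarrow> x - y \<in> N"
proof -
  show *: "0 \<in> N" "\<And>x y. x \<in> N \<Longrightarrow> y \<in> N \<Longrightarrow> x + y \<in> N" "\<And>x y. x \<in> N \<Longrightarrow> y * x \<in> N"
    using assms by (auto simp: lid_def)
  show m: "- x \<in> N" if "x \<in> N" for x using *(3)[OF that, of "- 1"] by simp
  show "x - y \<in> N" if "x \<in> N" "y \<in> N" using *(2)[OF that(1) m[OF that(2)]] by simp
qed

lemma lid_sum: "lid N \<Longrightarrow> (\<And>s. s \<in> S \<Longrightarrow> f s \<in> N) \<Longrightarrow> sum f S \<in> N"
  by (induction S rule: infinite_finite_induct) (auto simp: lidD)

inductive_set lspan :: "'a::ring_1 set \<Rightarrow> 'a set" for U where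
  zero: "0 \<in> lspan U"
| step: "g \<in> U \<Longrightarrow> x \<in> lspan U \<Longrightarrow> y * g + x \<in> lspan U"

lemma lspan_gen: "g \<in> U \<Longrightarrow> y * g \<in> lspan U"
  using lspan.step[OF _ lspan.zero, of g U y] by simp

lemma lspan_add: "x \<in> lspan U \<Longrightarrow> x' \<in> lspan U \<Longrightarrow> x + x' \<in> lspan U"
  by (induction x rule: lspan.induct) (auto intro: lspan.intros simp: add.assoc)

lemma lspan_lmult: "x \<in> lspan U \<Longrightarrow> y * x \<in> lspan U"
  by (induction x rule: lspan.induct)
    (auto intro: lspan.intros simp: distrib_left mult.assoc[symmetric])

lemma lid_lspan: "lid (lspan U)"
  by (auto simp: lid_def lspan.zero lspan_add lspan_lmult)

lemma lspan_base: "U \<subseteq> lspan U"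
  using lspan_gen[of _ U 1] by auto

lemma lspan_least: "lid N \<Longrightarrow> U \<subseteq> N \<Longrightarrow> lspan U \<subseteq> N"
proof
  fix x assume N: "lid N" "U \<subseteq> N" and "x \<in> lspan U"
  from this(3) show "x \<in> N"
    by induction (use N in \<open>auto intro: lidD\<close>)
qed

lemma lspan_mono: "U \<subseteq> V \<Longrightarrow> lspan U \<subseteq> lspan V"
  using lspan_least[OF lid_lspan, of U V] lspan_base[of V] by blast

lemma lspan_central_rmult:
  assumes "\<And>g. g \<in> U \<Longrightarrow> central g" "x \<in> lspan U"
  shows "x * z \<in> lspan U"
  using assms(2)
proof induction
  case (step g x y)
  have "g * z = z * g" using assms(1)[OF step(1)] unfolding central_def by blast
  hence "y * g * z = y * z * g" by (simp only: mult.assoc)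
  hence "(y * g + x) * z = y * z * g + x * z" by (simp only: distrib_right)
  thus ?case using lspan.step[OF step(1,3), of "y * z"] by (simp only:)
qed (simp add: lspan.zero)

text \<open>Centrality of the generators makes the left ideal they generate two-sided. Its
  intersection with the p-center is then an ideal of the p-center containing the generators, hence
  it contains \<open>p_center_plus\<close>.\<close>

lemma restricted_ideal_eq:
  assumes p: "CHAR('k::field) > 0"
  shows "restricted_ideal = lspan (p_center_gens :: 'k yangian set)"
proof -
  let ?Y = "ring_of_type_algebra :: 'k yangian ring" and ?U = "p_center_gens :: 'k yangian set"
  interpret Y: ring ?Y by (rule ring_ring_of_type_algebra)
  note cen = p_center_gens_central[OF p]
  have "subring p_center ?Y" unfolding p_center_def by (rule Y.generate_ring_is_subring) simp
  from Y.subring_is_ring[OF this] interpret S: ring "?Y\<lparr>carrier := p_center\<rparr>" .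
  have U: "?U \<subseteq> p_center"
    unfolding p_center_def by (intro subsetI generate_ring.incl UnI2)
  have neg: "\<ominus>\<^bsub>?Y\<lparr>carrier := p_center\<rparr>\<^esub> x = - x" if "x \<in> p_center" for x
  proof -
    have "- x \<in> p_center"
      using generate_ring.a_inv[of x ?Y] that by (simp add: p_center_def)
    thus ?thesis using S.minus_equality[of "- x" x] that by simp
  qed
  have "ideal (p_center \<inter> lspan ?U) (?Y\<lparr>carrier := p_center\<rparr>)"
  proof (rule idealI)
    show "ring (?Y\<lparr>carrier := p_center\<rparr>)" by (rule S.ring_axioms)
    show "subgroup (p_center \<inter> lspan ?U) (add_monoid (?Y\<lparr>carrier := p_center\<rparr>))"
    proof (rule S.add.subgroupI)
      show "p_center \<inter> lspan ?U \<noteq> {}" using S.zero_closed lspan.zero by auto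
      fix a assume a: "a \<in> p_center \<inter> lspan ?U"
      hence "- a \<in> p_center \<inter> lspan ?U"
        using neg[of a] S.a_inv_closed[of a] by (auto simp: lidD(4)[OF lid_lspan])
      thus "\<ominus>\<^bsub>?Y\<lparr>carrier := p_center\<rparr>\<^esub> a \<in> p_center \<inter> lspan ?U"
        using neg[of a] a by simp
    qed (use S.a_closed lspan_add in auto)
  qed (use S.m_closed lspan_lmult lspan_central_rmult[OF cen] in auto)
  hence "p_center_plus \<subseteq> lspan ?U"
    unfolding p_center_plus_def genideal_def using U lspan_base by blast
  note W = this
  have "x \<in> lspan ?U" if "x \<in> restricted_ideal" for x
    using that unfolding restricted_ideal_def
    by (induction rule: ideal_prod.induct) (use W in \<open>auto intro: lspan_lmult lspan_add\<close>)
  moreover have "x \<in> restricted_ideal" if "x \<in> lspan ?U" for x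
  proof -
    have g: "?U \<subseteq> p_center_plus" unfolding p_center_plus_def genideal_def by blast
    have b: "y * g \<in> restricted_ideal" if "g \<in> ?U" for y g
      unfolding restricted_ideal_def
      using ideal_prod.prod[of y "carrier ?Y" g p_center_plus ?Y] that g by auto
    have a: "x + y \<in> restricted_ideal" if "x \<in> restricted_ideal" "y \<in> restricted_ideal" for x y :: "'k yangian"
      using ideal_prod.sum[of x ?Y "carrier ?Y" p_center_plus y] that unfolding restricted_ideal_def by simp
    have "fps_nth e_series 1 ^ CHAR('k) \<in> ?U" unfolding p_center_gens_def by blast
    from b[OF this, of 0] have "0 \<in> (restricted_ideal :: 'k yangian set)" by simp
    with that show ?thesis by induction (auto intro: a b)
  qed
  ultimately show ?thesis by blast
qed

lemma ideal_restricted_ideal: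
  assumes p: "CHAR('k::field) > 0"
  shows "ideal (restricted_ideal :: 'k yangian set) ring_of_type_algebra"
  unfolding restricted_ideal_eq[OF p]
proof (rule idealI[OF ring_ring_of_type_algebra])
  interpret Y: ring "ring_of_type_algebra :: 'k yangian ring" by (rule ring_ring_of_type_algebra)
  show "subgroup (lspan p_center_gens :: 'k yangian set) (add_monoid ring_of_type_algebra)"
    by (rule Y.add.subgroupI)
      (auto simp: a_inv_def[symmetric] lidD[OF lid_lspan] intro: lspan.zero)
qed (use lspan_lmult lspan_central_rmult[OF p_center_gens_central[OF p]] in auto)

text \<open>
  Replaces the tower of quotients in the definition of the simple module by a left ideal of the Yangian.
\<close>

definition presents ::
    "('k::field yangian set, 'm) module \<Rightarrow> ('k yangian \<Rightarrow> 'm) \<Rightarrow> 'k yangian set \<Rightarrow> bool" where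
  "presents M f L \<longleftrightarrow> left_module restricted_yangian M \<and> carrier M = range f \<and>
     (\<forall>x y. f (x + y) = f x \<oplus>\<^bsub>M\<^esub> f y) \<and> (\<forall>x y. f (x * y) = restricted_proj x \<odot>\<^bsub>M\<^esub> f y) \<and>
     (\<forall>x. f x = \<zero>\<^bsub>M\<^esub> \<longleftrightarrow> x \<in> L)"

lemma carrier_restricted: "carrier restricted_yangian = range (restricted_proj :: 'k::field yangian \<Rightarrow> _)"
  by (auto simp: restricted_yangian_def FactRing_def A_RCOSETS_def' restricted_proj_def)

lemma restricted_hom:
  assumes p: "CHAR('k::field) > 0"
  shows "restricted_proj \<in> ring_hom ring_of_type_algebra (restricted_yangian :: 'k yangian set ring)"
  using ideal.rcos_ring_hom[OF ideal_restricted_ideal[OF p]]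
  by (simp add: restricted_yangian_def restricted_proj_def[abs_def])

lemma ring_restricted: "CHAR('k::field) > 0 \<Longrightarrow> ring (restricted_yangian :: 'k yangian set ring)"
  unfolding restricted_yangian_def by (intro ideal.quotient_is_ring ideal_restricted_ideal)

lemma presents_regular:
  assumes p: "CHAR('k::field) > 0"
  shows "presents (regular_module restricted_yangian) (restricted_proj :: 'k yangian \<Rightarrow> _) restricted_ideal"
proof -
  let ?I = "restricted_ideal :: 'k yangian set"
  interpret I: ideal ?I ring_of_type_algebra by (rule ideal_restricted_ideal[OF p])
  note h = ring_hom_memE[OF restricted_hom[OF p], simplified]
  have "restricted_proj x = ?I \<longleftrightarrow> x \<in> ?I" for x
    unfolding restricted_proj_def
    using I.a_coset_join1[of ?I x] I.a_coset_join2[of x ?I] I.a_subgroup by auto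
  moreover have "\<zero>\<^bsub>regular_module restricted_yangian\<^esub> = ?I"
    by (simp add: regular_module_def restricted_yangian_def FactRing_def)
  ultimately show ?thesis
    using left_module_regular_module[OF ring_restricted[OF p]] h
    by (simp add: presents_def) (simp add: regular_module_def carrier_restricted)
qed

context
  fixes M :: "('k::field yangian set, 'm) module" and f L
  assumes pr: "presents M f L"
begin

lemma presD:
  "left_module restricted_yangian M" "carrier M = range f" "f (x + y) = f x \<oplus>\<^bsub>M\<^esub> f y"
  "f (x * y) = restricted_proj x \<odot>\<^bsub>M\<^esub> f y" "f x = \<zero>\<^bsub>M\<^esub> \<longleftrightarrow> x \<in> L"
  using pr by (auto simp: presents_def)

lemma pres_0: "f 0 = \<zero>\<^bsub>M\<^esub>" and pres_minus: "f (- x) = \<ominus>\<^bsub>M\<^esub> f x"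
proof -
  interpret left_module restricted_yangian M by (rule presD)
  have c: "f x \<in> carrier M" for x by (simp add: presD)
  have "f 0 \<oplus>\<^bsub>M\<^esub> f 0 = f 0" using presD(3)[of 0 0] by simp
  thus z: "f 0 = \<zero>\<^bsub>M\<^esub>" using c[of 0] by (metis M.add.r_cancel_one')
  have "f (- x) \<oplus>\<^bsub>M\<^esub> f x = \<zero>\<^bsub>M\<^esub>" using presD(3)[of "- x" x] z by simp
  thus "f (- x) = \<ominus>\<^bsub>M\<^esub> f x" using c M.minus_equality by metis
qed

lemma pres_diff: "f x = f y \<longleftrightarrow> x - y \<in> L"
proof -
  interpret left_module restricted_yangian M by (rule presD)
  have c: "f x \<in> carrier M" for x by (simp add: presD)
  show ?thesis
  proof
    assume "f x = f y"
    hence "f (x - y) = \<zero>\<^bsub>M\<^esub>"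
      using presD(3)[of x "- y"] c[of y] by (simp add: pres_minus M.r_neg)
    thus "x - y \<in> L" by (simp only: presD(5))
  next
    assume "x - y \<in> L"
    hence "f (x - y) = \<zero>\<^bsub>M\<^esub>" by (simp only: presD(5))
    thus "f x = f y" using presD(3)[of "x - y" y] c[of y] by simp
  qed
qed

lemma lid_vimage:
  assumes "Module.submodule S restricted_yangian M"
  shows "lid (f -` S)" "L \<subseteq> f -` S" "f ` (f -` S) = S"
proof -
  interpret left_module restricted_yangian M by (rule presD)
  interpret S: Module.submodule S restricted_yangian M by fact
  have z: "\<zero>\<^bsub>M\<^esub> \<in> S" using S.one_closed by simp
  show "L \<subseteq> f -` S" using z presD(5) by auto
  show "f ` (f -` S) = S" using S.subset presD(2) by auto
  show "lid (f -` S)" unfolding lid_def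
  proof (intro conjI ballI allI)
    show "0 \<in> f -` S" using z pres_0 by simp
    show "x + y \<in> f -` S" if "x \<in> f -` S" "y \<in> f -` S" for x y
      using S.m_closed that by (simp add: presD(3))
    show "y * x \<in> f -` S" if "x \<in> f -` S" for x y
      using S.smult_closed[of "restricted_proj y" "f x"] that by (simp add: presD(4) carrier_restricted)
  qed
qed

lemma submodule_image:
  assumes "lid N"
  shows "Module.submodule (f ` N) restricted_yangian M"
proof (intro Module.submodule.intro submodule_axioms.intro)
  interpret left_module restricted_yangian M by (rule presD)
  show "subgroup (f ` N) (add_monoid M)"
  proof (rule M.add.subgroupI)
    show "f ` N \<noteq> {}" using lidD(1)[OF assms] by blast
    fix a assume "a \<in> f ` N"
    thus "\<ominus>\<^bsub>M\<^esub> a \<in> f ` N"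
      using lidD(4)[OF assms] by (auto simp: pres_minus[symmetric])
  qed (use presD(2) lidD[OF assms] in \<open>auto simp: presD(3)[symmetric]\<close>)
  fix a x
  assume "a \<in> carrier (restricted_yangian :: 'k yangian set ring)" "x \<in> f ` N"
  thus "a \<odot>\<^bsub>M\<^esub> x \<in> f ` N"
    using lidD(3)[OF assms] by (auto simp: carrier_restricted presD(4)[symmetric])
qed

lemma vimage_image: "lid N \<Longrightarrow> L \<subseteq> N \<Longrightarrow> f -` (f ` N) = N"
proof safe
  fix x y assume "lid N" "L \<subseteq> N" "f x = f y" "y \<in> N"
  thus "x \<in> N" using lidD(2)[of N "x - y" y] pres_diff by auto
qed auto

lemma presents_quot:
  assumes "Module.submodule S restricted_yangian M"
  shows "presents (quot_module M S) (\<lambda>y. S +>\<^bsub>M\<^esub> f y) (f -` S)"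
proof -
  interpret left_module restricted_yangian M by (rule presD)
  have sub: "abelian_subgroup S M"
    using Module.submodule.axioms(1)[OF assms]
    by (intro abelian_subgroupI3 additive_subgroup.intro M.abelian_group_axioms)
  interpret S: abelian_subgroup S M by fact
  have c: "f x \<in> carrier M" for x by (simp add: presD)
  have eq: "S +>\<^bsub>M\<^esub> f x = S +>\<^bsub>M\<^esub> f y \<longleftrightarrow> x - y \<in> f -` S" for x y
  proof
    assume "S +>\<^bsub>M\<^esub> f x = S +>\<^bsub>M\<^esub> f y"
    hence "f x \<in> S +>\<^bsub>M\<^esub> f y" using S.a_rcos_self[OF c] by auto
    then obtain s where s: "s \<in> S" "f x = s \<oplus>\<^bsub>M\<^esub> f y" by (auto simp: a_r_coset_def')
    have "f (x - y) = s"
      using presD(3)[of x "- y"] s c[of y] S.a_subset by (simp add: pres_minus M.a_assoc M.r_neg subset_eq)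
    thus "x - y \<in> f -` S" using s by simp
  next
    assume "x - y \<in> f -` S"
    hence "f x \<in> S +>\<^bsub>M\<^esub> f y"
      using presD(3)[of "x - y" y] by (auto simp: a_r_coset_def')
    thus "S +>\<^bsub>M\<^esub> f x = S +>\<^bsub>M\<^esub> f y" using S.a_repr_independence'[OF _ c] by metis
  qed
  have sm: "restricted_proj x \<odot>\<^bsub>quot_module M S\<^esub> (S +>\<^bsub>M\<^esub> f y) = S +>\<^bsub>M\<^esub> f (x * y)" for x y
  proof -
    have "S +>\<^bsub>M\<^esub> (restricted_proj x \<odot>\<^bsub>M\<^esub> m) = S +>\<^bsub>M\<^esub> f (x * y)" if m: "m \<in> S +>\<^bsub>M\<^esub> f y" for m
    proof -
      have "m \<in> carrier M" using m S.a_subset c[of y] by (auto simp: a_r_coset_def')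
      then obtain z where z: "m = f z" using presD(2) by auto
      hence "S +>\<^bsub>M\<^esub> f z = S +>\<^bsub>M\<^esub> f y" using S.a_repr_independence'[OF m c] by simp
      hence "z - y \<in> f -` S" by (simp only: eq)
      hence "x * z - x * y \<in> f -` S"
        using lidD(3)[OF lid_vimage(1)[OF assms]] by (simp only: right_diff_distrib[symmetric])
      thus ?thesis unfolding z presD(4)[symmetric] eq .
    qed
    moreover have "f y \<in> S +>\<^bsub>M\<^esub> f y" by (rule S.a_rcos_self[OF c])
    ultimately have "(\<Union>m\<in>S +>\<^bsub>M\<^esub> f y. S +>\<^bsub>M\<^esub> (restricted_proj x \<odot>\<^bsub>M\<^esub> m)) = S +>\<^bsub>M\<^esub> f (x * y)"
      by (intro UN_constant_eq ballI)
    thus ?thesis by (simp only: quot_module_def module.simps)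
  qed
  have z: "\<zero>\<^bsub>quot_module M S\<^esub> = S +>\<^bsub>M\<^esub> f 0"
    using M.a_coset_add_zero[OF S.a_subset] by (simp add: quot_module_def pres_0)
  show ?thesis unfolding presents_def
  proof (intro conjI allI)
    show "left_module restricted_yangian (quot_module M S)"
      by (rule left_module_quot_module[OF presD(1) assms])
    show "carrier (quot_module M S) = range (\<lambda>y. S +>\<^bsub>M\<^esub> f y)"
      by (auto simp: quot_module_def A_RCOSETS_def' presD(2))
    show "S +>\<^bsub>M\<^esub> f (x + y) = (S +>\<^bsub>M\<^esub> f x) \<oplus>\<^bsub>quot_module M S\<^esub> (S +>\<^bsub>M\<^esub> f y)" for x y
      using S.a_rcos_sum[OF c c] by (simp add: quot_module_def presD(3))
    show "S +>\<^bsub>M\<^esub> f x = \<zero>\<^bsub>quot_module M S\<^esub> \<longleftrightarrow> x \<in> f -` S" for x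
      unfolding z eq by simp
  qed (simp add: sm)
qed

lemma presents_quot_image:
  assumes "lid N" "L \<subseteq> N"
  shows "presents (quot_module M (f ` N)) (\<lambda>y. f ` N +>\<^bsub>M\<^esub> f y) N"
  using presents_quot[OF submodule_image[OF assms(1)]] vimage_image[OF assms] by simp

text \<open>The module is cyclic on the image of 1, so a submodule is proper exactly if its preimage
  avoids 1. Among these preimages \<open>N\<close> is the largest, which settles existence and
  uniqueness in the definite description at once.\<close>

lemma maximal_submodule_unique:
  assumes N: "lid N" "L \<subseteq> N" "1 \<notin> N"
    and max: "\<And>N'. lid N' \<Longrightarrow> L \<subseteq> N' \<Longrightarrow> 1 \<notin> N' \<Longrightarrow> N' \<subseteq> N"
  shows "(THE S. maximal_submodule S restricted_yangian M) = f ` N"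
proof -
  have car: "S = carrier M \<longleftrightarrow> 1 \<in> f -` S" if S: "Module.submodule S restricted_yangian M" for S
  proof
    assume "1 \<in> f -` S"
    hence "y \<in> f -` S" for y using lidD(3)[OF lid_vimage(1)[OF S], of 1 y] by simp
    thus "S = carrier M" using lid_vimage(3)[OF S] presD(2) by auto
  qed (simp add: presD)
  have sub: "S \<subseteq> f ` N" if S: "Module.submodule S restricted_yangian M" "S \<noteq> carrier M" for S
    using max[OF lid_vimage(1,2)[OF S(1)]] car[OF S(1)] S(2) lid_vimage(3)[OF S(1)] by blast
  have fN: "Module.submodule (f ` N) restricted_yangian M" "f ` N \<noteq> carrier M"
    using submodule_image[OF N(1)] car[OF submodule_image[OF N(1)]] vimage_image[OF N(1,2)] N(3) by auto
  show ?thesis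
  proof (rule the_equality)
    show "maximal_submodule (f ` N) restricted_yangian M"
      unfolding maximal_submodule_def using fN sub by blast
    show "S = f ` N" if "maximal_submodule S restricted_yangian M" for S
      using that fN sub unfolding maximal_submodule_def by blast
  qed
qed

end

text \<open>The preimage of a submodule of the regular module is a left ideal that automatically
  contains the p-center generators, since these map to zero.\<close>

lemma left_ideal_gen_eq:
  assumes p: "CHAR('k::field) > 0"
  shows "left_ideal_gen restricted_yangian (restricted_proj ` U) =
    (restricted_proj :: 'k yangian \<Rightarrow> _) ` lspan (p_center_gens \<union> U)"
proof -
  note pr = presents_regular[OF p]
  let ?J = "lspan (p_center_gens \<union> U)"
  show ?thesis
  proof
    show "left_ideal_gen restricted_yangian (restricted_proj ` U) \<subseteq> restricted_proj ` ?J"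
      unfolding left_ideal_gen_def
      using submodule_image[OF pr lid_lspan[of "p_center_gens \<union> U"]] lspan_base[of "p_center_gens \<union> U"]
      by (intro Inter_lower) blast
    show "restricted_proj ` ?J \<subseteq> left_ideal_gen restricted_yangian (restricted_proj ` U)"
      unfolding left_ideal_gen_def
    proof (rule Inter_greatest, safe)
      fix S x
      assume S: "Module.submodule S restricted_yangian (regular_module restricted_yangian)"
        and U: "restricted_proj ` U \<subseteq> S" and x: "x \<in> ?J"
      have "p_center_gens \<union> U \<subseteq> restricted_proj -` S"
        using lid_vimage(2)[OF pr S] U lspan_base[of p_center_gens] unfolding restricted_ideal_eq[OF p] by auto
      from lspan_least[OF lid_vimage(1)[OF pr S] this] x show "restricted_proj x \<in> S" by auto
    qed
  qed
qed

definition verma_gens :: "(ix \<Rightarrow> 'k::field fps) \<Rightarrow> 'k yangian set" where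
  "verma_gens lam = {fps_nth e_series r | r. r > 0}
     \<union> {fps_nth (d_series i) r - yangian_const (fps_nth (lam i) r) | i r. r > 0}"

lemma presents_baby_verma:
  assumes p: "CHAR('k::field) > 0"
  shows "\<exists>f. presents (baby_verma (lam :: ix \<Rightarrow> 'k fps)) f (lspan (p_center_gens \<union> verma_gens lam))"
proof -
  have "{restricted_proj (fps_nth e_series r) | r. r > 0}
           \<union> {restricted_proj (fps_nth (d_series i) r - yangian_const (fps_nth (lam i) r))
               | i r. r > 0} = restricted_proj ` verma_gens lam"
    unfolding verma_gens_def by blast
  hence "baby_verma lam = quot_module (regular_module restricted_yangian)
      (restricted_proj ` lspan (p_center_gens \<union> verma_gens lam))"
    by (simp only: baby_verma_def left_ideal_gen_eq[OF p])
  moreover have "restricted_ideal \<subseteq> lspan (p_center_gens \<union> verma_gens lam)"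
    unfolding restricted_ideal_eq[OF p] by (rule lspan_mono) simp
  ultimately show ?thesis
    using presents_quot_image[OF presents_regular[OF p] lid_lspan, of "p_center_gens \<union> verma_gens lam"] by metis
qed

lemma presents_simple_module:
  assumes p: "CHAR('k::field) > 0"
    and N: "lid N" "lspan (p_center_gens \<union> verma_gens lam) \<subseteq> N" "1 \<notin> N"
    and max: "\<And>N'. lid N' \<Longrightarrow> lspan (p_center_gens \<union> verma_gens lam) \<subseteq> N' \<Longrightarrow> 1 \<notin> N' \<Longrightarrow> N' \<subseteq> N"
  shows "\<exists>f. presents (simple_module (lam :: ix \<Rightarrow> 'k fps)) f N"
proof -
  obtain f where f: "presents (baby_verma lam) f (lspan (p_center_gens \<union> verma_gens lam))"
    using presents_baby_verma[OF p] by blast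
  have "(THE S. maximal_submodule S restricted_yangian (baby_verma lam)) = f ` N"
    by (rule maximal_submodule_unique[OF f N max])
  thus ?thesis
    using presents_quot_image[OF f N(1,2)] unfolding simple_module_def by auto
qed

section \<open>Triangular decomposition of a baby Verma module\<close>

definition word :: "nat list \<Rightarrow> 'k::field yangian" where
  "word ws = prod_list (map (fps_nth f_series) ws)"

lemma word_simps: "word [] = 1" "word (r # ws) = fps_nth f_series r * word ws"
  "word (u @ v) = word u * word v"
  by (simp_all add: word_def)

text \<open>The predicate carries what is known of the words (positive letters, bounded letters,
  nonempty, of a minimal length), so that one span serves all these purposes.\<close>

inductive_set wspan :: "(nat list \<Rightarrow> bool) \<Rightarrow> 'k::field yangian set" for P where
  zero: "0 \<in> wspan P"
| step: "P ws \<Longrightarrow> x \<in> wspan P \<Longrightarrow> yangian_const c * word ws + x \<in> wspan P"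

lemma wspan_word: "P ws \<Longrightarrow> yangian_const c * word ws \<in> wspan P"
  using wspan.step[OF _ wspan.zero, of P ws c] by simp

lemma wspan_add: "x \<in> wspan P \<Longrightarrow> y \<in> wspan P \<Longrightarrow> x + y \<in> wspan P"
  by (induction x rule: wspan.induct) (auto intro: wspan.step simp: add.assoc)

lemma wspan_mono: "(\<And>ws. P ws \<Longrightarrow> Q ws) \<Longrightarrow> x \<in> wspan P \<Longrightarrow> x \<in> wspan Q"
  by (rotate_tac, induction x rule: wspan.induct) (auto intro: wspan.intros)

lemma wspan_mult:
  assumes PQ: "\<And>u v. P u \<Longrightarrow> Q v \<Longrightarrow> S (u @ v)"
  shows "x \<in> wspan P \<Longrightarrow> y \<in> wspan Q \<Longrightarrow> x * y \<in> wspan S"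
proof (induction x rule: wspan.induct)
  case (step u x c)
  have "yangian_const c * word u * y \<in> wspan S"
    using step.prems
  proof (induction y rule: wspan.induct)
    case (step v y d)
    have "yangian_const c * word u * (yangian_const d * word v) = yangian_const (c * d) * word (u @ v)"
      by (simp only: word_simps yconst(4)) (metis yconst(5) mult.assoc)
    thus ?case
      unfolding distrib_left using step PQ \<open>P u\<close> by (simp add: wspan_add wspan_word)
  qed (simp add: wspan.zero)
  thus ?case unfolding distrib_right using step by (intro wspan_add) auto
qed (simp add: wspan.zero)

lemma wspan_lid: "lid N \<Longrightarrow> (\<And>ws. P ws \<Longrightarrow> word ws \<in> N) \<Longrightarrow> x \<in> wspan P \<Longrightarrow> x \<in> N"
  by (rotate_tac 2, induction x rule: wspan.induct) (auto intro: lidD)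

context yang
begin

lemma F_comm:
  assumes "1 \<le> j" "j \<le> k"
  shows "fps_nth F k * fps_nth F j - fps_nth F j * fps_nth F k = (\<Sum>i=j..<k. fps_nth F (j + k - 1 - i) * fps_nth F i)"
  using arg_cong[OF E_comm[OF assms], of tau]
  by (simp add: tau_minus tau_simps tau_sum ftr_E[symmetric] ftr_nth)

lemma A_F:
  "fps_nth A r * fps_nth F (Suc k) = fps_nth F (Suc k) * fps_nth A r - fps_nth (ftr (ek k) * A) r"
proof -
  from arg_cong[OF A_family(1)[of k], of ftr]
  have "fps_const (fps_nth F (Suc k)) * A - A * fps_const (fps_nth F (Suc k)) = ftr (ek k) * A"
    by (simp add: ftr_minus ftr_mult ftr_t) (simp add: xk_def ftr_def tau_0 if_distrib fps_const_def ftr_E[symmetric] cong: if_cong)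
  from arg_cong[OF this, of "\<lambda>f. fps_nth f r"] show ?thesis by (simp add: algebra_simps)
qed

lemma D_F:
  "fps_nth D r * fps_nth F (Suc k) = fps_nth F (Suc k) * fps_nth D r + fps_nth (ftr (ek k) * D) r"
proof -
  have "ftr (- f) = - ftr f" for f :: "'k yangian fps" using ftr_minus[of 0 f] by (simp add: ftr_def fps_eq_iff tau_0)
  from arg_cong[OF D_family(1)[of k], of ftr] this
  have "fps_const (fps_nth F (Suc k)) * D - D * fps_const (fps_nth F (Suc k)) = - (ftr (ek k) * D)"
    by (simp add: ftr_minus ftr_mult ftr_D) (simp add: xk_def ftr_def tau_0 if_distrib fps_const_def ftr_E[symmetric] cong: if_cong)
  from arg_cong[OF this, of "\<lambda>f. fps_nth f r"] show ?thesis by (simp add: algebra_simps)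
qed

lemma ftr_ek_nth: "fps_nth (ftr (ek k)) n = (if n = 0 then 0 else fps_nth F (k + n))"
  by (simp add: ftr_nth ek_nth tau_0 ftr_E[symmetric])

end

locale verma = yang K for K :: "'k::field itself" +
  fixes lam :: "ix \<Rightarrow> 'k fps"
  assumes p: "CHAR('k) > 0" and lam0: "\<And>i. fps_nth (lam i) 0 = 1"
begin

definition J :: "'k yangian set" where "J = lspan (p_center_gens \<union> verma_gens lam)"

text \<open>The spanning half of the triangular decomposition: this set contains 1 and turns out to
  be stable under left multiplication by every generator.\<close>

definition S :: "'k yangian set" where "S = {w + j | w j. w \<in> wspan (\<lambda>ws. \<forall>r\<in>set ws. r > 0) \<and> j \<in> J}"

lemma lid_J: "lid J"
  by (simp add: J_def lid_lspan)

lemma SI: "w \<in> wspan (\<lambda>ws. \<forall>r\<in>set ws. r > 0) \<Longrightarrow> j \<in> J \<Longrightarrow> w + j \<in> S"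
  unfolding S_def by blast

lemma S_J: "j \<in> J \<Longrightarrow> j \<in> S"
  using SI[OF wspan.zero] by simp

lemma S_0: "0 \<in> S"
  by (rule S_J) (rule lidD(1)[OF lid_J])

lemma S_word: "\<forall>r\<in>set ws. r > 0 \<Longrightarrow> yangian_const c * word ws \<in> S"
  using SI[OF wspan_word[of "\<lambda>ws. \<forall>r\<in>set ws. r > 0" ws c] lidD(1)[OF lid_J]] by simp

lemma S_add:
  assumes "x \<in> S" "y \<in> S"
  shows "x + y \<in> S"
proof -
  obtain w j w' j' where *: "x = w + j" "y = w' + j'" "w \<in> wspan (\<lambda>ws. \<forall>r\<in>set ws. r > 0)"
    "w' \<in> wspan (\<lambda>ws. \<forall>r\<in>set ws. r > 0)" "j \<in> J" "j' \<in> J"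
    using assms unfolding S_def by blast
  have "x + y = (w + w') + (j + j')" by (simp add: *(1,2))
  thus ?thesis using SI[OF wspan_add[OF *(3,4)] lidD(2)[OF lid_J *(5,6)]] by simp
qed

lemma S_mult:
  assumes "\<And>ws. \<forall>r\<in>set ws. r > 0 \<Longrightarrow> g * word ws \<in> S"
    and const: "\<And>c x. x \<in> S \<Longrightarrow> yangian_const c * x \<in> S"
    and "x \<in> S"
  shows "g * x \<in> S"
proof -
  obtain w j where x: "x = w + j" "w \<in> wspan (\<lambda>ws. \<forall>r\<in>set ws. r > 0)" "j \<in> J"
    using assms(3) unfolding S_def by blast
  from x(2) have "g * w \<in> S"
  proof induction
    case (step ws x c)
    have "g * (yangian_const c * word ws) = yangian_const c * (g * word ws)"
      by (metis yconst(5) mult.assoc)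
    thus ?case unfolding distrib_left using step assms(1) const by (simp add: S_add)
  qed (simp add: S_J lidD[OF lid_J])
  thus ?thesis unfolding x(1) distrib_left
    by (rule S_add) (rule S_J[OF lidD(3)[OF lid_J x(3)]])
qed

lemma S_const: "x \<in> S \<Longrightarrow> yangian_const c * x \<in> S"
proof -
  assume "x \<in> S"
  then obtain w j where x: "x = w + j" "w \<in> wspan (\<lambda>ws. \<forall>r\<in>set ws. r > 0)" "j \<in> J"
    unfolding S_def by blast
  from x(2) have "yangian_const c * w \<in> S"
  proof induction
    case (step ws x d)
    have "yangian_const c * (yangian_const d * word ws) = yangian_const (c * d) * word ws"
      by (simp only: yconst(4) mult.assoc)
    thus ?case unfolding distrib_left using step S_word by (simp add: S_add)
  qed (simp add: S_J lidD[OF lid_J])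
  thus ?thesis unfolding x(1) distrib_left
    by (rule S_add) (rule S_J[OF lidD(3)[OF lid_J x(3)]])
qed

definition stable :: "'k yangian \<Rightarrow> bool" where
  "stable g \<longleftrightarrow> (\<forall>x\<in>S. g * x \<in> S)"

lemma stableI: "(\<And>ws. \<forall>r\<in>set ws. r > 0 \<Longrightarrow> g * word ws \<in> S) \<Longrightarrow> stable g"
  unfolding stable_def using S_mult S_const by blast

lemma stable_add: "stable g \<Longrightarrow> stable h \<Longrightarrow> stable (g + h)"
  and stable_mult: "stable g \<Longrightarrow> stable h \<Longrightarrow> stable (g * h)"
  and stable_const: "stable (yangian_const c)"
  by (auto simp: stable_def distrib_right S_add mult.assoc S_const)

lemma stable_0: "stable 0" and stable_1: "stable 1" and stable_minus: "stable g \<Longrightarrow> stable (- g)"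
  using stable_const[of 0] stable_const[of 1] stable_mult[OF stable_const[of "- 1"], of g]
  by (simp_all add: yconst(1,2) yangian_const_uminus)

lemma stable_sum: "(\<And>s. s \<in> T \<Longrightarrow> stable (f s)) \<Longrightarrow> stable (sum f T)"
  by (induction T rule: infinite_finite_induct) (auto simp: stable_0 stable_add)

lemma stable_fps_mult: "(\<And>n. stable (fps_nth f n)) \<Longrightarrow> (\<And>n. stable (fps_nth g n)) \<Longrightarrow> stable (fps_nth (f * g) n)"
  unfolding fps_mult_nth by (intro stable_sum stable_mult)

lemma word_S: "\<forall>r\<in>set ws. r > 0 \<Longrightarrow> word ws \<in> S"
  using S_word[of ws 1] by (simp add: yconst(1))

lemma stable_F: "stable (fps_nth F r)"
proof (cases "r = 0")
  case False
  show ?thesis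
  proof (rule stableI)
    fix ws :: "nat list" assume "\<forall>r\<in>set ws. r > 0"
    thus "fps_nth F r * word ws \<in> S" using word_S[of "r # ws"] False by (simp add: word_simps)
  qed
qed (simp add: drinfeld_nth_0 stable_0)

lemma ftr_ek_stable: "stable (fps_nth (ftr (ek k)) n)"
  by (simp add: ftr_ek_nth stable_F stable_0)

lemma J_weight:
  assumes "r > 0"
  shows "fps_nth E r \<in> J" "fps_nth (d_series i) r - yangian_const (fps_nth (lam i) r) \<in> J"
  using assms lspan_base[of "p_center_gens \<union> verma_gens lam"] unfolding J_def verma_gens_def by blast+

lemma J_weight': "fps_nth (d_series i) r - yangian_const (fps_nth (lam i) r) \<in> J"
proof (cases "r = 0")
  case True
  have "fps_nth (d_series i) 0 = yangian_const (fps_nth (lam i) 0)"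
    by (simp add: drinfeld_nth_0 lam0 yconst(1))
  thus ?thesis using lidD(1)[OF lid_J] True by simp
qed (simp add: J_weight)

lemma d_S: "fps_nth (d_series i) r \<in> S"
proof -
  have "yangian_const (fps_nth (lam i) r) \<in> S" using S_word[of "[]"] by (simp add: word_simps)
  from S_add[OF this S_J[OF J_weight'[of i r]]] show ?thesis by simp
qed

text \<open>Moving \<open>q\<close> past the first letter leaves that letter or another one in front
  of a coefficient of \<open>q\<close> applied to a shorter word, so the induction treats all
  coefficients of \<open>q\<close> together. The factor \<open>s\<close> is -1 for d_1 and 1 for
  d_2.\<close>

lemma cartan_stable:
  assumes q: "\<And>r. fps_nth q r \<in> S"
    and rel: "\<And>r k. fps_nth q r * fps_nth F (Suc k)
      = fps_nth F (Suc k) * fps_nth q r + s * fps_nth (ftr (ek k) * q) r"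
    and s: "stable s"
  shows "stable (fps_nth q r)"
proof (rule stableI)
  fix ws :: "nat list" assume "\<forall>r\<in>set ws. r > 0"
  thus "fps_nth q r * word ws \<in> S"
  proof (induction ws arbitrary: r)
    case Nil
    thus ?case using q by (simp add: word_simps)
  next
    case (Cons a ws)
    then obtain k where a: "a = Suc k" by (cases a) auto
    have "fps_nth q r * word (a # ws) = (fps_nth q r * fps_nth F (Suc k)) * word ws"
      by (simp add: word_simps a mult.assoc)
    also have "\<dots> = fps_nth F (Suc k) * (fps_nth q r * word ws)
       + s * (\<Sum>t=0..r. fps_nth (ftr (ek k)) t * (fps_nth q (r - t) * word ws))"
      unfolding rel fps_mult_nth by (simp add: distrib_right sum_distrib_right mult.assoc)
    also have "\<dots> \<in> S"
    proof (rule S_add)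
      show "fps_nth F (Suc k) * (fps_nth q r * word ws) \<in> S"
        using stable_F Cons unfolding stable_def by auto
      have "(\<Sum>t\<in>T. fps_nth (ftr (ek k)) t * (fps_nth q (r - t) * word ws)) \<in> S" for T
        using ftr_ek_stable Cons unfolding stable_def
        by (induction T rule: infinite_finite_induct) (auto intro!: S_add S_0)
      thus "s * (\<Sum>t=0..r. fps_nth (ftr (ek k)) t * (fps_nth q (r - t) * word ws)) \<in> S"
        using s unfolding stable_def by blast
    qed
    finally show ?case .
  qed
qed

lemma stable_A: "stable (fps_nth A r)"
  using d_S[of I1] by (intro cartan_stable[where s = "- 1"]) (auto simp: d_series.simps(1) A_F stable_minus stable_1)

lemma stable_D: "stable (fps_nth D r)"
  using d_S[of I2] by (intro cartan_stable[where s = 1]) (auto simp: D_F stable_1)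

lemma stable_d1_inv: "stable (fps_nth d1_inv r)"
proof (induction r rule: less_induct)
  case (less r)
  show ?case
  proof (cases "r = 0")
    case False
    have "fps_nth d1_inv r + (\<Sum>t=1..r. fps_nth A t * fps_nth d1_inv (r - t)) = fps_nth (A * d1_inv) r"
      unfolding fps_mult_nth by (simp add: sum.atLeast_Suc_atMost[of 0 r] AD_nth_0)
    also have "\<dots> = 0" using False by (simp add: A_inv)
    finally have "fps_nth d1_inv r = - (\<Sum>t=1..r. fps_nth A t * fps_nth d1_inv (r - t))"
      by (simp add: eq_neg_iff_add_eq_0)
    moreover have "stable (- (\<Sum>t=1..r. fps_nth A t * fps_nth d1_inv (r - t)))"
      using less False by (intro stable_minus stable_sum stable_mult stable_A) auto
    ultimately show ?thesis by simp
  qed (simp add: d1_inv_def stable_1)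
qed

lemma stable_H: "stable (fps_nth H r)"
  unfolding H_def by (intro stable_fps_mult stable_d1_inv stable_D)

lemma stable_E: "stable (fps_nth E r)"
proof (cases "r = 0")
  case False
  show ?thesis
  proof (rule stableI)
    fix ws :: "nat list" assume "\<forall>r\<in>set ws. r > 0"
    thus "fps_nth E r * word ws \<in> S"
    proof (induction ws)
      case Nil
      show ?case using J_weight(1) False by (simp add: word_simps S_J)
    next
      case (Cons a ws)
      have "fps_nth E r * word (a # ws) = (fps_nth E r * fps_nth F a) * word ws"
        by (simp add: word_simps mult.assoc)
      also have "fps_nth E r * fps_nth F a = fps_nth F a * fps_nth E r + - fps_nth H (r + a - 1)"
        using E_F_comm[of r a] Cons.prems False by (simp add: algebra_simps)
      also have "\<dots> * word ws = fps_nth F a * (fps_nth E r * word ws) + - fps_nth H (r + a - 1) * word ws"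
        by (simp only: distrib_right mult.assoc)
      also have "\<dots> \<in> S"
        using Cons stable_F stable_minus[OF stable_H] word_S[of ws] unfolding stable_def
        by (intro S_add) auto
      finally show ?case .
    qed
  qed
qed (simp add: drinfeld_nth_0 stable_0)

lemma S_UNIV: "y \<in> S"
proof -
  have "stable (fps_nth B r)" "stable (fps_nth C r)" "stable (fps_nth G r)" for r
    unfolding gauss_BCG fps_add_nth
    by (intro stable_add stable_fps_mult stable_A stable_E stable_F stable_D)+
  hence t: "stable (t_gen i j r)" for i j r
    using stable_A[of r] by (cases i; cases j) (auto simp: t_series_def)
  have "stable y"
    by (induction y rule: yangian_induct) (simp_all add: stable_const t stable_add stable_mult)
  thus ?thesis using word_S[of "[]"] by (auto simp: stable_def word_simps)
qed

end

section \<open>The unique maximal submodule\<close>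

lemma lspan_rmult_word:
  assumes "\<And>g. g \<in> U \<Longrightarrow> central g" "x \<in> lspan U"
  shows "z * x * z' \<in> lspan U"
  by (intro lspan_central_rmult lspan_lmult assms)

context verma
begin

abbreviation I :: "'k yangian set" where "I \<equiv> lspan p_center_gens"

lemma I_two_sided: "x \<in> I \<Longrightarrow> z * x * z' \<in> I"
  using lspan_rmult_word p_center_gens_central[OF p] by blast

lemma I_J: "I \<subseteq> J"
  unfolding J_def by (rule lspan_mono) simp

text \<open>
  Modulo terms with a smaller sum of indices, the letters of a word commute, so a long word can be
  rearranged to start with a \<open>p\<close>-th power.
\<close>

lemma long_word_in_I:
  assumes "set ws \<subseteq> {1..R}" "length ws > R * (CHAR('k) - 1)"
  shows "word ws \<in> I"
  using assms
proof (induction "sum_list ws" arbitrary: ws rule: less_induct)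
  case less
  define Q where "Q ws' \<longleftrightarrow> mset ws' = mset ws" for ws'
  have Qset: "set ws' \<subseteq> {1..R}" "length ws' > R * (CHAR('k) - 1)" "sum_list ws' = sum_list ws"
    if "Q ws'" for ws'
    using that less.prems unfolding Q_def
    by (auto dest: mset_eq_setD mset_eq_length) (metis sum_mset_sum_list)
  have swap_le: "word (u @ [k, j] @ v) - word (u @ [j, k] @ v) \<in> I" if jk: "j \<le> k" "Q (u @ [k, j] @ v)" for u v j k
  proof -
    have r: "1 \<le> j" "k \<le> R" using Qset(1)[OF jk(2)] by auto
    have "word (u @ [k, j] @ v) - word (u @ [j, k] @ v)
        = word u * (fps_nth F k * fps_nth F j - fps_nth F j * fps_nth F k) * word v"
      by (simp add: word_simps right_diff_distrib left_diff_distrib mult.assoc)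
    also have "\<dots> = (\<Sum>i=j..<k. word (u @ [j + k - 1 - i, i] @ v))"
      unfolding F_comm[OF r(1) jk(1)] sum_distrib_left sum_distrib_right
      by (simp add: word_simps mult.assoc)
    also have "\<dots> \<in> I"
    proof (rule lid_sum[OF lid_lspan])
      fix i assume i: "i \<in> {j..<k}"
      show "word (u @ [j + k - 1 - i, i] @ v) \<in> I"
      proof (rule less.hyps)
        show "sum_list (u @ [j + k - 1 - i, i] @ v) < sum_list ws"
          using Qset(3)[OF jk(2)] i by auto
        show "set (u @ [j + k - 1 - i, i] @ v) \<subseteq> {1..R}"
          using Qset(1)[OF jk(2)] i r by auto
        show "length (u @ [j + k - 1 - i, i] @ v) > R * (CHAR('k) - 1)"
          using Qset(2)[OF jk(2)] by simp
      qed
    qed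
    finally show ?thesis .
  qed
  have swap: "word (u @ [k, j] @ v) - word (u @ [j, k] @ v) \<in> I" if Q: "Q (u @ [k, j] @ v)" for u v j k
  proof (cases "j \<le> k")
    case False
    have "Q (u @ [j, k] @ v)" using Q by (simp add: Q_def add_mset_commute)
    from lidD(4)[OF lid_lspan swap_le[OF _ this]] False show ?thesis by simp
  qed (rule swap_le[OF _ Q])
  have front: "word (u @ x # v) - word (x # u @ v) \<in> I" if "Q (u @ x # v)" for u x v
    using that
  proof (induction u arbitrary: v rule: rev_induct)
    case (snoc y u)
    have "Q (u @ x # (y # v))" using snoc.prems by (simp add: Q_def add_mset_commute)
    from lidD(2)[OF lid_lspan swap[of u y x v] snoc.IH[OF this]] snoc.prems show ?case by simp
  qed (simp add: lspan.zero)
  \<comment> \<open>Pigeonhole: this is the origin of the length bound R (p - 1).\<close>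
  have "\<exists>k\<in>{1..R}. count_list ws k \<ge> CHAR('k)"
  proof (rule ccontr)
    assume *: "\<not> ?thesis"
    have "(\<Sum>k\<in>{1..R}. count_list ws k) \<le> (\<Sum>k\<in>{1..R}. CHAR('k) - 1)"
    proof (rule sum_mono)
      fix k assume "k \<in> {1..R}"
      hence "count_list ws k < CHAR('k)" using * by force
      thus "count_list ws k \<le> CHAR('k) - 1" by simp
    qed
    thus False using sum_count_set[OF less.prems(1)] less.prems(2) by simp
  qed
  then obtain k where k: "k \<in> {1..R}" "count_list ws k \<ge> CHAR('k)" by blast
  have "\<exists>rest. Q (replicate n k @ rest) \<and> word ws - word (replicate n k @ rest) \<in> I"
    if "n \<le> count_list ws k" for n
    using that
  proof (induction n)
    case 0
    show ?case by (rule exI[of _ ws]) (simp add: Q_def lspan.zero)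
  next
    case (Suc n)
    then obtain rest where rest: "Q (replicate n k @ rest)" "word ws - word (replicate n k @ rest) \<in> I"
      by auto
    have "count_list ws k = n + count_list rest k"
      using arg_cong[OF rest(1)[unfolded Q_def], of "\<lambda>M. count M k"] by (simp add: count_mset)
    hence "k \<in> set rest" using Suc.prems by (metis Suc_n_not_le_n add_0_right count_notin)
    then obtain u v where uv: "rest = u @ k # v" by (auto simp: in_set_conv_decomp)
    have Q1: "Q ((replicate n k @ u) @ k # v)" using rest(1) uv by simp
    have "word ws - word (k # (replicate n k @ u) @ v) \<in> I"
      using lidD(2)[OF lid_lspan rest(2) front[OF Q1]] uv by simp
    moreover have "Q (k # (replicate n k @ u) @ v)" using Q1 by (simp add: Q_def)
    ultimately show ?case by (intro exI[of _ "u @ v"]) simp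
  qed
  from this[OF k(2)] obtain rest where rest: "word ws - word (replicate CHAR('k) k @ rest) \<in> I" by blast
  have "word (replicate n k) = fps_nth F k ^ n" for n
    by (induction n) (simp_all add: word_simps)
  moreover have "fps_nth F k ^ CHAR('k) \<in> I"
    using k(1) lspan_base[of p_center_gens] unfolding p_center_gens_def by force
  ultimately have "word (replicate CHAR('k) k @ rest) \<in> I"
    using I_two_sided[of _ 1] by (simp add: word_simps(3))
  from lidD(2)[OF lid_lspan rest this] show ?case by simp
qed

lemma word_power:
  assumes x: "x \<in> wspan (\<lambda>ws. set ws \<subseteq> {1..R} \<and> ws \<noteq> [])"
  shows "x ^ m \<in> wspan (\<lambda>ws. set ws \<subseteq> {1..R} \<and> length ws \<ge> m)"
proof (induction m)
  case 0
  show ?case using wspan_word[of "\<lambda>ws. set ws \<subseteq> {1..R} \<and> length ws \<ge> 0" "[]" 1]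
    by (simp add: word_simps yconst(1))
next
  case (Suc m)
  have "length u + length v \<ge> Suc m" if "u \<noteq> []" "length v \<ge> m" for u v :: "nat list"
    using that by (cases u) auto
  thus ?case unfolding power_Suc
    by (intro wspan_mult[OF _ x Suc]) auto
qed

lemma word_nilpotent:
  assumes "x \<in> wspan (\<lambda>ws. set ws \<subseteq> {1..R} \<and> ws \<noteq> [])"
  shows "x ^ Suc (R * (CHAR('k) - 1)) \<in> I"
  by (rule wspan_lid[OF lid_lspan _ word_power[OF assms]]) (rule long_word_in_I, auto)

lemma wspan_split:
  assumes "x \<in> wspan (\<lambda>ws. \<forall>r\<in>set ws. r > 0)"
  obtains c n R where "x = yangian_const c + n" "n \<in> wspan (\<lambda>ws. set ws \<subseteq> {1..R} \<and> ws \<noteq> [])"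
proof -
  from assms have "\<exists>c n R. x = yangian_const c + n \<and> n \<in> wspan (\<lambda>ws. set ws \<subseteq> {1..R} \<and> ws \<noteq> [])"
  proof induction
    case zero
    show ?case by (rule exI[of _ 0], rule exI[of _ 0]) (simp add: yconst(2) wspan.zero)
  next
    case (step ws x d)
    then obtain c n R where x: "x = yangian_const c + n" "n \<in> wspan (\<lambda>ws. set ws \<subseteq> {1..R} \<and> ws \<noteq> [])"
      by blast
    show ?case
    proof (cases "ws = []")
      case True
      have "yangian_const d * word ws + x = yangian_const (d + c) + n"
        unfolding True x(1) by (simp add: word_simps yconst(3))
      thus ?thesis using x(2) by blast
    next
      case False
      define R' where "R' = max R (sum_list ws)"
      have "set ws \<subseteq> {1..R'}"
        using step(1) member_le_sum_list[of _ ws] unfolding R'_def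
        by (auto simp: Suc_le_eq le_max_iff_disj)
      hence 1: "yangian_const d * word ws \<in> wspan (\<lambda>ws. set ws \<subseteq> {1..R'} \<and> ws \<noteq> [])"
        using False by (intro wspan_word) simp
      have 2: "n \<in> wspan (\<lambda>ws. set ws \<subseteq> {1..R'} \<and> ws \<noteq> [])"
        by (rule wspan_mono[OF _ x(2)]) (auto simp: R'_def le_max_iff_disj subset_iff)
      have "yangian_const d * word ws + x = yangian_const c + (yangian_const d * word ws + n)"
        by (simp add: x(1) algebra_simps)
      thus ?thesis using wspan_add[OF 1 2] by blast
    qed
  qed
  thus ?thesis using that by blast
qed

section \<open>The subspace F and the largest left ideal inside it\<close>

inductive_set Kf :: "'k yangian set" where
  zero: "0 \<in> Kf"
| step: "r > 0 \<Longrightarrow> x \<in> Kf \<Longrightarrow> fps_nth F r * y + x \<in> Kf"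

lemma Kf_base: "r > 0 \<Longrightarrow> fps_nth F r * y \<in> Kf"
  using Kf.step[OF _ Kf.zero, of r y] by simp

lemma Kf_add: "x \<in> Kf \<Longrightarrow> x' \<in> Kf \<Longrightarrow> x + x' \<in> Kf"
  by (induction x rule: Kf.induct) (auto intro: Kf.step simp: add.assoc)

lemma Kf_word: "x \<in> wspan (\<lambda>ws. set ws \<subseteq> {1..R} \<and> ws \<noteq> []) \<Longrightarrow> x \<in> Kf"
proof (induction x rule: wspan.induct)
  case (step ws x c)
  then obtain r us where ws: "ws = r # us" "r > 0" by (cases ws) auto
  have "yangian_const c * word ws = fps_nth F r * (yangian_const c * word us)"
    unfolding ws word_simps using yconst(5)[of "fps_nth F r" c] by (metis mult.assoc)
  thus ?case using step Kf_base[OF ws(2)] by (simp add: Kf_add)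
qed (rule Kf.zero)

definition Fv :: "'k yangian set" where
  "Fv = {k + j | k j. k \<in> Kf \<and> j \<in> J}"

lemma FvI: "k \<in> Kf \<Longrightarrow> j \<in> J \<Longrightarrow> k + j \<in> Fv"
  unfolding Fv_def by blast

lemma J_Fv: "J \<subseteq> Fv"
  using FvI[OF Kf.zero] by auto

lemma Fv_add: "x \<in> Fv \<Longrightarrow> y \<in> Fv \<Longrightarrow> x + y \<in> Fv"
proof -
  assume "x \<in> Fv" "y \<in> Fv"
  then obtain k j k' j' where *: "x = k + j" "y = k' + j'" "k \<in> Kf" "j \<in> J" "k' \<in> Kf" "j' \<in> J"
    unfolding Fv_def by blast
  have "x + y = (k + k') + (j + j')" by (simp add: *(1,2))
  thus ?thesis using FvI[OF Kf_add[OF *(3,5)] lidD(2)[OF lid_J *(4,6)]] by simp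
qed

text \<open>A nonempty word begins with a coefficient of f and lies in the right ideal
  \<open>Kf\<close>, so \<open>Fv\<close> has codimension at most one.\<close>

lemma scalar_mod_Fv: "\<exists>c. y - yangian_const c \<in> Fv"
proof -
  obtain w j where y: "y = w + j" "w \<in> wspan (\<lambda>ws. \<forall>r\<in>set ws. r > 0)" "j \<in> J"
    using S_UNIV[of y] unfolding S_def by blast
  from y(2) obtain c n R where w: "w = yangian_const c + n" "n \<in> wspan (\<lambda>ws. set ws \<subseteq> {1..R} \<and> ws \<noteq> [])"
    by (rule wspan_split)
  have "y - yangian_const c = n + j" by (simp add: y w)
  thus ?thesis using FvI[OF Kf_word[OF w(2)] y(3)] by metis
qed

lemma geometric_left: "(\<Sum>i<m. x ^ i) * (1 - x) = 1 - (x :: 'a::ring_1) ^ m"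
proof (induction m)
  case (Suc m)
  have "(\<Sum>i<Suc m. x ^ i) * (1 - x) = (\<Sum>i<m. x ^ i) * (1 - x) + x ^ m * (1 - x)"
    by (simp add: distrib_right)
  thus ?case unfolding Suc by (simp add: right_diff_distrib power_commutes)
qed simp

text \<open>After scaling and subtraction of a part in \<open>J\<close>, an element with nonzero
  constant term has the form 1 - x with x nilpotent modulo the p-center. The geometric series then
  puts 1 into \<open>N\<close>.\<close>

lemma proper_in_Fv:
  assumes N: "lid N" "J \<subseteq> N" "1 \<notin> N"
  shows "N \<subseteq> Fv"
proof
  fix y assume "y \<in> N"
  obtain w j where y: "y = w + j" "w \<in> wspan (\<lambda>ws. \<forall>r\<in>set ws. r > 0)" "j \<in> J"
    using S_UNIV[of y] unfolding S_def by blast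
  from y(2) obtain c n R where w: "w = yangian_const c + n" "n \<in> wspan (\<lambda>ws. set ws \<subseteq> {1..R} \<and> ws \<noteq> [])"
    by (rule wspan_split)
  have "c = 0"
  proof (rule ccontr)
    assume c: "c \<noteq> 0"
    define x where "x = yangian_const (- inverse c) * n"
    have "x \<in> wspan (\<lambda>ws. set ws \<subseteq> {1..R} \<and> ws \<noteq> [])"
      unfolding x_def using wspan_mult[OF _ wspan_word[of "\<lambda>ws. ws = []" "[]" "- inverse c"] w(2)]
      by (simp add: word_simps)
    from word_nilpotent[OF this] I_J N(2) obtain m where m: "x ^ m \<in> N" by blast
    have "w \<in> N" using lidD(5)[OF N(1) \<open>y \<in> N\<close>, of j] y N(2) by auto
    hence "yangian_const (inverse c) * w \<in> N" by (rule lidD(3)[OF N(1)])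
    also have "yangian_const (inverse c) * w = 1 - x"
      unfolding w(1) x_def distrib_left yconst(4)[symmetric] yangian_const_uminus
      using c by (simp add: yconst(1))
    finally have "(\<Sum>i<m. x ^ i) * (1 - x) \<in> N" by (rule lidD(3)[OF N(1)])
    hence "1 - x ^ m \<in> N" by (simp only: geometric_left)
    from lidD(2)[OF N(1) this m] N(3) show False by simp
  qed
  hence "y = n + j" by (simp add: y(1) w(1) yconst(2))
  thus "y \<in> Fv" using FvI[OF Kf_word[OF w(2)] y(3)] by simp
qed

text \<open>As the sum of a right and a left ideal, \<open>Fv\<close> need not be stable under
  multiplication; this is the largest left ideal contained in it.\<close>

definition Nmax :: "'k yangian set" where
  "Nmax = {y. \<forall>z. z * y \<in> Fv}"

lemma lid_Nmax: "lid Nmax"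
  unfolding lid_def Nmax_def
proof (intro conjI ballI allI CollectI)
  show "z * 0 \<in> Fv" for z using J_Fv lidD(1)[OF lid_J] by auto
  show "z * (x + y) \<in> Fv" if "x \<in> {y. \<forall>z. z * y \<in> Fv}" "y \<in> {y. \<forall>z. z * y \<in> Fv}" for x y z
    using that by (auto simp: distrib_left intro: Fv_add)
  show "z * (y * x) \<in> Fv" if "x \<in> {y. \<forall>z. z * y \<in> Fv}" for x y z
    using that by (simp add: mult.assoc[symmetric])
qed

lemma presents_simple:
  assumes "1 \<notin> Fv"
  shows "\<exists>f. presents (simple_module lam) f Nmax"
proof (rule presents_simple_module[OF p lid_Nmax])
  show "lspan (p_center_gens \<union> verma_gens lam) \<subseteq> Nmax"
    unfolding Nmax_def J_def[symmetric] using lidD(3)[OF lid_J] J_Fv by blast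
  show "1 \<notin> Nmax" unfolding Nmax_def using assms by (auto intro: exI[of _ 1])
  show "N' \<subseteq> Nmax" if "lid N'" "lspan (p_center_gens \<union> verma_gens lam) \<subseteq> N'" "1 \<notin> N'" for N'
    using proper_in_Fv[of N'] lidD(3)[OF that(1)] that unfolding Nmax_def J_def[symmetric] by blast
qed

section \<open>Reduction to finitely many weight conditions\<close>

definition vgens :: "nat \<Rightarrow> 'k yangian set" where
  "vgens N = {fps_nth e_series r | r. r > 0}
     \<union> {fps_nth (d_series i) r - yangian_const (fps_nth (lam i) r) | i r. 0 < r \<and> r \<le> N}"

lemma lspan_vgens_mono: "N \<le> N' \<Longrightarrow> lspan (vgens N) \<subseteq> lspan (vgens N')"
  unfolding vgens_def by (rule lspan_mono, rule Un_mono, simp, blast intro: order_trans)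

lemma lspan_verma_gens: "x \<in> lspan (verma_gens lam) \<Longrightarrow> \<exists>N. x \<in> lspan (vgens N)"
proof (induction x rule: lspan.induct)
  case (step g x y)
  then obtain N where N: "x \<in> lspan (vgens N)" by blast
  obtain r where "g \<in> vgens r" using step(1) unfolding verma_gens_def vgens_def by fastforce
  hence "y * g \<in> lspan (vgens r)" by (rule lspan_gen)
  with N lspan_vgens_mono[of N "max N r"] lspan_vgens_mono[of r "max N r"]
  have "y * g + x \<in> lspan (vgens (max N r))" by (intro lspan_add) auto
  thus ?case ..
qed (auto intro: lspan.zero)

text \<open>The coefficients of \<open>f\<close> act on the highest weight vector by those of
  \<open>m\<close>. The p-center generators are left out on purpose: \<open>wt_b\<close> has to
  derive from the weight conditions alone that the b-coefficients act by zero.\<close>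

definition wt :: "'k yangian fps \<Rightarrow> 'k fps \<Rightarrow> bool" where
  "wt f m \<longleftrightarrow> (\<forall>n. fps_nth f n - yangian_const (fps_nth m n) \<in> lspan (verma_gens lam))"

lemma wt_mult: "wt f m \<Longrightarrow> wt g m' \<Longrightarrow> wt (f * g) (m * m')"
proof (unfold wt_def, intro allI)
  fix n
  assume f: "\<forall>n. fps_nth f n - yangian_const (fps_nth m n) \<in> lspan (verma_gens lam)"
    and g: "\<forall>n. fps_nth g n - yangian_const (fps_nth m' n) \<in> lspan (verma_gens lam)"
  let ?c = yangian_const
  have cs: "?c (sum h T) = (\<Sum>t\<in>T. ?c (h t))" for h :: "nat \<Rightarrow> 'k" and T
    by (induction T rule: infinite_finite_induct) (simp_all add: yconst(2,3))
  have "fps_nth (f * g) n - ?c (fps_nth (m * m') n)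
    = (\<Sum>t=0..n. fps_nth f t * (fps_nth g (n - t) - ?c (fps_nth m' (n - t)))
        + ?c (fps_nth m' (n - t)) * (fps_nth f t - ?c (fps_nth m t)))"
    unfolding fps_mult_nth cs sum_subtractf[symmetric]
  proof (rule sum.cong[OF refl])
    fix t
    have "?c (fps_nth m' (n - t)) * ?c (fps_nth m t) = ?c (fps_nth m t * fps_nth m' (n - t))"
      by (simp only: yconst(4)[symmetric] mult.commute)
    thus "fps_nth f t * fps_nth g (n - t) - ?c (fps_nth m t * fps_nth m' (n - t))
      = fps_nth f t * (fps_nth g (n - t) - ?c (fps_nth m' (n - t)))
        + ?c (fps_nth m' (n - t)) * (fps_nth f t - ?c (fps_nth m t))"
      by (simp add: right_diff_distrib yconst(5)[of "fps_nth f t"])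
  qed
  also have "\<dots> \<in> lspan (verma_gens lam)"
    using f g by (intro lid_sum[OF lid_lspan] lspan_add lspan_lmult) auto
  finally show "fps_nth (f * g) n - ?c (fps_nth (m * m') n) \<in> lspan (verma_gens lam)" .
qed

lemma xi_pow_int: "fps_nth (xi s ^ i :: 'a::ring_1 fps) n = of_int (fps_nth (xi s ^ i :: int fps) n)"
proof (induction i arbitrary: n)
  case 0
  show ?case by (cases n) auto
next
  case (Suc i)
  have "fps_nth (xi s :: 'a fps) n = of_int (fps_nth (xi s :: int fps) n)" for n
    by (cases n) (auto simp: xi_def geom_def)
  thus ?case by (simp add: fps_mult_nth Suc)
qed

lemma yangian_const_of_int: "yangian_const (of_int n) = (of_int n :: 'k yangian)"
  by (cases n) (simp_all add: yangian_const_of_nat yangian_const_uminus yangian_const_minus yconst(1-4))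

lemma wt_sh: "wt f m \<Longrightarrow> wt (sh s f) (sh s m)"
proof (unfold wt_def, intro allI)
  fix n
  assume f: "\<forall>n. fps_nth f n - yangian_const (fps_nth m n) \<in> lspan (verma_gens lam)"
  let ?c = yangian_const
  have cs: "?c (sum h T) = (\<Sum>t\<in>T. ?c (h t))" for h :: "nat \<Rightarrow> 'k" and T
    by (induction T rule: infinite_finite_induct) (simp_all add: yconst(2,3))
  have "fps_nth (sh s f) n - ?c (fps_nth (sh s m) n)
    = (\<Sum>i=0..n. of_int (fps_nth (xi s ^ i :: int fps) n) * (fps_nth f i - ?c (fps_nth m i)))"
    unfolding sh_def fps_compose_nth cs sum_subtractf[symmetric]
  proof (rule sum.cong[OF refl])
    fix i
    define z where "z = fps_nth (xi s ^ i :: int fps) n"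
    have z: "fps_nth (xi s ^ i :: 'k yangian fps) n = of_int z" "fps_nth (xi s ^ i :: 'k fps) n = of_int z"
      unfolding z_def by (rule xi_pow_int)+
    show "fps_nth f i * fps_nth (xi s ^ i) n - ?c (fps_nth m i * fps_nth (xi s ^ i) n)
      = of_int z * (fps_nth f i - ?c (fps_nth m i))"
      unfolding z yconst(4) yangian_const_of_int right_diff_distrib
        of_int_central[of "fps_nth f i"] of_int_central[of "?c (fps_nth m i)"] ..
  qed
  also have "\<dots> \<in> lspan (verma_gens lam)"
    using f by (intro lid_sum[OF lid_lspan] lspan_lmult) auto
  finally show "fps_nth (sh s f) n - ?c (fps_nth (sh s m) n) \<in> lspan (verma_gens lam)" .
qed

lemma wt_d: "wt (d_series i) (lam i)"
  unfolding wt_def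
proof
  fix n
  show "fps_nth (d_series i) n - yangian_const (fps_nth (lam i) n) \<in> lspan (verma_gens lam)"
  proof (cases "n = 0")
    case True
    thus ?thesis by (simp add: drinfeld_nth_0 lam0 yconst(1) lspan.zero)
  next
    case False
    thus ?thesis using lspan_base[of "verma_gens lam"] unfolding verma_gens_def by blast
  qed
qed

lemma wt_b: "wt (b_series i) (u_shift_prod CHAR('k) (lam i))"
proof -
  have "wt (prod_list (map (\<lambda>c. sh (int c) (d_series i)) xs)) (prod_list (map (\<lambda>c. sh (int c) (lam i)) xs))" for xs
  proof (induction xs)
    case Nil
    show ?case by (auto simp: wt_def yconst(1,2) lspan.zero)
  qed (simp add: wt_mult wt_sh wt_d)
  thus ?thesis by (simp add: b_series_def u_shift_prod_def u_shift_eq_sh)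
qed

text \<open>Here the p-center disappears. A power of an e-coefficient ends in e, a b-coefficient
  acts by a coefficient of the norm of the weight, which is 1 by restrictedness, and a power of an
  f-coefficient is central and can be moved to the front of any multiple, into the right
  ideal.\<close>

lemma Fv_bounded:
  assumes res: "\<And>i. restricted_series (lam i)" and x: "x \<in> Fv"
  shows "\<exists>N k j. x = k + j \<and> k \<in> Kf \<and> j \<in> lspan (vgens N)"
proof -
  let ?L = "lspan (verma_gens lam)"
  have ctr: "y * g \<in> Kf \<or> y * g \<in> ?L" if g: "g \<in> p_center_gens \<union> verma_gens lam" for y g
  proof -
    obtain q where q: "CHAR('k) = Suc q" using p by (cases "CHAR('k)") auto
    from g consider i r where "g = fps_nth (b_series i) (r * CHAR('k))" "r > 0"
      | r where "g = fps_nth E r ^ CHAR('k)" "r > 0" | r where "g = fps_nth F r ^ CHAR('k)" "r > 0"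
      | "g \<in> verma_gens lam"
      unfolding p_center_gens_def by (elim UnE CollectE exE conjE)
    thus ?thesis
    proof cases
      case (1 i r)
      have "g - yangian_const (fps_nth (u_shift_prod CHAR('k) (lam i)) (r * CHAR('k))) \<in> ?L"
        using wt_b[of i] unfolding 1(1) wt_def by blast
      hence "g \<in> ?L" using res[of i] 1(2) p by (simp add: restricted_series_def yconst(2))
      thus ?thesis by (simp add: lspan_lmult)
    next
      case (2 r)
      have "fps_nth E r \<in> ?L" using 2(2) lspan_base[of "verma_gens lam"] unfolding verma_gens_def by blast
      thus ?thesis unfolding 2(1) q power_Suc2 by (simp add: lspan_lmult)
    next
      case (3 r)
      have "g \<in> p_center_gens" unfolding 3(1) p_center_gens_def using 3(2) by blast
      hence "y * g = g * y" using p_center_gens_central[OF p] unfolding central_def by metis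
      also have "\<dots> = fps_nth F r * (fps_nth F r ^ q * y)" unfolding 3(1) q power_Suc mult.assoc ..
      finally show ?thesis using Kf_base[OF 3(2)] by simp
    next
      case 4
      thus ?thesis using lspan_gen by blast
    qed
  qed
  have "\<exists>k j. x = k + j \<and> k \<in> Kf \<and> j \<in> ?L" if "x \<in> J" for x
    using that unfolding J_def
  proof induction
    case zero
    show ?case using Kf.zero lspan.zero by force
  next
    case (step g x y)
    then obtain k j where x: "x = k + j" "k \<in> Kf" "j \<in> ?L" by blast
    from ctr[OF step(1)] show ?case
    proof
      assume "y * g \<in> Kf"
      thus ?thesis using Kf_add x by (metis add.assoc)
    next
      assume "y * g \<in> ?L"
      hence "y * g + j \<in> ?L" by (rule lspan_add) (rule x)
      moreover have "y * g + x = k + (y * g + j)" by (simp add: x(1) algebra_simps)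
      ultimately show ?thesis using x(2) by blast
    qed
  qed
  moreover obtain k j where kj: "x = k + j" "k \<in> Kf" "j \<in> J" using x unfolding Fv_def by blast
  ultimately obtain k' j' where j': "j = k' + j'" "k' \<in> Kf" "j' \<in> ?L" by blast
  obtain N where "j' \<in> lspan (vgens N)" using lspan_verma_gens[OF j'(3)] by blast
  moreover have "x = (k + k') + j'" by (simp add: kj(1) j'(1))
  ultimately show ?thesis using Kf_add[OF kj(2) j'(2)] by blast
qed

end

section \<open>Tensor products of evaluation modules\<close>

text \<open>
  Operators on functions of infinitely many occupation numbers.  Only finitely many sites are ever
  used; each carries an evaluation module of gl(2) with basis vectors \<open>x\<^sub>0, x\<^sub>1, \<dots>\<close>.
\<close>

typedef (overloaded) 'k vop =
  "{T :: ((nat \<Rightarrow> nat) \<Rightarrow> 'k::field) \<Rightarrow> (nat \<Rightarrow> nat) \<Rightarrow> 'k.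
     (\<forall>x y. T (\<lambda>n. x n + y n) = (\<lambda>n. T x n + T y n)) \<and> (\<forall>c x. T (\<lambda>n. c * x n) = (\<lambda>n. c * T x n))}"
  morphisms app Vop
  by (rule exI[of _ id]) simp

setup_lifting type_definition_vop

lemma app_scale: "app T (\<lambda>n. c * x n) = (\<lambda>n. c * app T x n)"
  using app[of T] by auto

lemma app_zero: "app T (\<lambda>n. 0) = (\<lambda>n. 0)"
  using app_scale[of T 0 "\<lambda>n. 0"] by simp

instantiation vop :: (field) ring_1
begin
lift_definition zero_vop :: "'a vop" is "\<lambda>x n. 0" by simp
lift_definition one_vop :: "'a vop" is "\<lambda>x. x" by simp
lift_definition plus_vop :: "'a vop \<Rightarrow> 'a vop \<Rightarrow> 'a vop" is "\<lambda>S T x n. S x n + T x n"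
  by (auto simp: fun_eq_iff algebra_simps)
lift_definition minus_vop :: "'a vop \<Rightarrow> 'a vop \<Rightarrow> 'a vop" is "\<lambda>S T x n. S x n - T x n"
  by (auto simp: fun_eq_iff algebra_simps)
lift_definition uminus_vop :: "'a vop \<Rightarrow> 'a vop" is "\<lambda>S x n. - S x n"
  by (auto simp: fun_eq_iff algebra_simps)
lift_definition times_vop :: "'a vop \<Rightarrow> 'a vop \<Rightarrow> 'a vop" is "\<lambda>S T x. S (T x)"
  by auto
instance
proof
  show "(0 :: 'a vop) \<noteq> 1"
  proof
    assume "(0 :: 'a vop) = 1"
    hence "app (0 :: 'a vop) (\<lambda>n. 1) = app 1 (\<lambda>n. 1)" by simp
    thus False by (simp add: zero_vop.rep_eq one_vop.rep_eq fun_eq_iff)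
  qed
qed (transfer; auto simp: fun_eq_iff algebra_simps; fail)+
end

lemmas app_simps = zero_vop.rep_eq one_vop.rep_eq plus_vop.rep_eq minus_vop.rep_eq
  uminus_vop.rep_eq times_vop.rep_eq

lemma vop_eqI: "(\<And>x n. app S x n = app T x n) \<Longrightarrow> S = T"
  by (simp add: app_inject[symmetric] fun_eq_iff)

lemma app_sum: "app (sum f A) x n = (\<Sum>a\<in>A. app (f a) x n)"
  by (induction A rule: infinite_finite_induct) (simp_all add: app_simps)

lift_definition vscal :: "'k::field \<Rightarrow> 'k vop" is "\<lambda>c x n. c * x n"
  by (auto simp: fun_eq_iff algebra_simps)

lemma scalar_hom_vscal: "scalar_hom (vscal :: 'k::field \<Rightarrow> 'k vop)"
  unfolding scalar_hom_def
proof (intro conjI allI)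
  fix c :: 'k and T :: "'k vop"
  show "vscal c * T = T * vscal c"
    by (rule vop_eqI) (simp add: app_simps vscal.rep_eq app_scale)
qed (rule vop_eqI, simp add: app_simps vscal.rep_eq algebra_simps)+

text \<open>On the coefficients of a series in the variable x of site i, these are E_12 = d/dx, E_21
  = (al - be) x - x^2 d/dx, E_11 = al - x d/dx and E_22 = be + x d/dx. In this normalization 1 and x
  span a submodule if al - be = 1.\<close>

lift_definition eop :: "'k::field \<Rightarrow> 'k \<Rightarrow> nat \<Rightarrow> ix \<Rightarrow> ix \<Rightarrow> 'k vop" is
  "\<lambda>al be i a b x n.
     case (a, b) of
       (I1, I1) \<Rightarrow> (al - of_nat (n i)) * x n
     | (I2, I2) \<Rightarrow> (be + of_nat (n i)) * x n
     | (I1, I2) \<Rightarrow> of_nat (Suc (n i)) * x (n(i := Suc (n i)))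
     | (I2, I1) \<Rightarrow> (if n i = 0 then 0 else (al - be - of_nat (n i - 1)) * x (n(i := n i - 1)))"
  by (auto simp: fun_eq_iff algebra_simps split: ix.splits)

lemma eop_gl2:
  "eop al be i a b * eop al be i c d - eop al be i c d * eop al be i a b
     = (if b = c then eop al be i a d else 0) - (if a = d then eop al be i c b else 0)"
proof (rule vop_eqI)
  fix x n
  show "app (eop al be i a b * eop al be i c d - eop al be i c d * eop al be i a b) x n
     = app ((if b = c then eop al be i a d else 0) - (if a = d then eop al be i c b else 0)) x n"
    by (cases a; cases b; cases c; cases d; cases "n i")
      (simp_all add: app_simps eop.rep_eq algebra_simps fun_upd_idem)
qed

lemma eop_commute: "i \<noteq> j \<Longrightarrow> eop al be i a b * eop al' be' j c d = eop al' be' j c d * eop al be i a b"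
  by (rule vop_eqI, cases a; cases b; cases c; cases d)
    (simp_all add: app_simps eop.rep_eq algebra_simps fun_upd_twist)

text \<open>The evaluation homomorphism, which sends the matrix T(u) to 1 + E/u.\<close>

definition lop :: "'k::field \<Rightarrow> 'k \<Rightarrow> nat \<Rightarrow> ix \<Rightarrow> ix \<Rightarrow> 'k vop fps" where
  "lop al be i a b = Abs_fps (\<lambda>r. if r = 0 then (if a = b then 1 else 0)
     else if r = 1 then eop al be i a b else 0)"

lemma rtt_lop: "rtt (lop al be i)"
  unfolding rtt_def YmX_eq_iff
proof (intro allI conjI)
  fix a b c d r s
  let ?L = "lop al be i"
  show "fps_nth (fps_nth (inX (?L a b) * inY (?L c d) - inY (?L c d) * inX (?L a b)) s) 0 = 0"
    "fps_nth (fps_nth (inX (?L a b) * inY (?L c d) - inY (?L c d) * inX (?L a b)) 0) r = 0"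
    by (simp_all add: inXY_nth lop_def del: fps_mult_nth_0)
  have l: "fps_nth (?L a b) 0 = (if a = b then 1 else 0)" "fps_nth (?L a b) (Suc 0) = eop al be i a b"
    "r > 1 \<Longrightarrow> fps_nth (?L a b) r = 0" for a b r
    by (auto simp: lop_def)
  show "fps_nth (fps_nth (inX (?L a b) * inY (?L c d) - inY (?L c d) * inX (?L a b)) s) (Suc r) -
       fps_nth (fps_nth (inX (?L a b) * inY (?L c d) - inY (?L c d) * inX (?L a b)) (Suc s)) r =
       fps_nth (fps_nth (inX (?L c b) * inY (?L a d) - inY (?L c b) * inX (?L a d)) s) r"
    unfolding fps_sub_nth inXY_nth
  proof -
    consider "r = 0" "s = 1" | "r = 1" "s = 0" | "r > 1" | "s > 1" | "r = s" by linarith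
    thus "fps_nth (?L a b) (Suc r) * fps_nth (?L c d) s - fps_nth (?L c d) s * fps_nth (?L a b) (Suc r) -
      (fps_nth (?L a b) r * fps_nth (?L c d) (Suc s) - fps_nth (?L c d) (Suc s) * fps_nth (?L a b) r) =
      fps_nth (?L c b) r * fps_nth (?L a d) s - fps_nth (?L c b) s * fps_nth (?L a d) r"
    proof cases
      case 1
      thus ?thesis using eop_gl2[of al be i a b c d] by (simp add: l)
    next
      case 2
      have "- (eop al be i a b * eop al be i c d - eop al be i c d * eop al be i a b)
        = (if a = d then eop al be i c b else 0) - (if b = c then eop al be i a d else 0)"
        unfolding eop_gl2 by simp
      thus ?thesis using 2 by (simp add: l)
    next
      case 5
      show ?thesis
      proof (cases "r > 1")
        case False
        with 5 consider "r = 0" "s = 0" | "r = Suc 0" "s = Suc 0" by linarith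
        thus ?thesis by cases (simp_all add: l)
      qed (simp add: l 5)
    qed (simp_all add: l)
  qed
qed

primrec tprod :: "'k::field fps \<Rightarrow> (nat \<Rightarrow> 'k) \<Rightarrow> (nat \<Rightarrow> 'k) \<Rightarrow> nat \<Rightarrow> ix \<Rightarrow> ix \<Rightarrow> 'k vop fps" where
  "tprod g al be 0 = (\<lambda>a b. if a = b then Abs_fps (\<lambda>r. vscal (fps_nth g r)) else 0)"
| "tprod g al be (Suc N) = (\<lambda>a b. tprod g al be N a I1 * lop (al N) (be N) N I1 b
      + tprod g al be N a I2 * lop (al N) (be N) N I2 b)"

lemma tprod_commute:
  "m \<ge> N \<Longrightarrow> fps_nth (tprod g al be N a b) r * eop al' be' m c d = eop al' be' m c d * fps_nth (tprod g al be N a b) r"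
proof (induction N arbitrary: a b r)
  case 0
  show ?case by (auto intro: scalar_hom_simps(5)[OF scalar_hom_vscal, symmetric])
next
  case (Suc N)
  let ?e = "eop al' be' m c d"
  have l: "?e * fps_nth (lop (al N) (be N) N a b) r = fps_nth (lop (al N) (be N) N a b) r * ?e" for a b r
    using Suc.prems by (auto simp: lop_def intro!: eop_commute)
  have t: "?e * fps_nth (tprod g al be N a b) r = fps_nth (tprod g al be N a b) r * ?e" for a b r
    using Suc by simp
  have lf: "fps_const ?e * lop (al N) (be N) N a b = lop (al N) (be N) N a b * fps_const ?e"
    and tf: "fps_const ?e * tprod g al be N a b = tprod g al be N a b * fps_const ?e" for a b
    by (simp_all add: fps_eq_iff l t)
  have cm: "fps_const ?e * (f * g) = f * g * fps_const ?e"
    if "fps_const ?e * f = f * fps_const ?e" "fps_const ?e * g = g * fps_const ?e" for f g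
    using that by (metis mult.assoc)
  have "fps_const ?e * tprod g al be (Suc N) a b = tprod g al be (Suc N) a b * fps_const ?e"
    unfolding tprod.simps distrib_left distrib_right by (simp only: cm[OF tf lf])
  from arg_cong[OF this, of "\<lambda>f. fps_nth f r"] show ?case by simp
qed

lemma rtt_tprod: "rtt (tprod g al be N)"
proof (induction N)
  case 0
  have c: "vscal a * vscal b = vscal b * vscal a" for a b :: 'a
    by (rule scalar_hom_simps(5)[OF scalar_hom_vscal])
  show ?case unfolding rtt_def YmX_eq_iff by (auto simp: inXY_nth c simp del: fps_mult_nth_0)
next
  case (Suc N)
  have "fps_nth (tprod g al be N a b) r * fps_nth (lop (al N) (be N) N c d) s
      = fps_nth (lop (al N) (be N) N c d) s * fps_nth (tprod g al be N a b) r" for a b c d r s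
    by (auto simp: lop_def intro!: tprod_commute)
  from rtt_mult[OF Suc rtt_lop this] show ?case by simp
qed

definition vac :: "(nat \<Rightarrow> nat) \<Rightarrow> 'k::field" where
  "vac n = (if n = (\<lambda>i. 0) then 1 else 0)"

definition eig :: "'k::field vop fps \<Rightarrow> 'k fps \<Rightarrow> bool" where
  "eig f m \<longleftrightarrow> (\<forall>r. app (fps_nth f r) vac = (\<lambda>n. fps_nth m r * vac n))"

text \<open>Evaluation at the vacuum configuration, a linear functional, as a left eigenvector. Its
  eigenvalue 0 for f is what makes the vacuum expectation vanish on the right ideal
  \<open>Kf\<close>.\<close>

definition coeig :: "'k::field vop fps \<Rightarrow> 'k fps \<Rightarrow> bool" where
  "coeig f m \<longleftrightarrow> (\<forall>r x. app (fps_nth f r) x (\<lambda>i. 0) = fps_nth m r * x (\<lambda>i. 0))"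

lemma eig_add: "eig f m \<Longrightarrow> eig g m' \<Longrightarrow> eig (f + g) (m + m')"
  and eig_diff: "eig f m \<Longrightarrow> eig g m' \<Longrightarrow> eig (f - g) (m - m')"
  and coeig_add: "coeig f m \<Longrightarrow> coeig g m' \<Longrightarrow> coeig (f + g) (m + m')"
  by (auto simp: eig_def coeig_def app_simps algebra_simps)

lemma eig_mult:
  assumes f: "eig f m" and g: "eig g m'"
  shows "eig (f * g) (m * m')"
  unfolding eig_def
proof
  fix r
  have "app (fps_nth f t * fps_nth g s) vac = (\<lambda>n. fps_nth m t * fps_nth m' s * vac n)" for t s
    using f g by (simp add: app_simps eig_def app_scale) (simp add: mult_ac)
  thus "app (fps_nth (f * g) r) vac = (\<lambda>n. fps_nth (m * m') r * vac n)"
    by (simp add: fun_eq_iff fps_mult_nth app_sum sum_distrib_right)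
qed

lemma eig_mult_0:
  assumes "eig g 0"
  shows "eig (f * g) 0"
proof -
  have "app (fps_nth g s) vac = (\<lambda>n. 0)" for s using assms by (simp add: eig_def)
  hence "app (fps_nth f t) (app (fps_nth g s) vac) n = 0" for t s n by (simp add: app_zero)
  thus ?thesis unfolding eig_def by (intro allI ext) (simp add: fps_mult_nth app_sum app_simps)
qed

lemma coeig_mult_0: "coeig f 0 \<Longrightarrow> coeig (f * g) 0"
  unfolding coeig_def fps_mult_nth by (auto simp: app_sum app_simps)

lemma lin_nth: "fps_nth (1 + fps_const (c :: 'k::field) * fps_X) r = (if r = 0 then 1 else if r = 1 then c else 0)"
  by (cases r) auto

lemma lop_eig:
  "eig (lop al be i I1 I1) (1 + fps_const al * fps_X)" "eig (lop al be i I2 I2) (1 + fps_const be * fps_X)"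
  "eig (lop al be i I1 I2) 0" "coeig (lop al be i I1 I1) (1 + fps_const al * fps_X)"
  "coeig (lop al be i I2 I2) (1 + fps_const be * fps_X)" "coeig (lop al be i I2 I1) 0"
  unfolding eig_def coeig_def lin_nth
  by (auto simp: lop_def fun_eq_iff app_simps eop.rep_eq vac_def)

text \<open>The cross terms of the matrix product have to vanish. Entries built on the first N sites
  commute with site N, so t_12 can be moved next to the vacuum vector, and for the left eigenvector
  E_21 next to the vacuum functional.\<close>

lemma tprod_eig:
  "eig (tprod g al be N I1 I1) (g * (\<Prod>i<N. 1 + fps_const (al i) * fps_X))"
  "eig (tprod g al be N I2 I2) (g * (\<Prod>i<N. 1 + fps_const (be i) * fps_X))"
  "eig (tprod g al be N I1 I2) 0"
  "coeig (tprod g al be N I2 I1) 0"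
proof (induction N)
  case 0
  {
    case 1 show ?case by (simp add: eig_def vscal.rep_eq)
  next
    case 2 show ?case by (simp add: eig_def vscal.rep_eq)
  next
    case 3 show ?case by (simp add: eig_def app_simps)
  next
    case 4 show ?case by (simp add: coeig_def app_simps)
  }
next
  case (Suc N)
  let ?L = "lop (al N) (be N) N" and ?T = "tprod g al be N"
  have z: "eig (?L I1 I2) 0" by (rule lop_eig)
  {
    case 1
    have "eig (?T I1 I2 * ?L I2 I1) 0"
      unfolding eig_def
    proof
      fix r
      have "app (fps_nth (?T I1 I2) t * fps_nth (?L I2 I1) s) vac = (\<lambda>n. 0)" for t s
      proof (cases "s = 1")
        case True
        have "fps_nth (?T I1 I2) t * eop (al N) (be N) N I2 I1 = eop (al N) (be N) N I2 I1 * fps_nth (?T I1 I2) t"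
          by (rule tprod_commute) simp
        thus ?thesis using Suc(3) True by (simp add: lop_def app_simps eig_def app_zero)
      qed (simp add: lop_def app_simps app_zero)
      thus "app (fps_nth (?T I1 I2 * ?L I2 I1) r) vac = (\<lambda>n. fps_nth 0 r * vac n)"
        by (simp add: fps_mult_nth fun_eq_iff app_sum)
    qed
    from eig_add[OF eig_mult[OF Suc(1) lop_eig(1)] this] show ?case by (simp add: mult.assoc)
  next
    case 2
    from eig_add[OF eig_mult_0[OF z, of "?T I2 I1"] eig_mult[OF Suc(2) lop_eig(2)]]
    show ?case by (simp add: mult.assoc)
  next
    case 3
    from eig_add[OF eig_mult_0[OF z, of "?T I1 I1"] eig_mult[OF Suc(3) lop_eig(2)]]
    show ?case by simp
  next
    case 4
    have "coeig (?T I2 I2 * ?L I2 I1) 0"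
      unfolding coeig_def
    proof (intro allI)
      fix r x
      have "app (fps_nth (?T I2 I2) t * fps_nth (?L I2 I1) s) x (\<lambda>i. 0) = 0" for t s
      proof (cases "s = 1")
        case True
        have "fps_nth (?T I2 I2) t * eop (al N) (be N) N I2 I1 = eop (al N) (be N) N I2 I1 * fps_nth (?T I2 I2) t"
          by (rule tprod_commute) simp
        thus ?thesis using True by (simp add: lop_def app_simps eop.rep_eq)
      qed (simp add: lop_def app_simps app_zero)
      thus "app (fps_nth (?T I2 I2 * ?L I2 I1) r) x (\<lambda>i. 0) = fps_nth 0 r * x (\<lambda>i. 0)"
        by (simp add: fps_mult_nth app_sum)
    qed
    from coeig_add[OF coeig_mult_0[OF Suc(4), of "?L I1 I1"] this] show ?case by simp
  }
qed

lemma tprod_nth_0: "fps_nth g 0 = 1 \<Longrightarrow> fps_nth (tprod g al be N a b) 0 = (if a = b then 1 else 0)"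
proof (induction N arbitrary: a b)
  case 0
  thus ?case by (simp add: scalar_hom_simps(1)[OF scalar_hom_vscal])
next
  case (Suc N)
  thus ?case by (cases a; cases b) (simp_all add: lop_def)
qed

text \<open>The vacuum is annihilated by t_12, hence by e, and then d_2 acts on it as t_22 does.
  Dually, the vacuum functional annihilates t_21 and therefore f.\<close>

lemma vacuum_representation:
  fixes g :: "'k::field fps"
  assumes g: "fps_nth g 0 = 1"
  obtains h :: "'k yangian \<Rightarrow> 'k vop" where
    "\<And>x y. h (x + y) = h x + h y" "\<And>x y. h (x * y) = h x * h y" "h 1 = 1"
    "\<And>a. h (yangian_const a) = vscal a" "\<And>a b r. h (t_gen a b r) = fps_nth (tprod g al be N a b) r"
    "\<And>r. app (h (fps_nth e_series r)) vac = (\<lambda>n. 0)"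
    "\<And>r x. app (h (fps_nth f_series r)) x (\<lambda>i. 0) = 0"
    "\<And>r. app (h (fps_nth (d_series I1) r)) vac
       = (\<lambda>n. fps_nth (g * (\<Prod>i<N. 1 + fps_const (al i) * fps_X)) r * vac n)"
    "\<And>r. app (h (fps_nth (d_series I2) r)) vac
       = (\<lambda>n. fps_nth (g * (\<Prod>i<N. 1 + fps_const (be i) * fps_X)) r * vac n)"
proof -
  let ?T = "tprod g al be N"
  obtain h :: "'k yangian \<Rightarrow> 'k vop" where h:
    "\<And>x y. h (x + y) = h x + h y" "\<And>x y. h (x * y) = h x * h y" "h 1 = 1"
    "\<And>a. h (yangian_const a) = vscal a" "\<And>i j r. h (t_gen i j r) = fps_nth (?T i j) r"
    by (rule yangian_universal[OF scalar_hom_vscal rtt_tprod tprod_nth_0[OF g]]) (rule that)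
  have h0: "h 0 = 0" using h(1)[of 0 0] by simp
  have hm: "h (x - y) = h x - h y" for x y using h(1)[of "x - y" y] by (simp add: eq_diff_eq)
  have hs: "h (sum f A) = (\<Sum>a\<in>A. h (f a))" for f and A :: "nat set"
    by (induction A rule: infinite_finite_induct) (simp_all add: h0 h)
  define H where "H f = Abs_fps (\<lambda>n. h (fps_nth f n))" for f :: "'k yangian fps"
  have Hm: "H (f * g) = H f * H g" and Hd: "H (f - g) = H f - H g" for f g
    by (rule fps_ext, simp add: H_def fps_mult_nth hs h hm)+
  have Ht: "H (t_series a b) = ?T a b" for a b
    by (rule fps_ext) (simp add: H_def t_series_def h)
  have e: "eig (H e_series) 0"
    unfolding e_series_def Hm Ht by (intro eig_mult_0 tprod_eig)
  have f: "coeig (H f_series) 0"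
    unfolding f_series_def Hm Ht by (intro coeig_mult_0 tprod_eig)
  have d1: "eig (H (d_series I1)) (g * (\<Prod>i<N. 1 + fps_const (al i) * fps_X))"
    unfolding d_series.simps Ht by (rule tprod_eig)
  have "eig (H (d_series I2)) (g * (\<Prod>i<N. 1 + fps_const (be i) * fps_X) - 0)"
    unfolding d_series.simps Hd Hm Ht by (intro eig_diff eig_mult_0[OF e] tprod_eig)
  hence d2: "eig (H (d_series I2)) (g * (\<Prod>i<N. 1 + fps_const (be i) * fps_X))" by simp
  show ?thesis
    by (rule that[of h]) (use h e f d1 d2 in \<open>simp_all add: eig_def coeig_def H_def\<close>)
qed

section \<open>Polynomials in \<open>u\<close> as Laurent series\<close>

definition evu :: "'k::field fls \<Rightarrow> 'k poly \<Rightarrow> 'k fls" where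
  "evu w P = poly (map_poly fls_const P) w"

lemma evu_hom:
  fixes P Q :: "'k::field poly"
  shows "evu w (P + Q) = evu w P + evu w Q" "evu w (P * Q) = evu w P * evu w Q" "evu w 0 = 0" "evu w 1 = (1 :: 'k fls)"
  "evu w [:a, b:] = fls_const a + w * fls_const b" "evu w (smult a P) = fls_const a * evu w P"
proof -
  have h: "map_poly fls_const (P + Q) = map_poly fls_const P + map_poly fls_const Q" for P Q :: "'k poly"
    by (rule poly_eqI) (simp add: coeff_map_poly fls_plus_const)
  show "evu w (P + Q) = evu w P + evu w Q" by (simp add: evu_def h)
  have s: "map_poly fls_const (smult a P) = smult (fls_const a) (map_poly fls_const P)" for a and P :: "'k poly"
    by (rule poly_eqI) (simp add: coeff_map_poly)
  show "evu w (smult a P) = fls_const a * evu w P" by (simp add: evu_def s)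
  have c: "map_poly fls_const (pCons a P) = pCons (fls_const a) (map_poly fls_const P)" for a and P :: "'k poly"
    by (rule poly_eqI) (simp add: coeff_map_poly coeff_pCons split: nat.split)
  show "evu w (P * Q) = evu w P * evu w Q"
    by (induction P) (simp_all add: evu_def h s c algebra_simps)
  show "evu w 0 = 0" "evu w 1 = (1 :: 'k fls)" "evu w [:a, b:] = fls_const a + w * fls_const b"
    by (simp_all add: evu_def c one_pCons)
qed

lemma evu_prod: "evu w (prod f S) = (\<Prod>s\<in>S. evu w (f s))"
  by (induction S rule: infinite_finite_induct) (simp_all add: evu_hom)

lemma evu_pcompose: "evu w (pcompose P Q) = evu (evu w Q) P"
proof (induction P)
  case (pCons a P)
  have c: "map_poly fls_const (pCons a P) = pCons (fls_const a) (map_poly fls_const P)"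
    by (rule poly_eqI) (simp add: coeff_map_poly coeff_pCons split: nat.split)
  have "evu w [:a:] = fls_const a" using evu_hom(5)[of w a 0] by simp
  thus ?case using pCons unfolding pcompose_pCons evu_hom(1,2) by (simp add: evu_def c)
qed (simp add: evu_def)

lemma poly_in_u_evu: "poly_in_u P = evu fls_X_inv P"
  by (simp add: poly_in_u_def evu_def)

lemma evu_altdef:
  assumes "degree P \<le> d"
  shows "evu w P = (\<Sum>i\<le>d. fls_const (coeff P i) * w ^ i)"
proof -
  have "evu w P = (\<Sum>i\<le>degree P. fls_const (coeff P i) * w ^ i)"
    unfolding evu_def poly_altdef
    by (simp add: degree_map_poly coeff_map_poly)
  also have "\<dots> = (\<Sum>i\<le>d. fls_const (coeff P i) * w ^ i)"
    by (rule sum.mono_neutral_left) (use assms in \<open>auto simp: coeff_eq_0\<close>)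
  finally show ?thesis .
qed

lemma poly_in_u_nth: "fls_nth (poly_in_u P) n = (if n \<le> 0 then coeff P (nat (- n)) else 0)"
proof -
  have "fls_nth (poly_in_u P) n = (\<Sum>i\<le>degree P. fls_nth (fls_const (coeff P i) * fls_X_inv ^ i) n)"
    unfolding poly_in_u_evu evu_altdef[OF order.refl] by (rule fls_nth_sum)
  also have "\<dots> = (\<Sum>i\<le>degree P. if n = - int i then coeff P i else 0)"
    by (rule sum.cong) auto
  also have "\<dots> = (\<Sum>i\<le>degree P. if i = nat (- n) \<and> n \<le> 0 then coeff P i else 0)"
    by (rule sum.cong) auto
  also have "\<dots> = (if n \<le> 0 then coeff P (nat (- n)) else 0)"
    by (auto simp: coeff_eq_0)
  finally show ?thesis .
qed

lemma poly_in_u_inj: "poly_in_u P = poly_in_u Q \<longleftrightarrow> P = Q"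
proof
  assume *: "poly_in_u P = poly_in_u Q"
  show "P = Q"
  proof (rule poly_eqI)
    fix n
    from arg_cong[OF *, of "\<lambda>f. fls_nth f (- int n)"] show "coeff P n = coeff Q n"
      by (simp add: poly_in_u_nth)
  qed
qed simp

lemma poly_in_u_eq_0: "poly_in_u P = 0 \<longleftrightarrow> P = 0"
  using poly_in_u_inj[of P 0] by (simp add: poly_in_u_evu evu_hom)

lemma fls_is_poly_in_u:
  assumes "\<And>n. n > 0 \<Longrightarrow> fls_nth f n = 0"
  obtains Q where "f = poly_in_u Q"
proof -
  define Q where "Q = (\<Sum>i\<le>nat (- fls_subdegree f). monom (fls_nth f (- int i)) i)"
  have c: "coeff Q j = fls_nth f (- int j)" for j
  proof (cases "j \<le> nat (- fls_subdegree f)")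
    case False
    hence "fls_nth f (- int j) = 0" by (intro fls_eq0_below_subdegree) linarith
    thus ?thesis using False by (simp add: Q_def coeff_sum)
  qed (simp add: Q_def coeff_sum)
  have "f = poly_in_u Q"
    by (rule fls_eqI) (use assms in \<open>auto simp: poly_in_u_nth c not_le\<close>)
  thus ?thesis by (rule that)
qed

lemma fls_X_inv_X: "fls_X_inv * fls_X = (1 :: 'k::field fls)"
  by (simp add: fls_X_inv_times_conv_shift fls_X_conv_shift_1)

lemma fps_to_fls_prod: "fps_to_fls (prod f S) = (\<Prod>s\<in>S. fps_to_fls (f s :: 'k::field fps))"
  by (induction S rule: infinite_finite_induct) (simp_all add: fls_times_fps_to_fls)

text \<open>The product u^(-d) P(u), a power series in 1/u, to which \<open>sh\<close>
  applies.\<close>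

definition rpoly :: "nat \<Rightarrow> 'k::field poly \<Rightarrow> 'k fps" where
  "rpoly d P = (\<Sum>i\<le>d. fps_const (coeff P i) * fps_X ^ (d - i))"

lemma sh_power: "sh s (f ^ n) = sh s f ^ n"
  by (induction n) (simp_all add: sh_simps)

lemma fps_to_fls_sum: "fps_to_fls (sum f A) = (\<Sum>a\<in>A. fps_to_fls (f a))"
  by (induction A rule: infinite_finite_induct) simp_all

lemma xi_fls:
  "fps_to_fls (xi s :: 'k::field fps) \<noteq> 0"
  "inverse (fps_to_fls (xi s :: 'k fps)) = fls_X_inv - of_int s"
proof -
  have "fps_nth (xi s :: 'k fps) 1 = 1" by (simp add: xi_def geom_def)
  hence "xi s \<noteq> (0 :: 'k fps)" by force
  thus nz: "fps_to_fls (xi s :: 'k fps) \<noteq> 0" by simp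
  have "(fls_X_inv - of_int s) * fps_to_fls (xi s :: 'k fps)
      = (fls_X_inv * fls_X - of_int s * fls_X) * fps_to_fls (geom s)"
    unfolding xi_def fls_times_fps_to_fls by (simp add: algebra_simps)
  also have "\<dots> = fps_to_fls ((1 - of_int s * fps_X) * geom s)"
    unfolding fls_times_fps_to_fls by (simp add: fls_X_inv_X fls_times_fps_to_fls fps_to_fls_of_int)
  also have "\<dots> = 1" by (simp only: geom_inverse) simp
  finally show "inverse (fps_to_fls (xi s :: 'k fps)) = fls_X_inv - of_int s"
    by (intro inverse_unique) (simp only: mult.commute)
qed

lemma rpoly_sh:
  fixes P :: "'k::field poly"
  assumes "degree P \<le> d"
  shows "fps_to_fls (sh s (rpoly d P)) = fps_to_fls (xi s) ^ d * poly_in_u (pcompose P [:- of_int s, 1:])"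
proof -
  let ?w = "fps_to_fls (xi s :: 'k fps)"
  note w = xi_fls[of s, where ?'k = 'k]
  have "poly_in_u (pcompose P [:- of_int s, 1:]) = evu (inverse ?w) P"
    unfolding poly_in_u_evu evu_pcompose w(2) by (simp add: evu_hom fls_of_int)
  also have "?w ^ d * \<dots> = (\<Sum>i\<le>d. fls_const (coeff P i) * ?w ^ (d - i))"
    unfolding evu_altdef[OF assms] sum_distrib_left
    by (rule sum.cong) (use w(1) in \<open>auto simp: power_diff field_simps\<close>)
  also have "\<dots> = fps_to_fls (sh s (rpoly d P))"
    unfolding rpoly_def sh_sum fps_to_fls_sum
    by (simp add: sh_simps sh_power fls_times_fps_to_fls fps_to_fls_power)
  finally show ?thesis ..
qed

text \<open>\<open>sh\<close> acts on power series in 1/u, so both polynomials are first multiplied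
  by u^(-d); after the shift the common factor (u - s)^(-d) is cancelled.\<close>

lemma shift_ratio:
  fixes P Q :: "'k::field poly"
  assumes "poly_in_u P = fps_to_fls g * poly_in_u Q"
  shows "poly_in_u (pcompose P [:- of_int s, 1:]) = fps_to_fls (sh s g) * poly_in_u (pcompose Q [:- of_int s, 1:])"
proof -
  define d where "d = max (degree P) (degree Q)"
  have d: "degree P \<le> d" "degree Q \<le> d" by (simp_all add: d_def)
  have "fps_to_fls (rpoly d P) = fps_to_fls (g * rpoly d Q)"
    using rpoly_sh[OF d(1), of 0] rpoly_sh[OF d(2), of 0] assms
    by (simp add: sh_0 fls_times_fps_to_fls pcompose_idR)
  hence "rpoly d P = g * rpoly d Q" by simp
  hence "fps_to_fls (sh s (rpoly d P)) = fps_to_fls (sh s g) * fps_to_fls (sh s (rpoly d Q))"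
    by (simp add: sh_simps fls_times_fps_to_fls)
  thus ?thesis
    using xi_fls(1)[of s, where ?'k = 'k] unfolding rpoly_sh[OF d(1)] rpoly_sh[OF d(2)] by simp
qed

section \<open>Hilbert's Theorem 90 for the shift\<close>

definition tr :: "nat \<Rightarrow> 'k::field poly \<Rightarrow> 'k poly" where
  "tr j P = pcompose P [:of_nat j, 1:]"

lemma tr_hom: "tr j (P * Q) = tr j P * tr j Q" "tr j (P + Q) = tr j P + tr j Q" "tr j 0 = 0" "tr j 1 = 1"
  by (simp_all add: tr_def pcompose_mult pcompose_add pcompose_1)

lemma tr_prod: "tr j (prod f S) = (\<Prod>s\<in>S. tr j (f s))"
  by (induction S rule: infinite_finite_induct) (simp_all add: tr_hom)

lemma tr_sum: "tr j (sum f S) = (\<Sum>s\<in>S. tr j (f s))"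
  by (induction S rule: infinite_finite_induct) (simp_all add: tr_hom)

lemma tr_tr: "tr i (tr j P) = tr (i + j) P"
proof -
  have "pcompose [:of_nat j, 1:] [:of_nat i, 1:] = [:of_nat (i + j), 1 :: 'a:]"
    by (simp add: pcompose_pCons add.commute)
  thus ?thesis unfolding tr_def by (simp add: pcompose_assoc[symmetric])
qed

lemma tr_CHAR: "tr CHAR('k::field) P = (P :: 'k poly)"
  by (simp add: tr_def pcompose_idR)

lemma tr_eq_0: "tr j P = 0 \<longleftrightarrow> P = 0"
  unfolding tr_def by (subst pcompose_eq_0_iff) auto

text \<open>
  The classical resolvent \<open>\<Sum>\<^sub>c G\<^sub>c(u) \<theta>(u + c)\<close>, \<open>G\<^sub>c\<close> a partial norm, with denominators cleared.
  Some \<open>\<theta> = u\<^sup>j\<close> gives a nonzero value: a suitable combination over \<open>j\<close> isolates the term \<open>c = 0\<close>.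
\<close>

lemma hilbert90_shift:
  fixes A B :: "'k::field poly"
  assumes p: "CHAR('k) > 0" and A0: "A \<noteq> 0"
    and norm: "(\<Prod>c<CHAR('k). tr c A) = (\<Prod>c<CHAR('k). tr c B)"
  shows "\<exists>P. P \<noteq> 0 \<and> A * P = tr 1 P * B"
proof -
  let ?p = "CHAR('k)"
  define W where "W c = (\<Prod>j<c. tr j B) * (\<Prod>j=c..<?p. tr j A)" for c
  define R where "R \<theta> = (\<Sum>c<?p. W c * tr c \<theta>)" for \<theta>
  have W0: "W 0 = (\<Prod>j<?p. tr j A)" by (simp add: W_def atLeast0LessThan)
  have Wp: "W ?p = W 0" by (simp add: W_def norm W0 atLeast0LessThan)
  have step: "A * W (Suc c) = tr 1 (W c) * B" if "c < ?p" for c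
  proof -
    have "tr 1 (W c) = (\<Prod>j<c. tr (Suc j) B) * (\<Prod>j=c..<?p. tr (Suc j) A)"
      by (simp add: W_def tr_hom tr_prod tr_tr)
    also have "(\<Prod>j<c. tr (Suc j) B) * B = (\<Prod>j<Suc c. tr j B)"
      by (subst prod.lessThan_Suc_shift) (simp add: tr_def pcompose_idR mult.commute)
    hence "(\<Prod>j<c. tr (Suc j) B) * (\<Prod>j=c..<?p. tr (Suc j) A) * B
      = (\<Prod>j<Suc c. tr j B) * (\<Prod>j=c..<?p. tr (Suc j) A)" by (simp add: mult_ac)
    also have "(\<Prod>j=c..<?p. tr (Suc j) A) = (\<Prod>j=Suc c..<Suc ?p. tr j A)"
      by (rule prod.shift_bounds_Suc_ivl[symmetric])
    also have "\<dots> = (\<Prod>j=Suc c..<?p. tr j A) * A"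
      using that by (simp add: tr_CHAR)
    finally show ?thesis by (simp add: W_def mult_ac)
  qed
  have key: "A * R \<theta> = tr 1 (R \<theta>) * B" for \<theta>
  proof -
    have "tr 1 (R \<theta>) * B = (\<Sum>c<?p. tr 1 (W c) * B * tr (Suc c) \<theta>)"
      unfolding R_def tr_sum tr_hom tr_tr sum_distrib_right by (simp add: mult_ac)
    also have "\<dots> = (\<Sum>c<?p. A * (W (Suc c) * tr (Suc c) \<theta>))"
    proof (rule sum.cong[OF refl])
      fix c assume "c \<in> {..<?p}"
      hence "A * W (Suc c) = tr 1 (W c) * B" by (intro step) simp
      thus "tr 1 (W c) * B * tr (Suc c) \<theta> = A * (W (Suc c) * tr (Suc c) \<theta>)"
        by (simp only: mult.assoc[symmetric])
    qed
    also have "\<dots> = A * (\<Sum>c<?p. W (Suc c) * tr (Suc c) \<theta>)" by (simp add: sum_distrib_left)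
    also have "(\<Sum>c<?p. W (Suc c) * tr (Suc c) \<theta>) = R \<theta>"
    proof -
      have "W 0 * tr 0 \<theta> + (\<Sum>c<?p. W (Suc c) * tr (Suc c) \<theta>) = (\<Sum>c<Suc ?p. W c * tr c \<theta>)"
        by (rule sum.lessThan_Suc_shift[symmetric])
      also have "\<dots> = R \<theta> + W 0 * tr 0 \<theta>"
        by (simp add: R_def Wp tr_CHAR) (simp add: tr_def pcompose_idR)
      finally show ?thesis by simp
    qed
    finally show ?thesis ..
  qed
  have "\<exists>j. R ([:0, 1:] ^ j) \<noteq> 0"
  proof (rule ccontr)
    assume "\<not> ?thesis"
    hence R0: "R ([:0, 1:] ^ j) = 0" for j by simp
    define V :: "'k poly poly" where "V = (\<Prod>c=1..<?p. [:- [:of_nat c, 1:], 1:])"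
    have tx: "tr c ([:0, 1:] ^ j) = [:of_nat c, 1:] ^ j" for c j
      by (induction j) (simp_all only: power_0 power_Suc tr_hom, simp add: tr_def pcompose_pCons)
    have "0 = (\<Sum>j\<le>degree V. coeff V j * R ([:0, 1:] ^ j))" by (simp add: R0)
    also have "\<dots> = (\<Sum>c<?p. W c * poly V [:of_nat c, 1:])"
      unfolding R_def sum_distrib_left poly_altdef tx by (subst sum.swap) (simp add: mult_ac)
    also have "\<dots> = (\<Sum>c\<in>{0}. W c * poly V [:of_nat c, 1:])"
    proof (rule sum.mono_neutral_right)
      show "\<forall>c\<in>{..<?p} - {0}. W c * poly V [:of_nat c, 1:] = 0"
        by (auto simp: V_def poly_prod intro!: bexI)
    qed (use p in auto)
    also have "poly V [:of_nat 0, 1:] \<noteq> 0"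
      by (auto simp: V_def poly_prod of_nat_eq_0_iff_char_dvd dest: dvd_imp_le)
    hence "(\<Sum>c\<in>{0}. W c * poly V [:of_nat c, 1:]) \<noteq> 0"
      using A0 by (simp add: W0 tr_eq_0)
    finally show False by simp
  qed
  thus ?thesis using key by blast
qed

lemma prod_list_upt: "prod_list (map f [0..<n]) = (\<Prod>c<n. f c :: 'a::comm_monoid_mult)"
  by (induction n) (simp_all add: mult.commute)

text \<open>Restrictedness makes the product of all p shifts of l1/l2 equal to 1, so
  \<open>C\<close> and \<open>Q\<close> have the same norm and Hilbert 90 applies to them.\<close>

lemma restricted_rational:
  fixes l1 l2 :: "'k::field fps"
  assumes p: "CHAR('k) > 0" and r: "restricted_series l1" "restricted_series l2"
    and l0: "fps_nth l1 0 = 1" "fps_nth l2 0 = 1"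
    and C: "C \<noteq> 0" "poly_in_u C * fps_to_fls l2 = poly_in_u Q * fps_to_fls l1"
  shows "\<exists>P. Polynomial.lead_coeff P = 1 \<and>
    fps_to_fls l1 / fps_to_fls l2 = poly_in_u (pcompose P [:1, 1:]) / poly_in_u P"
proof -
  let ?p = "CHAR('k)"
  have nz: "fps_to_fls l1 \<noteq> 0" "fps_to_fls l2 \<noteq> 0" using l0 by auto
  define g where "g = l1 * inverse l2"
  have gl: "g * l2 = l1" using inverse_mult_eq_1[of l2] l0 by (simp add: g_def mult.assoc)
  hence fg: "fps_to_fls g * fps_to_fls l2 = fps_to_fls l1" by (simp add: fls_times_fps_to_fls[symmetric])
  have CQ: "poly_in_u C = fps_to_fls g * poly_in_u Q"
  proof -
    have "poly_in_u C * fps_to_fls l2 = fps_to_fls g * poly_in_u Q * fps_to_fls l2"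
      unfolding C(2) fg[symmetric] by (simp add: mult_ac)
    thus ?thesis using nz by simp
  qed
  have Q0: "Q \<noteq> 0" using CQ C(1) poly_in_u_eq_0 by (metis mult_zero_right)
  have "(\<Prod>c<?p. sh (int c) g) * (\<Prod>c<?p. sh (int c) l2) = (\<Prod>c<?p. sh (int c) l1)"
    unfolding prod.distrib[symmetric] sh_simps(3)[symmetric] gl ..
  hence gn: "(\<Prod>c<?p. sh (int c) g) = 1"
    using r by (simp add: restricted_series_def u_shift_prod_def u_shift_eq_sh prod_list_upt)
  have "poly_in_u (\<Prod>c<?p. pcompose C [:- of_int (int c), 1:])
      = (\<Prod>c<?p. fps_to_fls (sh (int c) g)) * poly_in_u (\<Prod>c<?p. pcompose Q [:- of_int (int c), 1:])"
    unfolding poly_in_u_evu evu_prod unfolding poly_in_u_evu[symmetric] prod.distrib[symmetric]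
    by (rule prod.cong) (simp_all only: shift_ratio[OF CQ])
  also have "(\<Prod>c<?p. fps_to_fls (sh (int c) g)) = fps_to_fls (\<Prod>c<?p. sh (int c) g)"
    by (rule fps_to_fls_prod[symmetric])
  finally have "(\<Prod>c<?p. pcompose C [:- of_int (int c), 1:]) = (\<Prod>c<?p. pcompose Q [:- of_int (int c), 1:])"
    by (simp add: gn poly_in_u_inj)
  \<comment> \<open>These norms run over u, u - 1, ..., u - p + 1; translation by p - 1 and reversal
    of the order turn them into products over u + c.\<close>
  hence "tr (?p - 1) (\<Prod>c<?p. pcompose C [:- of_int (int c), 1:]) = tr (?p - 1) (\<Prod>c<?p. pcompose Q [:- of_int (int c), 1:])"
    by (rule arg_cong)
  moreover have "tr (?p - 1) (\<Prod>c<?p. pcompose C [:- of_int (int c), 1:]) = (\<Prod>c<?p. tr c C)" for C :: "'k poly"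
  proof -
    have "tr (?p - 1) (pcompose C [:- of_int (int c), 1:]) = tr (?p - 1 - c) C" if "c < ?p" for c
    proof -
      have "pcompose [:- of_int (int c), 1:] [:of_nat (?p - 1), 1:] = [:of_nat (?p - 1 - c), 1 :: 'k:]"
        using that by (simp add: pcompose_pCons of_nat_diff)
      thus ?thesis by (simp add: tr_def pcompose_assoc[symmetric])
    qed
    hence "tr (?p - 1) (\<Prod>c<?p. pcompose C [:- of_int (int c), 1:]) = (\<Prod>c<?p. tr (?p - 1 - c) C)"
      unfolding tr_prod by (intro prod.cong) auto
    also have "\<dots> = (\<Prod>c<?p. tr c C)"
      by (rule prod.reindex_bij_witness[of _ "\<lambda>c. ?p - 1 - c" "\<lambda>c. ?p - 1 - c"]) auto
    finally show ?thesis .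
  qed
  ultimately have "(\<Prod>c<?p. tr c C) = (\<Prod>c<?p. tr c Q)" by simp
  from hilbert90_shift[OF p C(1) this] obtain P where P: "P \<noteq> 0" "C * P = tr 1 P * Q" by blast
  have pi: "poly_in_u (f * h) = poly_in_u f * poly_in_u h" for f h :: "'k poly"
    by (simp add: poly_in_u_evu evu_hom)
  have ratio: "fps_to_fls l1 / fps_to_fls l2 = poly_in_u (tr 1 P) / poly_in_u P"
  proof -
    have "poly_in_u (tr 1 P) * poly_in_u Q = fps_to_fls g * poly_in_u Q * poly_in_u P"
      using arg_cong[OF P(2), of poly_in_u, unfolded pi CQ] by (simp only: mult_ac)
    hence "poly_in_u Q * poly_in_u (tr 1 P) = poly_in_u Q * (fps_to_fls g * poly_in_u P)"
      by (simp only: mult_ac)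
    moreover have "poly_in_u Q \<noteq> 0" using Q0 poly_in_u_eq_0 by blast
    ultimately have "poly_in_u (tr 1 P) = fps_to_fls g * poly_in_u P" using mult_left_cancel by blast
    thus ?thesis using P(1) poly_in_u_eq_0[of P] nz by (simp add: field_simps fg[symmetric])
  qed
  define a where "a = inverse (Polynomial.lead_coeff P)"
  have a: "a \<noteq> 0" using P(1) by (simp add: a_def)
  have "Polynomial.lead_coeff (smult a P) = 1" using P(1) by (simp add: a_def)
  moreover have "poly_in_u (pcompose (smult a P) [:1, 1:]) / poly_in_u (smult a P) = poly_in_u (tr 1 P) / poly_in_u P"
    using a by (simp add: tr_def pcompose_smult poly_in_u_evu evu_hom)
  ultimately show ?thesis unfolding ratio by (intro exI[of _ "smult a P"]) simp
qed

section \<open>Linear factors and the weights of evaluation modules\<close>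

lemma monic_factor:
  fixes P :: "'k::alg_closed_field poly"
  assumes "Polynomial.lead_coeff P = 1"
  obtains a where "P = (\<Prod>i<degree P. [:a i, 1:])"
proof -
  have "P \<noteq> 0" using assms by auto
  from alg_closed_imp_factorization[OF this] obtain M
    where M: "size M = degree P" "P = (\<Prod>x\<in>#M. [:- x, 1:])" using assms by auto
  obtain xs where xs: "mset xs = M" using ex_mset by blast
  have "P = prod_list (map (\<lambda>x. [:- x, 1:]) xs)"
    using M(2) xs by (metis mset_map prod_mset_prod_list)
  also have "map (\<lambda>x. [:- x, 1:]) xs = map (\<lambda>i. [:- (xs ! i), 1:]) [0..<length xs]"
    by (rule nth_equalityI) simp_all
  also have "prod_list \<dots> = (\<Prod>i<length xs. [:- (xs ! i), 1:])" by (rule prod_list_upt)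
  also have "length xs = degree P" using M(1) xs by auto
  finally show ?thesis by (rule that)
qed

lemma linear_in_u: "poly_in_u [:a, 1:] = fls_X_inv * fps_to_fls (1 + fps_const a * fps_X)"
proof -
  have "fls_X_inv * fps_to_fls (1 + fps_const a * fps_X) = fls_X_inv + fls_const a * (fls_X_inv * fls_X)"
    by (simp add: fls_times_fps_to_fls algebra_simps)
  also have "fls_X_inv * fls_X = (1 :: 'a fls)" by (rule fls_X_inv_X)
  finally show ?thesis by (simp add: poly_in_u_evu evu_hom add.commute)
qed

lemma prod_linear_in_u:
  "poly_in_u (\<Prod>i<N. [:a i, 1:]) = fls_X_inv ^ N * fps_to_fls (\<Prod>i<N. 1 + fps_const (a i) * fps_X)"
  unfolding fps_to_fls_prod poly_in_u_evu evu_prod unfolding poly_in_u_evu[symmetric] linear_in_u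
  by (simp add: prod.distrib)

text \<open>The part of u^N q(u) with nonnegative exponents is a monic polynomial of degree N and
  splits into factors u + a_i; division by u^N gives the product.\<close>

lemma truncated_factorization:
  fixes q :: "'k::alg_closed_field fps"
  assumes q0: "fps_nth q 0 = 1"
  obtains a where "\<And>n. n \<le> N \<Longrightarrow> fps_nth (\<Prod>i<N. 1 + fps_const (a i) * fps_X) n = fps_nth q n"
proof -
  define P where "P = (\<Sum>n\<le>N. monom (fps_nth q n) (N - n))"
  have c: "coeff P j = (if j \<le> N then fps_nth q (N - j) else 0)" for j
  proof -
    have "coeff P j = (\<Sum>n\<le>N. if n = N - j \<and> j \<le> N then fps_nth q n else 0)"
      unfolding P_def coeff_sum by (rule sum.cong) auto
    thus ?thesis by (auto simp: )
  qed
  have dP: "degree P = N"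
    by (rule antisym) (auto intro!: degree_le le_degree simp: c q0)
  obtain a where a: "P = (\<Prod>i<N. [:a i, 1:])"
    using monic_factor[of P] by (auto simp: dP c q0)
  show ?thesis
  proof (rule that)
    fix n assume n: "n \<le> N"
    have "fls_nth (poly_in_u P) (int n - int N) = fps_nth (\<Prod>i<N. 1 + fps_const (a i) * fps_X) n"
      unfolding a prod_linear_in_u by (simp add: fls_X_inv_power_times_conv_shift)
    thus "fps_nth (\<Prod>i<N. 1 + fps_const (a i) * fps_X) n = fps_nth q n"
      using n by (simp add: poly_in_u_nth c nat_diff_distrib)
  qed
qed

lemma pcompose_prod_linear: "pcompose (\<Prod>i<(N::nat). [:a i, 1:]) [:1, 1:] = (\<Prod>i<N. [:a i + 1, 1 :: 'k::field:])"
proof -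
  have "tr 1 [:c, 1:] = [:c + 1, 1 :: 'k:]" for c by (simp add: tr_def pcompose_pCons)
  thus ?thesis using tr_prod[of 1 "\<lambda>i. [:a i, 1:]" "{..<N}"] by (simp add: tr_def)
qed

text \<open>If P is the product of the u + a_i, the quotient is the product of the (u + a_i + 1)/(u
  + a_i), each of them the weight quotient of a two-dimensional evaluation module. The series
  \<open>g\<close> collects what both weights share.\<close>

lemma ratio_product:
  fixes l1 l2 :: "'k::alg_closed_field fps"
  assumes l0: "fps_nth l1 0 = 1" "fps_nth l2 0 = 1" and P: "Polynomial.lead_coeff P = 1"
    and r: "fps_to_fls l1 / fps_to_fls l2 = poly_in_u (pcompose P [:1, 1:]) / poly_in_u P"
  obtains a :: "nat \<Rightarrow> 'k" and N g where "l1 = g * (\<Prod>i<N. 1 + fps_const (a i + 1) * fps_X)"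
    "l2 = g * (\<Prod>i<N. 1 + fps_const (a i) * fps_X)" "fps_nth g 0 = 1"
proof -
  obtain a where a: "P = (\<Prod>i<degree P. [:a i, 1:])" using monic_factor[OF P] by blast
  let ?N = "degree P"
  let ?A = "\<Prod>i<?N. 1 + fps_const (a i + 1) * fps_X" and ?B = "\<Prod>i<?N. 1 + fps_const (a i) * fps_X"
  have B0: "fps_nth (\<Prod>i<n. 1 + fps_const (b i) * fps_X) 0 = (1 :: 'k)" for b and n :: nat
    by (induction n) simp_all
  have nz: "fps_to_fls l2 \<noteq> 0" "fps_to_fls ?B \<noteq> 0" using l0 B0[of a ?N] by auto
  have X: "(fls_X_inv :: 'k fls) ^ ?N \<noteq> 0" by simp
  have "poly_in_u P = fls_X_inv ^ ?N * fps_to_fls ?B" by (subst a) (rule prod_linear_in_u)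
  moreover have "poly_in_u (pcompose P [:1, 1:]) = fls_X_inv ^ ?N * fps_to_fls ?A"
    by (subst a) (simp only: pcompose_prod_linear prod_linear_in_u)
  ultimately have "fps_to_fls l1 / fps_to_fls l2 = fps_to_fls ?A / fps_to_fls ?B"
    using r X by simp
  hence "fps_to_fls l1 * fps_to_fls ?B = fps_to_fls ?A * fps_to_fls l2" using nz by (simp add: field_simps)
  hence AB: "l1 * ?B = ?A * l2" by (simp add: fls_times_fps_to_fls[symmetric])
  define g where "g = l2 * inverse ?B"
  have iB: "inverse ?B * ?B = 1" by (rule inverse_mult_eq_1) (simp add: B0)
  have 1: "l1 = g * ?A"
  proof -
    have "l1 = l1 * ?B * inverse ?B" using iB by (simp add: mult.assoc mult.commute)
    thus ?thesis unfolding AB g_def by (simp add: mult_ac)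
  qed
  have 2: "l2 = g * ?B" unfolding g_def mult.assoc iB by simp
  show ?thesis by (rule that[OF 1 2]) (simp add: g_def l0 B0)
qed

section \<open>Finite dimension\<close>

inductive_set cspan :: "'k::field yangian set \<Rightarrow> 'k yangian set" for T where
  zero: "0 \<in> cspan T"
| step: "t \<in> T \<Longrightarrow> x \<in> cspan T \<Longrightarrow> yangian_const c * t + x \<in> cspan T"

lemma cspan_mono: "T \<subseteq> T' \<Longrightarrow> x \<in> cspan T \<Longrightarrow> x \<in> cspan T'"
  by (rotate_tac, induction x rule: cspan.induct) (auto intro: cspan.intros)

text \<open>Each functional adds at most one vector to \<open>T\<close>, an element on which it is
  nonzero while the functionals treated before vanish.\<close>

lemma finite_codimension:
  fixes \<theta> :: "'b \<Rightarrow> 'k::field yangian \<Rightarrow> 'k"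
  assumes "finite B"
    and add: "\<And>b x y. \<theta> b (x + y) = \<theta> b x + \<theta> b y"
    and scal: "\<And>b c x. \<theta> b (yangian_const c * x) = c * \<theta> b x"
  shows "\<exists>T. finite T \<and> (\<forall>y. \<exists>w\<in>cspan T. \<forall>b\<in>B. \<theta> b (y - w) = 0)"
  using assms(1)
proof induction
  case empty
  show ?case by (rule exI[of _ "{}"]) (auto intro: cspan.zero)
next
  case (insert b B)
  then obtain T where T: "finite T" "\<And>y. \<exists>w\<in>cspan T. \<forall>b\<in>B. \<theta> b (y - w) = 0" by blast
  have diff: "\<theta> b (x - y) = \<theta> b x - \<theta> b y" for b x y
    using add[of b "x - y" y] by simp
  show ?case
  proof (cases "\<exists>z. (\<forall>b\<in>B. \<theta> b z = 0) \<and> \<theta> b z \<noteq> 0")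
    case False
    thus ?thesis using T by (intro exI[of _ T]) (metis insert_iff)
  next
    case True
    then obtain z where z: "\<forall>b\<in>B. \<theta> b z = 0" "\<theta> b z \<noteq> 0" by blast
    show ?thesis
    proof (intro exI[of _ "insert z T"] conjI allI)
      fix y
      obtain w where w: "w \<in> cspan T" "\<forall>b\<in>B. \<theta> b (y - w) = 0" using T(2) by blast
      let ?w = "yangian_const (\<theta> b (y - w) / \<theta> b z) * z + w"
      have "?w \<in> cspan (insert z T)"
        using cspan_mono[OF subset_insertI w(1)] by (intro cspan.step) auto
      moreover have "\<forall>b\<in>insert b B. \<theta> b (y - ?w) = 0"
        using w(2) z by (simp add: diff add scal)
      ultimately show "\<exists>w\<in>cspan (insert z T). \<forall>b\<in>insert b B. \<theta> b (y - w) = 0" by blast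
    qed (simp add: T)
  qed
qed

lemma scalar_ring_hom:
  assumes p: "CHAR('k::field) > 0"
  shows "(\<lambda>c. restricted_proj (yangian_const c)) \<in> ring_hom (ring_of_type_algebra :: 'k ring) restricted_yangian"
proof -
  note h = ring_hom_memE[OF restricted_hom[OF p], simplified]
  show ?thesis by (rule ring_hom_memI) (simp_all add: h yconst(1-4))
qed

context
  fixes M :: "('k::field yangian set, 'm) module" and f L
  assumes p: "CHAR('k) > 0" and pr: "presents M f L"
begin

abbreviation V where "V \<equiv> restrict_scalars (\<lambda>c :: 'k. restricted_proj (yangian_const c)) M"

lemma vectorspace_V: "vectorspace ring_of_type_algebra V"
  by (rule vectorspace_restrict_scalars[OF presD(1)[OF pr] field_from_type_algebra scalar_ring_hom[OF p]])

lemma V_simps: "carrier V = range f" "f x \<oplus>\<^bsub>V\<^esub> f y = f (x + y)" "c \<odot>\<^bsub>V\<^esub> f x = f (yangian_const c * x)"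
  "\<zero>\<^bsub>V\<^esub> = f 0"
  by (simp_all add: restrict_scalars_def presD[OF pr] pres_0[OF pr])

lemma finite_dimensionalI:
  assumes "finite T" "\<And>y. \<exists>w\<in>cspan T. y - w \<in> L"
  shows "finite_dimensional M"
proof -
  interpret vectorspace "ring_of_type_algebra :: 'k ring" V by (rule vectorspace_V)
  have T: "f ` T \<subseteq> carrier V" by (auto simp: V_simps)
  interpret S: LinearCombinations.submodule "ring_of_type_algebra :: 'k ring" "span (f ` T)" V
    by (rule span_is_submodule[OF T])
  have "f w \<in> span (f ` T)" if "w \<in> cspan T" for w
    using that
  proof induction
    case zero
    show ?case using S.zero_closed by (simp only: V_simps)
  next
    case (step t x c)
    have "f t \<in> span (f ` T)" using in_own_span[OF T] step(1) by blast
    hence "c \<odot>\<^bsub>V\<^esub> f t \<oplus>\<^bsub>V\<^esub> f x \<in> span (f ` T)"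
      using step(3) S.m_closed S.smult_closed[of c] by simp
    thus ?case by (simp only: V_simps)
  qed
  moreover have "\<exists>w\<in>cspan T. f y = f w" for y
    using assms(2)[of y] pres_diff[OF pr] by blast
  ultimately have "f y \<in> span (f ` T)" for y by metis
  hence "carrier V \<subseteq> span (f ` T)" by (auto simp: V_simps)
  hence "span (f ` T) = carrier V" using S.subset by blast
  hence "fin_dim" unfolding fin_dim_def using assms(1) T by blast
  thus ?thesis by (simp add: finite_dimensional_def)
qed

lemma finite_dimensional_dependence:
  fixes y :: "nat \<Rightarrow> 'k yangian"
  assumes "finite_dimensional M"
  shows "\<exists>S c. finite S \<and> (\<exists>r\<in>S. c r \<noteq> 0) \<and> (\<Sum>r\<in>S. yangian_const (c r) * y r) \<in> L"
proof (cases "inj (\<lambda>r. f (y r))")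
  \<comment> \<open>Linear dependence is a property of sets of vectors, so a repetition within the
    family is treated apart.\<close>
  case False
  then obtain i j where ij: "i \<noteq> j" "f (y i) = f (y j)" by (auto simp: inj_def)
  have "(\<Sum>r\<in>{i, j}. yangian_const (if r = i then 1 else - 1) * y r) = y i - y j"
    using ij(1) by (simp add: yconst(1) yangian_const_uminus)
  moreover have "y i - y j \<in> L" using pres_diff[OF pr] ij(2) by blast
  ultimately show ?thesis
    by (intro exI[of _ "{i, j}"] exI[of _ "\<lambda>r. if r = i then 1 else - 1"]) auto
next
  case True
  interpret vectorspace "ring_of_type_algebra :: 'k ring" V by (rule vectorspace_V)
  have "fin_dim" using assms by (simp add: finite_dimensional_def)
  moreover have "infinite (range (\<lambda>r. f (y r)))" using True by (simp add: finite_image_iff)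
  moreover have "range (\<lambda>r. f (y r)) \<subseteq> carrier V" by (auto simp: V_simps)
  ultimately have "lin_dep (range (\<lambda>r. f (y r)))" using fin_dim_li_fin by blast
  then obtain Z a v where Z: "finite Z" "Z \<subseteq> range (\<lambda>r. f (y r))" "lincomb a Z = \<zero>\<^bsub>V\<^esub>" "v \<in> Z" "a v \<noteq> 0"
    unfolding lin_dep_def by auto
  define S where "S = (\<lambda>r. f (y r)) -` Z"
  have S: "finite S" "Z = (\<lambda>r. f (y r)) ` S"
    using Z(1,2) True by (auto simp: S_def finite_vimageI)
  have lc: "lincomb a ((\<lambda>r. f (y r)) ` S) = f (\<Sum>r\<in>S. yangian_const (a (f (y r))) * y r)" if "finite S" for S
    using that
  proof induction
    case empty
    show ?case by (simp add: lincomb_def V_simps)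
  next
    case (insert r S)
    have n: "f (y r) \<notin> (\<lambda>r. f (y r)) ` S" using insert(2) True by (auto simp: inj_def)
    have "lincomb a ((\<lambda>r. f (y r)) ` insert r S)
        = a (f (y r)) \<odot>\<^bsub>V\<^esub> f (y r) \<oplus>\<^bsub>V\<^esub> lincomb a ((\<lambda>r. f (y r)) ` S)"
      unfolding lincomb_def image_insert
      by (rule finsum_insert) (use insert n in \<open>auto simp: V_simps\<close>)
    thus ?case using insert by (simp add: V_simps)
  qed
  from Z(3) lc[OF S(1)] have "f (\<Sum>r\<in>S. yangian_const (a (f (y r))) * y r) = f 0"
    unfolding S(2) by (simp only: V_simps)
  hence "(\<Sum>r\<in>S. yangian_const (a (f (y r))) * y r) \<in> L" using pres_diff[OF pr] by simp
  moreover have "\<exists>r\<in>S. a (f (y r)) \<noteq> 0" using Z(4,5) unfolding S(2) by auto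
  ultimately show ?thesis using S(1) by (intro exI[of _ S] exI[of _ "\<lambda>r. a (f (y r))"]) blast
qed

end

section \<open>The classification\<close>

context verma
begin

section \<open>The vacuum functional and the Hankel relations\<close>

lemma vac_Kf:
  fixes h :: "'k yangian \<Rightarrow> 'k vop"
  assumes add: "\<And>x y. h (x + y) = h x + h y" and mult: "\<And>x y. h (x * y) = h x * h y"
    and F: "\<And>r x. app (h (fps_nth f_series r)) x (\<lambda>i. 0) = 0" and "k \<in> Kf"
  shows "app (h k) x (\<lambda>i. 0) = 0"
proof -
  have h0: "h 0 = 0" using add[of 0 0] by simp
  from \<open>k \<in> Kf\<close> show ?thesis
    by induction (simp_all add: h0 add mult app_simps F)
qed

lemma vac_lspan:
  fixes h :: "'k yangian \<Rightarrow> 'k vop"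
  assumes add: "\<And>x y. h (x + y) = h x + h y" and mult: "\<And>x y. h (x * y) = h x * h y"
    and U: "\<And>g. g \<in> U \<Longrightarrow> app (h g) vac = (\<lambda>n. 0)" and "j \<in> lspan U"
  shows "app (h j) vac = (\<lambda>n. 0)"
proof -
  have h0: "h 0 = 0" using add[of 0 0] by simp
  from \<open>j \<in> lspan U\<close> show ?thesis
    by induction (simp_all add: h0 add mult app_simps U app_zero)
qed

lemma vac_vgens:
  fixes h :: "'k yangian \<Rightarrow> 'k vop"
  assumes add: "\<And>x y. h (x + y) = h x + h y" and mult: "\<And>x y. h (x * y) = h x * h y"
    and const: "\<And>a. h (yangian_const a) = vscal a"
    and E: "\<And>r. app (h (fps_nth e_series r)) vac = (\<lambda>n. 0)"
    and d1: "\<And>r. app (h (fps_nth (d_series I1) r)) vac = (\<lambda>n. fps_nth m1 r * vac n)"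
    and d2: "\<And>r. app (h (fps_nth (d_series I2) r)) vac = (\<lambda>n. fps_nth m2 r * vac n)"
    and m: "\<And>r. r \<le> N \<Longrightarrow> fps_nth m1 r = fps_nth (lam I1) r" "\<And>r. r \<le> N \<Longrightarrow> fps_nth m2 r = fps_nth (lam I2) r"
    and j: "j \<in> lspan (vgens N)"
  shows "app (h j) vac = (\<lambda>n. 0)"
proof (rule vac_lspan[OF add mult _ j])
  have diff: "h (x - y) = h x - h y" for x y using add[of "x - y" y] by (simp add: eq_diff_eq)
  have d: "app (h (fps_nth (d_series i) r)) vac = (\<lambda>n. fps_nth (lam i) r * vac n)" if "r \<le> N" for i r
    using d1 d2 m that by (cases i) simp_all
  show "app (h g) vac = (\<lambda>n. 0)" if "g \<in> vgens N" for g
    using that unfolding vgens_def by (auto simp: E diff const app_simps vscal.rep_eq d)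
qed

text \<open>The equation A H = D is solved degree by degree, as both \<open>A\<close> and
  \<open>lam I1\<close> have constant term 1.\<close>

lemma wt_H: "wt H (lam I2 * inverse (lam I1))"
  unfolding wt_def
proof
  fix n
  let ?c = yangian_const and ?h = "lam I2 * inverse (lam I1)" and ?L = "lspan (verma_gens lam)"
  have lh: "lam I1 * ?h = lam I2"
    using inverse_mult_eq_1[of "lam I1"] lam0[of I1] by (simp add: mult_ac)
  have AH: "A * H = D" by (simp only: H_def mult.assoc[symmetric] A_inv mult_1_left)
  have cs: "?c (sum h T) = (\<Sum>t\<in>T. ?c (h t))" for h :: "nat \<Rightarrow> 'k" and T
    by (induction T rule: infinite_finite_induct) (simp_all add: yconst(2,3))
  show "fps_nth H n - ?c (fps_nth ?h n) \<in> ?L"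
  proof (induction n rule: less_induct)
    case (less n)
    let ?S = "\<Sum>t=1..n. fps_nth A t * (fps_nth H (n - t) - ?c (fps_nth ?h (n - t)))
        + ?c (fps_nth ?h (n - t)) * (fps_nth A t - ?c (fps_nth (lam I1) t))"
    have e1: "fps_nth D n = fps_nth H n + (\<Sum>t=1..n. fps_nth A t * fps_nth H (n - t))"
      unfolding AH[symmetric] fps_mult_nth[of A] by (simp add: sum.atLeast_Suc_atMost[of 0 n] AD_nth_0)
    have e2: "fps_nth (lam I2) n = fps_nth ?h n + (\<Sum>t=1..n. fps_nth (lam I1) t * fps_nth ?h (n - t))"
      by (subst lh[symmetric], subst fps_mult_nth) (simp add: sum.atLeast_Suc_atMost[of 0 n] lam0)
    have e3: "?S = (\<Sum>t=1..n. fps_nth A t * fps_nth H (n - t)) - ?c (\<Sum>t=1..n. fps_nth (lam I1) t * fps_nth ?h (n - t))"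
      unfolding cs sum_subtractf[symmetric]
    proof (rule sum.cong[OF refl])
      fix t
      have "?c (fps_nth ?h (n - t)) * ?c (fps_nth (lam I1) t) = ?c (fps_nth (lam I1) t * fps_nth ?h (n - t))"
        by (simp only: yconst(4)[symmetric] mult.commute)
      thus "fps_nth A t * (fps_nth H (n - t) - ?c (fps_nth ?h (n - t)))
        + ?c (fps_nth ?h (n - t)) * (fps_nth A t - ?c (fps_nth (lam I1) t))
        = fps_nth A t * fps_nth H (n - t) - ?c (fps_nth (lam I1) t * fps_nth ?h (n - t))"
        by (simp add: right_diff_distrib yconst(5)[of "fps_nth A t"])
    qed
    have "x - y = (x + u - (y + v)) - (u - v)" for x y u v :: "'k yangian" by simp
    hence "fps_nth H n - ?c (fps_nth ?h n) = (fps_nth D n - ?c (fps_nth (lam I2) n)) - ?S"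
      unfolding e1 e2 e3 yconst(3) .
    moreover have "?S \<in> ?L"
      using less wt_d[of I1]
      by (intro lid_sum[OF lid_lspan] lspan_add lspan_lmult) (auto simp: wt_def d_series.simps(1))
    moreover have "fps_nth D n - ?c (fps_nth (lam I2) n) \<in> ?L" using wt_d[of I2] unfolding wt_def by blast
    ultimately show ?case by (simp only: lidD(5)[OF lid_lspan])
  qed
qed

lemma lspan_verma_Fv: "lspan (verma_gens lam) \<subseteq> Fv"
  using lspan_mono[of "verma_gens lam" "p_center_gens \<union> verma_gens lam"] J_Fv unfolding J_def by auto

text \<open>Multiplication by e^(s) gives an element of \<open>Fv\<close> that agrees, modulo the
  weight conditions, with the negative of the scalar in question. A nonzero scalar in
  \<open>Fv\<close> would put 1 there.\<close>

lemma hankel_relation: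
  assumes one: "1 \<notin> Fv" and R: "finite R" "(\<Sum>r\<in>R. yangian_const (c r) * fps_nth F (Suc r)) \<in> Nmax" and s: "s \<ge> 1"
  shows "(\<Sum>r\<in>R. c r * fps_nth (lam I2 * inverse (lam I1)) (s + r)) = 0"
proof -
  let ?h = "lam I2 * inverse (lam I1)" and ?c = yangian_const
  have cs: "?c (sum h T) = (\<Sum>t\<in>T. ?c (h t))" for h :: "nat \<Rightarrow> 'k" and T
    by (induction T rule: infinite_finite_induct) (simp_all add: yconst(2,3))
  let ?X = "\<Sum>r\<in>R. ?c (c r) * (fps_nth F (Suc r) * fps_nth E s)"
  let ?Z = "\<Sum>r\<in>R. ?c (c r) * (fps_nth H (s + r) - ?c (fps_nth ?h (s + r)))"
  have "fps_nth E s * (\<Sum>r\<in>R. ?c (c r) * fps_nth F (Suc r)) \<in> Fv"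
    using R(2) unfolding Nmax_def by blast
  also have "fps_nth E s * (\<Sum>r\<in>R. ?c (c r) * fps_nth F (Suc r))
      = ?X - (\<Sum>r\<in>R. ?c (c r) * fps_nth H (s + r))"
    unfolding sum_distrib_left sum_subtractf[symmetric]
  proof (rule sum.cong[OF refl])
    fix r
    have "fps_nth E s * fps_nth F (Suc r) = fps_nth F (Suc r) * fps_nth E s - fps_nth H (s + r)"
      using E_F_comm[of s "Suc r"] s by (simp add: algebra_simps)
    moreover have "fps_nth E s * (?c (c r) * fps_nth F (Suc r)) = ?c (c r) * (fps_nth E s * fps_nth F (Suc r))"
      unfolding mult.assoc[symmetric] yconst(5)[of "fps_nth E s"] ..
    ultimately show "fps_nth E s * (?c (c r) * fps_nth F (Suc r))
      = ?c (c r) * (fps_nth F (Suc r) * fps_nth E s) - ?c (c r) * fps_nth H (s + r)"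
      by (simp add: right_diff_distrib)
  qed
  finally have 1: "?X - (\<Sum>r\<in>R. ?c (c r) * fps_nth H (s + r)) \<in> Fv" .
  have "?X \<in> J" using J_weight(1)[of s] s by (intro lid_sum[OF lid_J] lidD(3)[OF lid_J]) auto
  hence 2: "- ?X \<in> Fv" using lidD(4)[OF lid_J] J_Fv by blast
  have "?Z \<in> lspan (verma_gens lam)"
    using wt_H unfolding wt_def by (intro lid_sum[OF lid_lspan] lspan_lmult) blast
  hence 3: "?Z \<in> Fv" using lspan_verma_Fv by blast
  define t where "t = (\<Sum>r\<in>R. c r * fps_nth ?h (s + r))"
  have "- ?c t = (?X - (\<Sum>r\<in>R. ?c (c r) * fps_nth H (s + r))) + - ?X + ?Z"
    unfolding t_def cs yconst(4) by (simp add: right_diff_distrib sum_subtractf)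
  hence t: "?c (- t) \<in> Fv" using Fv_add[OF Fv_add[OF 1 2] 3] by (simp add: yangian_const_uminus)
  show ?thesis
  proof (rule ccontr)
    assume "(\<Sum>r\<in>R. c r * fps_nth ?h (s + r)) \<noteq> 0"
    hence t0: "t \<noteq> 0" by (simp add: t_def)
    obtain k j where kj: "?c (- t) = k + j" "k \<in> Kf" "j \<in> J" using t unfolding Fv_def by blast
    have "?c (- inverse t) * ?c (- t) = 1" using t0 by (simp add: yconst(4)[symmetric] yconst(1))
    hence "1 = ?c (- inverse t) * k + ?c (- inverse t) * j" by (simp add: kj(1) distrib_left)
    moreover have "?c b * k \<in> Kf" for b
      using kj(2)
    proof induction
      case (step r x y)
      have "?c b * (fps_nth F r * y) = fps_nth F r * (?c b * y)"
        unfolding mult.assoc[symmetric] yconst(5)[of "fps_nth F r"] ..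
      thus ?case using step by (simp add: distrib_left Kf.step)
    qed (simp add: Kf.zero)
    ultimately show False using FvI lidD(3)[OF lid_J kj(3)] one by metis
  qed
qed

end

text \<open>An equation expressing 1 as an element of \<open>Fv\<close> involves weight conditions
  up to some degree N only. In a representation with these weights up to degree N, its vacuum
  expectation reads 1 = 0.\<close>

lemma one_notin_Fv:
  fixes lam :: "ix \<Rightarrow> 'k::alg_closed_field fps"
  assumes p: "CHAR('k) > 0" and r: "restricted_tuple lam"
  shows "1 \<notin> verma.Fv lam"
proof
  interpret verma "TYPE('k)" lam by standard (use assms in \<open>simp_all add: restricted_tuple_def\<close>)
  assume "1 \<in> verma.Fv lam"
  then obtain N k j where kj: "1 = k + j" "k \<in> Kf" "j \<in> lspan (vgens N)"
    using Fv_bounded[of 1] r unfolding restricted_tuple_def by blast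
  \<comment> \<open>With the twist \<open>lam I2\<close> and all second weights zero, it remains to
    match the quotient \<open>q\<close> up to degree N by N linear factors.\<close>
  define q where "q = lam I1 * inverse (lam I2)"
  have q: "lam I2 * q = lam I1"
    using inverse_mult_eq_1[of "lam I2"] lam0[of I2] by (simp add: q_def mult_ac)
  have "fps_nth q 0 = 1" by (simp add: q_def lam0)
  then obtain a where a: "\<And>n. n \<le> N \<Longrightarrow> fps_nth (\<Prod>i<N. 1 + fps_const (a i) * fps_X) n = fps_nth q n"
    using truncated_factorization[of q N] by blast
  obtain h :: "'k yangian \<Rightarrow> 'k vop" where h:
    "\<And>x y. h (x + y) = h x + h y" "\<And>x y. h (x * y) = h x * h y" "h 1 = 1"
    "\<And>a. h (yangian_const a) = vscal a"
    "\<And>b c r. h (t_gen b c r) = fps_nth (tprod (lam I2) a (\<lambda>_. 0) N b c) r"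
    "\<And>r. app (h (fps_nth e_series r)) vac = (\<lambda>n. 0)"
    "\<And>r x. app (h (fps_nth f_series r)) x (\<lambda>i. 0) = 0"
    "\<And>r. app (h (fps_nth (d_series I1) r)) vac
       = (\<lambda>n. fps_nth (lam I2 * (\<Prod>i<N. 1 + fps_const (a i) * fps_X)) r * vac n)"
    "\<And>r. app (h (fps_nth (d_series I2) r)) vac
       = (\<lambda>n. fps_nth (lam I2 * (\<Prod>i<N. 1 + fps_const 0 * fps_X)) r * vac n)"
    by (rule vacuum_representation[OF lam0[of I2], of a "\<lambda>_. 0" N]) (rule that)
  have m1: "fps_nth (lam I2 * (\<Prod>i<N. 1 + fps_const (a i) * fps_X)) n = fps_nth (lam I1) n" if "n \<le> N" for n
    unfolding q[symmetric] fps_mult_nth by (rule sum.cong[OF refl]) (use a that in simp)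
  have "app (h j) vac = (\<lambda>n. 0)"
    by (rule vac_vgens[OF h(1,2,4,6,8,9) m1 _ kj(3)]) simp_all
  moreover have "app (h k) vac (\<lambda>i. 0) = 0" by (rule vac_Kf[OF h(1,2,7) kj(2)])
  ultimately have "app (h 1) vac (\<lambda>i. 0) = 0" unfolding kj(1) h(1) by (simp add: app_simps)
  thus False by (simp add: h(3) app_simps vac_def)
qed

text \<open>
  When \<open>al i = be i + 1\<close>, the factor \<open>al - be - 1\<close> of the lowering operator cuts each site down to
  the natural two-dimensional module.
\<close>

definition box :: "nat \<Rightarrow> (nat \<Rightarrow> nat) set" where
  "box N = {n. (\<forall>i<N. n i \<le> 1) \<and> (\<forall>i\<ge>N. n i = 0)}"

lemma finite_box: "finite (box N)"
proof -
  have "box N \<subseteq> (\<lambda>A i. if i \<in> A then 1 else 0) ` Pow {..<N}"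
  proof
    fix n assume n: "n \<in> box N"
    have "n = (\<lambda>i. if i \<in> {i. i < N \<and> n i = 1} then 1 else 0)"
    proof
      fix i
      show "n i = (if i \<in> {i. i < N \<and> n i = 1} then 1 else 0)"
        using n by (cases "i < N") (auto simp: box_def le_Suc_eq)
    qed
    thus "n \<in> (\<lambda>A i. if i \<in> A then 1 else 0) ` Pow {..<N}" by (rule image_eqI) auto
  qed
  thus ?thesis by (rule finite_subset) simp
qed

definition keeps :: "(nat \<Rightarrow> nat) set \<Rightarrow> 'k::field vop \<Rightarrow> bool" where
  "keeps B T \<longleftrightarrow> (\<forall>x. (\<forall>n. n \<notin> B \<longrightarrow> x n = 0) \<longrightarrow> (\<forall>n. n \<notin> B \<longrightarrow> app T x n = 0))"

lemma keeps_closed: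
  "keeps B 0" "keeps B 1" "keeps B (vscal c)" "keeps B S \<Longrightarrow> keeps B T \<Longrightarrow> keeps B (S + T)"
  "keeps B S \<Longrightarrow> keeps B T \<Longrightarrow> keeps B (S * T)"
  by (auto simp: keeps_def app_simps vscal.rep_eq)

lemma keeps_sum: "(\<And>s. s \<in> S \<Longrightarrow> keeps B (f s)) \<Longrightarrow> keeps B (sum f S)"
  by (induction S rule: infinite_finite_induct) (auto simp: keeps_closed)

lemma keeps_eop:
  assumes "i < N"
  shows "keeps (box N) (eop (be + 1) be i a b)"
  unfolding keeps_def
proof (intro allI impI)
  fix x :: "(nat \<Rightarrow> nat) \<Rightarrow> 'a" and n
  assume x: "\<forall>n. n \<notin> box N \<longrightarrow> x n = 0" and n: "n \<notin> box N"
  have 1: "n(i := Suc (n i)) \<notin> box N"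
  proof
    assume *: "n(i := Suc (n i)) \<in> box N"
    have "n j \<le> (n(i := Suc (n i))) j" for j by simp
    hence "n \<in> box N" using * assms unfolding box_def by (auto intro: order_trans)
    thus False using n by simp
  qed
  \<comment> \<open>From inside the box, site i leads to a point outside only by passing from 1 to
    2.\<close>
  have 2: "n i = 2" if "n i \<noteq> 0" "n(i := n i - 1) \<in> box N"
  proof -
    have "n j \<le> 1" if "j < N" "j \<noteq> i" for j
      using \<open>n(i := n i - 1) \<in> box N\<close> that unfolding box_def by (auto split: if_splits)
    moreover have "n j = 0" if "j \<ge> N" for j
      using \<open>n(i := n i - 1) \<in> box N\<close> that assms unfolding box_def by (auto split: if_splits)
    moreover have "n i - 1 \<le> 1" using that(2) assms unfolding box_def by (auto split: if_splits)
    ultimately have "\<not> n i \<le> 1" using n unfolding box_def by blast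
    thus ?thesis using \<open>n i - 1 \<le> 1\<close> by simp
  qed
  show "app (eop (be + 1) be i a b) x n = 0"
  proof -
    \<comment> \<open>The coefficient al - be - (n i - 1) becomes 1 - (2 - 1) = 0.\<close>
    have "of_nat (n i) = (2 :: 'a)" if "n i \<noteq> 0" "n(i := n i - 1) \<in> box N"
      using 2[OF that] by simp
    thus ?thesis using x n 1 by (cases a; cases b) (auto simp: eop.rep_eq)
  qed
qed

lemma keeps_tprod:
  "N \<le> N' \<Longrightarrow> keeps (box N') (fps_nth (tprod g (\<lambda>i. be i + 1) be N a b) r)"
proof (induction N arbitrary: a b r)
  case 0
  show ?case by (auto simp: keeps_closed)
next
  case (Suc N)
  have "keeps (box N') (fps_nth (lop (be N + 1) (be N) N a b) r)" for a b r
    using keeps_eop[of N N' "be N"] Suc.prems by (simp add: lop_def keeps_closed)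
  thus ?case using Suc by (auto simp: fps_mult_nth intro!: keeps_closed keeps_sum)
qed

theorem theorem3p11:
  fixes lam :: "ix \<Rightarrow> 'k::alg_closed_field fps"
  assumes "CHAR('k) > 0"
    and "restricted_tuple lam"
  shows "finite_dimensional (simple_module lam) \<longleftrightarrow>
    (\<exists>P :: 'k poly. Polynomial.lead_coeff P = 1 \<and>
       fps_to_fls (lam I1) / fps_to_fls (lam I2)
         = poly_in_u (pcompose P [:1, 1:]) / poly_in_u P)"
proof -
  interpret verma "TYPE('k)" lam by standard (use assms in \<open>simp_all add: restricted_tuple_def\<close>)
  have res: "restricted_series (lam i)" for i using assms(2) by (simp add: restricted_tuple_def)
  have one: "1 \<notin> Fv" by (rule one_notin_Fv[OF assms])
  obtain f where pr: "presents (simple_module lam) f Nmax" using presents_simple[OF one] by blast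
  show ?thesis
  proof
    assume "finite_dimensional (simple_module lam)"
    from finite_dimensional_dependence[OF assms(1) pr this, of "\<lambda>r. fps_nth F (Suc r)"]
    obtain R c where R: "finite R" "\<exists>r\<in>R. c r \<noteq> 0"
      "(\<Sum>r\<in>R. yangian_const (c r) * fps_nth F (Suc r)) \<in> Nmax" by blast
    let ?h = "lam I2 * inverse (lam I1)"
    \<comment> \<open>The dependence becomes a polynomial in u. The Hankel relations for all s > 0
      say that its product with lam2/lam1 has no negative powers of u, so this product is a
      polynomial as well.\<close>
    define Q1 where "Q1 = (\<Sum>r\<in>R. monom (c r) r)"
    have cQ: "coeff Q1 r = (if r \<in> R then c r else 0)" for r
      using R(1) by (simp add: Q1_def coeff_sum)
    have Q0: "Q1 \<noteq> 0"
    proof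
      assume "Q1 = 0"
      with R(2) show False using cQ by (metis coeff_0)
    qed
    have "poly_in_u Q1 = (\<Sum>r\<in>R. fls_const (c r) * fls_X_inv ^ r)"
    proof (rule fls_eqI)
      fix n
      have "fls_nth (\<Sum>r\<in>R. fls_const (c r) * fls_X_inv ^ r) n = (\<Sum>r\<in>R. if r = nat (- n) \<and> n \<le> 0 then c r else 0)"
        unfolding fls_nth_sum by (rule sum.cong) auto
      thus "fls_nth (poly_in_u Q1) n = fls_nth (\<Sum>r\<in>R. fls_const (c r) * fls_X_inv ^ r) n"
        using R(1) by (auto simp: poly_in_u_nth cQ)
    qed
    moreover have "fls_nth (fls_const b * fls_X_inv ^ r * fps_to_fls h) (int s) = b * fps_nth h (s + r)"
      for b :: 'k and h r s
    proof -
      have 1: "fls_X_inv ^ r * fps_to_fls h = fls_shift (int r) (fps_to_fls h)"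
        by (rule fls_X_inv_power_times_conv_shift)
      have "fls_nth (fls_const b * (fls_X_inv ^ r * fps_to_fls h)) (int s) = b * fps_nth h (s + r)"
        unfolding 1 by (simp add: nat_add_distrib)
      thus ?thesis by (simp only: mult.assoc)
    qed
    ultimately have "fls_nth (poly_in_u Q1 * fps_to_fls ?h) (int s) = (\<Sum>r\<in>R. c r * fps_nth ?h (s + r))" for s
      by (simp only: sum_distrib_right fls_nth_sum)
    hence "fls_nth (poly_in_u Q1 * fps_to_fls ?h) n = 0" if "n > 0" for n
      using hankel_relation[OF one R(1,3), of "nat n"] that by (metis int_nat_eq less_imp_le nat_0_iff not_le not_less_eq_eq zero_less_nat_eq One_nat_def Suc_le_eq)
    then obtain Q where Q: "poly_in_u Q1 * fps_to_fls ?h = poly_in_u Q" by (rule fls_is_poly_in_u)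
    have "?h * lam I1 = lam I2"
      using inverse_mult_eq_1[of "lam I1"] lam0[of I1] by (simp add: mult.assoc)
    hence "poly_in_u Q1 * fps_to_fls (lam I2) = poly_in_u Q * fps_to_fls (lam I1)"
      using Q by (metis fls_times_fps_to_fls mult.assoc)
    thus "\<exists>P. Polynomial.lead_coeff P = 1 \<and>
       fps_to_fls (lam I1) / fps_to_fls (lam I2) = poly_in_u (pcompose P [:1, 1:]) / poly_in_u P"
      by (rule restricted_rational[OF assms(1) res res lam0 lam0 Q0])
  next
    assume "\<exists>P. Polynomial.lead_coeff P = 1 \<and>
       fps_to_fls (lam I1) / fps_to_fls (lam I2) = poly_in_u (pcompose P [:1, 1:]) / poly_in_u P"
    then obtain a :: "nat \<Rightarrow> 'k" and N g where a: "lam I1 = g * (\<Prod>i<N. 1 + fps_const (a i + 1) * fps_X)"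
      "lam I2 = g * (\<Prod>i<N. 1 + fps_const (a i) * fps_X)" "fps_nth g 0 = 1"
      using ratio_product[OF lam0 lam0] by blast
    obtain h :: "'k yangian \<Rightarrow> 'k vop" where h:
      "\<And>x y. h (x + y) = h x + h y" "\<And>x y. h (x * y) = h x * h y" "h 1 = 1"
      "\<And>a. h (yangian_const a) = vscal a"
      "\<And>b c r. h (t_gen b c r) = fps_nth (tprod g (\<lambda>i. a i + 1) a N b c) r"
      "\<And>r. app (h (fps_nth e_series r)) vac = (\<lambda>n. 0)"
      "\<And>r x. app (h (fps_nth f_series r)) x (\<lambda>i. 0) = 0"
      "\<And>r. app (h (fps_nth (d_series I1) r)) vac = (\<lambda>n. fps_nth (lam I1) r * vac n)"
      "\<And>r. app (h (fps_nth (d_series I2) r)) vac = (\<lambda>n. fps_nth (lam I2) r * vac n)"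
      by (rule vacuum_representation[OF a(3), of "\<lambda>i. a i + 1" a N, folded a(1,2)]) (rule that)
    define \<psi> where "\<psi> b y = app (h y) vac b" for b y
    have \<psi>_add: "\<psi> b (x + y) = \<psi> b x + \<psi> b y" and \<psi>_scal: "\<psi> b (yangian_const c * x) = c * \<psi> b x" for b c x y
      by (simp_all add: \<psi>_def h app_simps vscal.rep_eq)
    have FvD: "\<psi> (\<lambda>i. 0) y = 0" if "y \<in> Fv" for y
    proof -
      from Fv_bounded[OF res that]
      obtain M k j where kj: "y = k + j" "k \<in> Kf" "j \<in> lspan (vgens M)" by blast
      \<comment> \<open>The weights agree in every degree here, so any bound \<open>M\<close> is
        admissible.\<close>
      have "app (h j) vac = (\<lambda>n. 0)"
        by (rule vac_vgens[OF h(1,2,4,6,8,9) refl refl kj(3)])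
      moreover have "app (h k) vac (\<lambda>i. 0) = 0" by (rule vac_Kf[OF h(1,2,7) kj(2)])
      ultimately show ?thesis by (simp add: \<psi>_def kj(1) h(1) app_simps)
    qed
    \<comment> \<open>\<open>Fv\<close> has codimension at most one and lies in the kernel of the
      vacuum functional, which is nonzero at 1; so the two coincide.\<close>
    have kernel: "y \<in> Fv" if "\<psi> (\<lambda>i. 0) y = 0" for y
    proof -
      obtain c where c: "y - yangian_const c \<in> Fv" using scalar_mod_Fv by blast
      have "\<psi> (\<lambda>i. 0) (yangian_const c * 1) = c" unfolding \<psi>_scal by (simp add: \<psi>_def h(3) app_simps vac_def)
      hence "c = 0" using FvD[OF c] \<psi>_add[of "\<lambda>i. 0" "y - yangian_const c" "yangian_const c"] that by simp
      thus ?thesis using c by (simp add: yconst(2))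
    qed
    have keeps: "keeps (box N) (h y)" for y
    proof (induction y rule: yangian_induct)
      case (gen i j r)
      show ?case unfolding h(5) by (rule keeps_tprod) simp
    qed (simp_all add: h keeps_closed)
    \<comment> \<open>The finitely many coordinates in the box decide whether the vector of y
      vanishes. If it does, so do the vectors of all multiples z y, and these lie in the kernel
      \<open>Fv\<close>.\<close>
    have Nmax: "y \<in> Nmax" if "\<forall>b\<in>box N. \<psi> b y = 0" for y
    proof -
      have "vac n = (0 :: 'k)" if "n \<notin> box N" for n
        using that by (auto simp: vac_def box_def)
      hence "app (h y) vac n = 0" if "n \<notin> box N" for n
        using keeps[of y] that unfolding keeps_def by blast
      hence "app (h y) vac = (\<lambda>n. 0)" using that unfolding \<psi>_def by blast
      hence "\<psi> (\<lambda>i. 0) (z * y) = 0" for z by (simp add: \<psi>_def h(2) app_simps app_zero)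
      thus ?thesis unfolding Nmax_def using kernel by blast
    qed
    obtain T where "finite T" "\<And>y. \<exists>w\<in>cspan T. \<forall>b\<in>box N. \<psi> b (y - w) = 0"
      using finite_codimension[where \<theta> = \<psi>, OF finite_box[of N] \<psi>_add \<psi>_scal] by blast
    with Nmax show "finite_dimensional (simple_module lam)"
      by (intro finite_dimensionalI[OF assms(1) pr, of T]) blast+
  qed
qed

end
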